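(* Let $l$ and $m$ be fixed integers with $l>m\ge 0$. Let $f(x)=(a_1x+b_1)(a_2x+b_2)$, where $a_1,a_2,b_1,b_2$ are positive integers with $\gcd(a_1,b_1)=\gcd(a_2,b_2)=1$ and $a_1b_2\ne a_2b_1$. Let $q=\mathrm{lcm}(a_1,a_2)$. Then, as the positive integer $n\to\infty$, $$\log \mathrm{lcm}_{mn<i\le ln}\{ f(i)\}=\frac{n}{\varphi(q)}\sum_{\substack{r=1\\ \gcd(r,q)=1}}^{q}A_r+o(n),$$ where $\varphi$ is Euler's totient function and, for each $r$ with $1\le r\le q$, $\gcd(r,q)=1$, $$A_r:=\begin{cases}\lambda_r(a_1,a_2,b_1,b_2) & \text{if } a_1\langle b_2r\rangle_{a_2}\ge a_2\langle b_1r\rangle_{a_1},\\ \lambda_r(a_2,a_1,b_2,b_1) & \text{if } a_1\langle b_2r\rangle_{a_2}< a_2\langle b_1r\rangle_{a_1}.\end{cases}$$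
   Context: For positive integers $a$ and $b$, $\langle b\rangle_a$ denotes the unique integer in $\{1,2,\dots,a\}$ congruent to $b$ modulo $a$. For an integer $t$, $S_t:=\{i\in\mathbb{N}: 0\le i\le t\}$ (with $\mathbb{N}$ the nonnegative integers); $S_t$ is empty when $t<0$, and a sum over an empty $S_t$ is $0$. With $l,m$ as in the claim, define for positive integers $x,y,z,w$ and integer $r$: $$g_r(x,y,z,w):=\Big\lfloor \frac{xyl+ym\langle zr\rangle_{x}-xl\langle wr\rangle_{y}}{xy(l-m)}\Big\rfloor,\qquad h_r(x,y,z,w):=\Big\lfloor \frac{xm\langle wr\rangle_{y}-yl\langle zr\rangle_{x}}{xy(l-m)}\Big\rfloor,$$ and $$\lambda_r(x,y,z,w):=\sum_{i\in S_{g_r(x,y,z,w)}}\frac{xl}{\langle zr\rangle_{x}+xi}-\sum_{i\in S_{g_r(x,y,z,w)-1}}\frac{ym}{\langle wr\rangle_{y}+yi}+\sum_{i\in S_{h_r(x,y,z,w)}}\Big(\frac{yl}{\langle wr\rangle_{y}+yi}- \frac{xm}{\langle zr\rangle_{x}+xi}\Big),$$ where $\lfloor\cdot\rfloor$ is the floor function. *)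

theory Defs
  imports Complex_Main "HOL-Library.Landau_Symbols" "HOL-Number_Theory.Number_Theory"
begin

text \<open>\<open>bracket a b\<close> is $\langle b \rangle_a$.\<close>

definition bracket :: "int \<Rightarrow> int \<Rightarrow> int" where
  "bracket a b = (THE c. c \<in> {1..a} \<and> [c = b] (mod a))"

lemma bracket_ex1:
  fixes a b :: int
  assumes "a > 0"
  shows "\<exists>!c. c \<in> {1..a} \<and> [c = b] (mod a)"
proof (rule ex1I[of _ "(b - 1) mod a + 1"])
  have "[(b - 1) mod a + 1 = (b - 1) + 1] (mod a)"
    by (intro cong_add) (auto simp: cong_def)
  then show "(b - 1) mod a + 1 \<in> {1..a} \<and> [(b - 1) mod a + 1 = b] (mod a)"
    using assms by (simp add: add1_zle_eq)
next
  fix c assume c: "c \<in> {1..a} \<and> [c = b] (mod a)"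
  then have "[c - 1 = b - 1] (mod a)"
    by (intro cong_diff) auto
  then have "(c - 1) mod a = (b - 1) mod a"
    by (simp add: cong_def)
  moreover have "(c - 1) mod a = c - 1"
    using c by (intro mod_pos_pos_trivial) auto
  ultimately show "c = (b - 1) mod a + 1" by simp
qed

definition S_set :: "int \<Rightarrow> nat set" where
  "S_set t = {i. int i \<le> t}"

definition g_floor :: "int \<Rightarrow> int \<Rightarrow> int \<Rightarrow> int \<Rightarrow> int \<Rightarrow> int \<Rightarrow> int \<Rightarrow> int" where
  "g_floor l m r x y z w =
     \<lfloor>real_of_int (x * y * l + y * m * bracket x (z * r) - x * l * bracket y (w * r))
        / real_of_int (x * y * (l - m))\<rfloor>"

definition h_floor :: "int \<Rightarrow> int \<Rightarrow> int \<Rightarrow> int \<Rightarrow> int \<Rightarrow> int \<Rightarrow> int \<Rightarrow> int" where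
  "h_floor l m r x y z w =
     \<lfloor>real_of_int (x * m * bracket y (w * r) - y * l * bracket x (z * r))
        / real_of_int (x * y * (l - m))\<rfloor>"

definition lambda_sum :: "int \<Rightarrow> int \<Rightarrow> int \<Rightarrow> int \<Rightarrow> int \<Rightarrow> int \<Rightarrow> int \<Rightarrow> real" where
  "lambda_sum l m r x y z w =
     (\<Sum>i\<in>S_set (g_floor l m r x y z w).
        real_of_int (x * l) / real_of_int (bracket x (z * r) + x * int i))
   - (\<Sum>i\<in>S_set (g_floor l m r x y z w - 1).
        real_of_int (y * m) / real_of_int (bracket y (w * r) + y * int i))
   + (\<Sum>i\<in>S_set (h_floor l m r x y z w).
        real_of_int (y * l) / real_of_int (bracket y (w * r) + y * int i)
      - real_of_int (x * m) / real_of_int (bracket x (z * r) + x * int i))"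

definition A_coeff :: "int \<Rightarrow> int \<Rightarrow> int \<Rightarrow> int \<Rightarrow> int \<Rightarrow> int \<Rightarrow> int \<Rightarrow> real" where
  "A_coeff l m a1 a2 b1 b2 r =
     (if a1 * bracket a2 (b2 * r) \<ge> a2 * bracket a1 (b1 * r)
      then lambda_sum l m r a1 a2 b1 b2
      else lambda_sum l m r a2 a1 b2 b1)"

end

theory Submission
  imports "HOL-Complex_Analysis.Complex_Analysis" "HOL-Computational_Algebra.Squarefree"
    "HOL-Real_Asymp.Real_Asymp" Defs
begin

text \<open>A prime \<open>p\<close> not exceeding \<open>O(sqrt n)\<close> contributes \<open>O(ln n)\<close> to the logarithm of the least common
  multiple, and a larger one divides it at most once (up to finitely many exceptions). Hence the logarithm is, up to \<open>o(n)\<close>, the sum of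
  \<open>ln p\<close> over the primes dividing some \<open>f i\<close>. Let \<open>r p = 1\<close> modulo \<open>q\<close>, and write \<open>u\<close> and \<open>v\<close> for the brackets of
  \<open>b\<^sub>1 r\<close> and \<open>b\<^sub>2 r\<close> divided by \<open>a\<^sub>1\<close> and \<open>a\<^sub>2\<close>. Up to \<open>O(1)\<close> many values of \<open>i\<close>, the prime \<open>p\<close> divides some
  \<open>f i\<close> iff \<open>p\<close> lies in an interval from \<open>m n / s\<close> to \<open>l n / s\<close> for some \<open>s\<close> among \<open>u, v, u + 1, v + 1, \<dots>\<close>.
  Consecutive intervals leave only finitely many gaps, which are counted by the two floor functions, so the prime number
  theorem in arithmetic progressions gives the claim.

  That theorem is obtained from Newman's Tauberian theorem for the series of \<open>\<mu>(n) \<chi>(n) n\<^sup>-\<^sup>s\<close>, which yields that \<open>\<mu> \<chi>\<close> has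
  mean value zero; Axer's method transfers this to \<open>\<Lambda> \<chi> = (\<mu> \<chi>) * (\<chi> ln)\<close>, and for the trivial character to
  \<open>\<Lambda> - 1 = \<mu> * (ln - \<tau>)\<close> by means of Dirichlet's divisor problem. The non-vanishing of \<open>L(s, \<chi>)\<close> on the line \<open>Re s = 1\<close> comes
  from the \<open>3-4-1\<close> inequality, and at \<open>s = 1\<close> for real \<open>\<chi>\<close> from Monsky's argument with Lambert series.\<close>

section \<open>Newman's Tauberian theorem\<close>

text \<open>Working with \<mu> instead of \<Lambda> keeps all coefficients bounded by 1, so Newman's
  theorem needs no Chebyshev bound, and the pole of zeta becomes a zero of its reciprocal; the only
  analytic input left is the absence of zeros. The return to \<Lambda> is elementary, but Axer's
  method needs a second factor with partial sums O(sqrt y). For a nontrivial character these are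
  even O(ln y); for the trivial one the leading terms y ln y - y of the sums of ln must first be
  cancelled by the divisor function and the constant 2 \<gamma>.

  The condition r p = 1 explains the brackets: if a i + b = p k, then k is congruent to b r modulo
  a, and being positive it runs through \<open>bracket a (b * r) + a * j\<close> with j >= 0.
  Division by a turns m n < i + b / a <= l n into a condition on p times u + j or v + j. As u and v
  lie in (0, 1], the relation u <= v already orders u, v, u + 1, v + 1 and so on; the two cases of
  the coefficient only exchange the factors to reach this order.\<close>

lemma powr_mvt:
  fixes y :: real and n :: nat
  assumes "n \<ge> 1"
  obtains z where "real n < z" "z < real (Suc n)" "real (Suc n) powr y - real n powr y = y * z powr (y - 1)"
proof -
  have "\<exists>z>real n. z < real (Suc n) \<and>
      real (Suc n) powr y - real n powr y = (real (Suc n) - real n) * (y * z powr (y - 1))"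
    using assms by (intro MVT2) (auto intro!: derivative_eq_intros)
  then show ?thesis using that by auto
qed

lemma powr_neg_le_diff:
  fixes x :: real and n :: nat
  assumes "x > 0" "n \<ge> 1"
  shows "real (Suc n) powr (-1 - x) \<le> (real n powr (-x) - real (Suc n) powr (-x)) / x"
proof -
  obtain z where z: "real n < z" "z < real (Suc n)"
    "real (Suc n) powr (-x) - real n powr (-x) = - x * z powr (- x - 1)"
    using powr_mvt[OF assms(2)] by metis
  have "real (Suc n) powr (-1 - x) \<le> z powr (- 1 - x)"
    using z assms by (intro powr_mono2') auto
  moreover have "- x - 1 = -1 - x" by simp
  ultimately have "x * real (Suc n) powr (-1 - x) \<le> real n powr (-x) - real (Suc n) powr (-x)"
    using z(3) assms(1) by (metis (no_types, opaque_lifting) minus_diff_eq mult_le_cancel_left_pos mult_minus_left neg_equal_iff_equal)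
  then show ?thesis using assms by (simp add: field_simps)
qed

lemma powr_le_diff_lower:
  fixes y :: real and n :: nat
  assumes "y > 0" "y \<le> 1"
  shows "real (Suc n) powr (y - 1) \<le> (real (Suc n) powr y - real n powr y) / y"
proof (cases "n = 0")
  case True
  then show ?thesis using assms by (simp add: field_simps)
next
  case False
  then obtain z where z: "real n < z" "z < real (Suc n)"
    "real (Suc n) powr y - real n powr y = y * z powr (y - 1)"
    using powr_mvt[of n] by (metis One_nat_def Suc_leI bot_nat_0.not_eq_extremum)
  have "real (Suc n) powr (y - 1) \<le> z powr (y - 1)"
    using z assms False by (intro powr_mono2') auto
  then show ?thesis using z assms by (simp add: field_simps)
qed

lemma powr_le_diff_upper:
  fixes y :: real and n :: nat
  assumes "y \<ge> 1" "n \<ge> 1"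
  shows "real n powr (y - 1) \<le> (real (Suc n) powr y - real n powr y) / y"
proof -
  obtain z where z: "real n < z" "z < real (Suc n)"
    "real (Suc n) powr y - real n powr y = y * z powr (y - 1)"
    using powr_mvt[OF assms(2)] by metis
  have "real n powr (y - 1) \<le> z powr (y - 1)"
    using z assms by (intro powr_mono2) auto
  then show ?thesis using z assms by (simp add: field_simps)
qed

text \<open>Comparison with the telescoping sum of n^y / y. For y <= 1 the summand decreases and the
  comparison is direct; for y > 1 it increases, so the comparison reaches only N - 1, and the last
  term N^(y - 1) = N^y / N is the source of 1 / N.\<close>

lemma sum_powr_le:
  fixes y :: real
  assumes "y > 0" "N \<ge> 1"
  shows "(\<Sum>n\<le>N. real n powr (y - 1)) \<le> real N powr y * (1 / y + 1 / real N)"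
proof (cases "y \<le> 1")
  case True
  have "(\<Sum>n\<le>M. real n powr (y - 1)) \<le> real M powr y / y" for M
  proof (induction M)
    case (Suc M)
    then show ?case using powr_le_diff_lower[OF assms(1) True, of M] by (simp add: diff_divide_distrib)
  qed auto
  from this[of N] have "(\<Sum>n\<le>N. real n powr (y - 1)) \<le> real N powr y / y" .
  also have "\<dots> \<le> real N powr y * (1 / y + 1 / real N)" by (simp add: distrib_left)
  finally show ?thesis .
next
  case False
  have "(\<Sum>n\<le>M. real n powr (y - 1)) \<le> real (Suc M) powr y / y" for M
  proof (induction M)
    case 0
    then show ?case using assms by simp
  next
    case (Suc M)
    then show ?case using powr_le_diff_upper[of y "Suc M"] False by (simp add: diff_divide_distrib)
  qed
  from this[of "N-1"] have "(\<Sum>n\<le>N-1. real n powr (y - 1)) \<le> real N powr y / y" using assms by simp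
  moreover have "(\<Sum>n\<le>N. real n powr (y - 1)) = (\<Sum>n\<le>N-1. real n powr (y - 1)) + real N powr (y - 1)"
    using assms by (cases N) auto
  moreover have "real N powr (y - 1) = real N powr y / real N"
    using assms by (simp add: powr_diff)
  ultimately show ?thesis by (simp add: algebra_simps)
qed

lemma sums_powr_tail_le:
  fixes x :: real
  assumes "x > 0" "N \<ge> 1"
  shows "(\<Sum>n<M. real (n + Suc N) powr (-1 - x)) \<le> real N powr (-x) / x"
proof -
  have "(\<Sum>n<M. real (n + Suc N) powr (-1 - x)) \<le> (real N powr (-x) - real (M + N) powr (-x)) / x"
  proof (induction M)
    case (Suc M)
    then show ?case using powr_neg_le_diff[OF assms(1), of "M + N"] assms
      by (simp add: diff_divide_distrib)
  qed auto
  also have "\<dots> \<le> real N powr (-x) / x" using assms by (simp add: divide_right_mono)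
  finally show ?thesis .
qed

section \<open>Newman's kernel and the contour\<close>

lemma norm_nat_powr: "norm (of_nat n powr s :: complex) = real n powr Re s"
  by (cases "n = 0") (auto simp: norm_powr_real_powr)

text \<open>On the circle R^2 is w times its conjugate, so the kernel equals (w + cnj w) / R^2. Its
  factor Re w cancels the 1 / Re w that the estimates of tails and partial sums produce.\<close>

lemma norm_newman_kernel:
  assumes "norm w = R" "R > 0"
  shows "norm ((1 + w\<^sup>2 / of_real R ^ 2) / w) = 2 * \<bar>Re w\<bar> / R\<^sup>2"
proof -
  have w0: "w \<noteq> 0" using assms by auto
  have R2: "of_real R ^ 2 = w * cnj w" using assms by (simp add: complex_norm_square[symmetric])
  have "cnj w \<noteq> 0" using w0 by simp
  then have "(1 + w\<^sup>2 / of_real R ^ 2) / w = (w + cnj w) / of_real R ^ 2"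
    unfolding R2 using w0 by (simp add: field_simps power2_eq_square)
  also have "w + cnj w = of_real (2 * Re w)" by (rule complex_add_cnj)
  finally show ?thesis using assms by (simp add: norm_divide norm_power norm_mult)
qed

lemma has_contour_integral_arc_inverse: 
  assumes "R > 0"
  shows "((\<lambda>w. c / w) has_contour_integral (c * \<i> * of_real (t - s))) (part_circlepath 0 R s t)"
proof -
  have *: "((\<lambda>x. c * \<i> * of_real (t - s)) has_integral (c * \<i> * of_real (t - s))) {0..1::real}"
    using has_integral_const_real[of "c * \<i> * of_real (t - s)" 0 1] by simp
  have "c * \<i> * of_real (t - s) = c / part_circlepath 0 R s t x * 
      vector_derivative (part_circlepath 0 R s t) (at x within {0..1})" if "x \<in> {0..1}" for x
    using assms that by (subst vector_derivative_part_circlepath01)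
        (auto simp: part_circlepath_def linepath_def)
  from has_integral_eq[OF this *, of "\<lambda>x. x"] show ?thesis unfolding has_contour_integral_def by blast
qed

text \<open>A substitute for the residue theorem: (A w - A 0) / w extends to an entire function,
  whose integral over the closed path of the two arcs is zero, and A 0 / w contributes A 0 times
  \<i> times the angle of each arc. The arcs are kept apart because they are estimated by different
  means.\<close>

lemma contour_integral_two_half_circles:
  assumes hol: "A holomorphic_on UNIV" and R: "R > 0"
  shows "contour_integral (part_circlepath 0 R (-pi/2) (pi/2)) (\<lambda>w. A w / w) +
         contour_integral (part_circlepath 0 R (pi/2) (3*pi/2)) (\<lambda>w. A w / w) = 2 * pi * \<i> * A 0"
proof -
  define B where "B = (\<lambda>z. if z = 0 then deriv A 0 else (A z - A 0) / (z - 0))"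
  have holB: "B holomorphic_on UNIV" unfolding B_def by (rule pole_lemma_open[OF hol]) auto
  have cB: "continuous_on T B" for T using holB holomorphic_on_imp_continuous_on continuous_on_subset by blast
  let ?p = "part_circlepath 0 R (-pi/2) (pi/2)" and ?m = "part_circlepath 0 R (pi/2) (3*pi/2)"
  have j: "pathfinish ?p = pathstart ?m" "pathfinish ?m = pathstart ?p"
    by (simp_all add: exp_eq)
  have int: "B contour_integrable_on part_circlepath 0 R s t" for s t
    by (rule contour_integrable_continuous_part_circlepath[OF cB])
  have "(B has_contour_integral 0) (?p +++ ?m)"
    by (rule Cauchy_theorem_convex_simple[OF holB]) (use j in auto)
  moreover have "(B has_contour_integral (contour_integral ?p B + contour_integral ?m B)) (?p +++ ?m)"
    using int by (intro has_contour_integral_join) (auto intro: has_contour_integral_integral)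
  ultimately have 0: "contour_integral ?p B + contour_integral ?m B = 0"
    using contour_integral_unique by metis
  have "contour_integral (part_circlepath 0 R s t) (\<lambda>w. A w / w) = 
        contour_integral (part_circlepath 0 R s t) B + A 0 * \<i> * of_real (t - s)" for s t
  proof (rule contour_integral_unique)
    have "((\<lambda>w. B w + A 0 / w) has_contour_integral
        (contour_integral (part_circlepath 0 R s t) B + A 0 * \<i> * of_real (t - s))) (part_circlepath 0 R s t)"
      by (intro has_contour_integral_add has_contour_integral_integral int has_contour_integral_arc_inverse R)
    then show "((\<lambda>w. A w / w) has_contour_integral
        (contour_integral (part_circlepath 0 R s t) B + A 0 * \<i> * of_real (t - s))) (part_circlepath 0 R s t)"
    proof (rule has_contour_integral_eq)
      fix x assume "x \<in> path_image (part_circlepath 0 R s t)"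
      then have "norm x = R" using path_image_part_circlepath_subset'[of R 0 s t] R by auto
      then show "B x + A 0 / x = A x / x" using R by (auto simp: B_def diff_divide_distrib)
    qed
  qed
  from this[of "-pi/2" "pi/2"] this[of "pi/2" "3*pi/2"] 0 show ?thesis
    by (simp add: algebra_simps)
qed


text \<open>Since z^2 = - R^2, the kernel factors as (w - z) (w + z) / R^2. At parameter u on the
  segment w - z is proportional to u, and so is Re w = - u d; hence the kernel is O(\<bar>Re
  w\<bar>), even near the endpoint on the imaginary axis.\<close>

lemma newman_kernel_segment_bound:
  assumes "w \<in> closed_segment z (- of_real d)" "z = \<i> * of_real R \<or> z = - (\<i> * of_real R)" "R > 0" "d > 0"
  shows "Re w \<le> 0" "norm (1 + w\<^sup>2 / of_real R ^ 2) \<le> (d + R) * (2 * R + d) / (d * R\<^sup>2) * \<bar>Re w\<bar>"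
proof -
  obtain u where u: "0 \<le> u" "u \<le> 1" "w = (1 - u) *\<^sub>R z + u *\<^sub>R (- of_real d)"
    using assms(1) by (auto simp: closed_segment_def)
  have nz: "norm z = R" and Rz: "Re z = 0" and z2: "z\<^sup>2 = - (of_real R ^ 2)"
    using assms by (auto simp: norm_mult power_mult_distrib)
  have Rew: "Re w = - u * d" unfolding u(3) using Rz by simp
  then show "Re w \<le> 0" using u assms by (auto simp: mult_nonneg_nonneg)
  have "1 + w\<^sup>2 / of_real R ^ 2 = (w - z) * (w + z) / of_real R ^ 2"
  proof -
    have "(w - z) * (w + z) = w\<^sup>2 - z\<^sup>2" by (simp add: algebra_simps power2_eq_square)
    then show ?thesis using assms z2 by (simp add: add_divide_distrib)
  qed
  then have eq: "norm (1 + w\<^sup>2 / of_real R ^ 2) = norm (w - z) * norm (w + z) / R\<^sup>2"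
    using assms by (simp add: norm_mult norm_divide norm_power)
  have wz: "w - z = u *\<^sub>R (- of_real d - z)" using u by (simp add: algebra_simps scaleR_conv_of_real)
  have "norm (- of_real d - z) \<le> d + R"
    using norm_triangle_ineq4[of "- of_real d" z] nz assms by simp
  then have 1: "norm (w - z) \<le> u * (d + R)"
    unfolding wz using u by (simp add: mult_left_mono)
  have "norm w \<le> (1 - u) * R + u * d"
    unfolding u(3) using norm_triangle_ineq[of "(1 - u) *\<^sub>R z" "u *\<^sub>R (- of_real d)"] u nz assms by simp
  also have "\<dots> \<le> R + d" using u assms by (intro add_mono) (auto simp: mult_left_le_one_le)
  finally have 2: "norm (w + z) \<le> 2 * R + d"
    using norm_triangle_ineq[of w z] nz by simp
  have "norm (w - z) * norm (w + z) \<le> u * (d + R) * (2 * R + d)"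
    using 1 2 u assms by (intro mult_mono) auto
  then have "norm (w - z) * norm (w + z) / R\<^sup>2 \<le> u * (d + R) * (2 * R + d) / R\<^sup>2"
    by (simp add: divide_right_mono)
  also have "\<dots> = (d + R) * (2 * R + d) / (d * R\<^sup>2) * \<bar>Re w\<bar>"
  proof -
    have "\<bar>Re w\<bar> = u * d" using Rew u(1) assms by (simp add: abs_mult)
    then show ?thesis using assms by simp
  qed
  finally show "norm (1 + w\<^sup>2 / of_real R ^ 2) \<le> (d + R) * (2 * R + d) / (d * R\<^sup>2) * \<bar>Re w\<bar>"
    using eq by simp
qed

lemma right_half_circle:
  assumes "w \<in> path_image (part_circlepath 0 R (-pi/2) (pi/2))" "R > 0"
  shows "norm w = R" "Re w \<ge> 0"
proof -
  obtain t where t: "-pi/2 \<le> t" "t \<le> pi/2" "w = R * exp (\<i> * of_real t)"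
    using assms(1) by (auto simp: path_image_part_circlepath)
  show "norm w = R" using t assms by (simp add: norm_mult)
  have "cos t \<ge> 0" using t by (intro cos_ge_zero) auto
  then show "Re w \<ge> 0" using t assms by (simp add: Re_exp)
qed

lemma left_half_circle:
  assumes "w \<in> path_image (part_circlepath 0 R (pi/2) (3*pi/2))" "R > 0"
  shows "norm w = R" "Re w \<le> 0"
proof -
  obtain t where t: "pi/2 \<le> t" "t \<le> 3*pi/2" "w = R * exp (\<i> * of_real t)"
    using assms(1) by (auto simp: path_image_part_circlepath)
  show "norm w = R" using t assms by (simp add: norm_mult)
  have "cos (t - pi) \<ge> 0" using t by (intro cos_ge_zero) auto
  then have "cos t \<le> 0" by simp
  then show "Re w \<le> 0" using t assms by (simp add: Re_exp mult_nonneg_nonpos)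
qed

lemma imaginary_on_circle:
  assumes "norm w = R" "Re w = 0"
  shows "w \<in> {\<i> * of_real R, - (\<i> * of_real R)}"
proof -
  have "\<bar>Im w\<bar> = R" using assms cmod_eq_Im by auto
  then show ?thesis using assms by (auto simp: complex_eq_iff abs_if split: if_splits)
qed

text \<open>Newman's contour argument. Assuming \<open>F 1 = 0\<close> makes \<open>F (1 + z) / z\<close> holomorphic at \<open>0\<close>, so that the part of the
  contour to the left of the imaginary axis can be any path; two segments suffice, since the kernel vanishes at their endpoints
  \<open>\<plusminus>\<i> R\<close>. The term \<open>n = 0\<close> of the series vanishes because \<open>0 powr s = 0\<close>.\<close>
lemma newman_estimate:
  fixes a :: "nat \<Rightarrow> complex" and F :: "complex \<Rightarrow> complex"
  assumes bd: "\<And>n. norm (a n) \<le> B"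
    and S: "open S" "F holomorphic_on S" "{s. Re s \<ge> 1} \<subseteq> S"
    and F: "\<And>s. Re s > 1 \<Longrightarrow> (\<lambda>n. a n * of_nat n powr (-s)) sums F s"
    and F1: "F 1 = 0" and R: "R > 0"
  obtains M where "\<And>N. N \<ge> 2 \<Longrightarrow> norm (\<Sum>n\<le>N. a n / of_nat n) \<le> 2 * B / R + B / real N + M / ln (real N)"
proof -
  have B0: "B \<ge> 0" using bd[of 0] norm_ge_zero order_trans by blast
  define T where "T = (\<lambda>z. 1 + z) -` S"
  have oT: "open T" unfolding T_def by (intro open_vimage S continuous_intros)
  \<comment> \<open>Compactness gives a strip of uniform width \<open>e\<close> to the left of this
    piece of the imaginary axis. The factor 2 makes the points \<plusminus>\<i> R interior to
    \<open>U\<close>.\<close>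
  define K where "K = (\<lambda>t. Complex 0 t) ` {-2*R..2*R}"
  have "compact K" unfolding K_def Complex_eq by (intro compact_continuous_image continuous_intros) auto
  moreover have "K \<subseteq> T" using S(3) by (auto simp: K_def T_def intro!: subsetD[OF S(3)])
  ultimately obtain e where e: "e > 0" "(\<Union>x\<in>K. ball x e) \<subseteq> T"
    using compact_subset_open_imp_ball_epsilon_subset[OF _ oT] by blast
  define U where "U = {z. Re z > -e} \<inter> {z. Im z < 2*R} \<inter> {z. Im z > -2*R}"
  have oU: "open U" unfolding U_def
    by (intro open_Int open_halfspace_Re_gt open_halfspace_Im_lt open_halfspace_Im_gt)
  have cU: "convex U" unfolding U_def
    by (intro convex_Int convex_halfspace_Re_gt convex_halfspace_Im_lt convex_halfspace_Im_gt)
  have UT: "U \<subseteq> T"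
  proof
    fix z assume z: "z \<in> U"
    show "z \<in> T"
    proof (cases "Re z \<ge> 0")
      case True
      then show ?thesis using S(3) by (auto simp: T_def)
    next
      case False
      have "dist (Complex 0 (Im z)) z = \<bar>Re z\<bar>"
        by (simp add: dist_norm cmod_def)
      then have "z \<in> ball (Complex 0 (Im z)) e" using z False by (simp add: U_def)
      moreover have "Complex 0 (Im z) \<in> K" using z by (auto simp: K_def U_def)
      ultimately show ?thesis using e by blast
    qed
  qed
  define G where "G = (\<lambda>z. F (1 + z))"
  have "F \<circ> (\<lambda>z. 1 + z) holomorphic_on T"
    by (intro holomorphic_on_compose_gen[OF _ S(2)] holomorphic_intros) (auto simp: T_def)
  then have holG: "G holomorphic_on U" using UT by (auto simp: G_def o_def intro: holomorphic_on_subset)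
  define H where "H = (\<lambda>z. if z = 0 then deriv G 0 else (G z - G 0) / (z - 0))"
  have holH: "H holomorphic_on U" unfolding H_def by (rule pole_lemma_open[OF holG oU])
  have G0: "G 0 = 0" by (simp add: G_def F1)
  define d where "d = e / 2"
  have d: "d > 0" using e by (simp add: d_def)
  let ?p = "part_circlepath 0 R (-pi/2) (pi/2)" and ?m = "part_circlepath 0 R (pi/2) (3*pi/2)"
  let ?s1 = "linepath (\<i> * of_real R) (- of_real d)" and ?s2 = "linepath (- of_real d) (- (\<i> * of_real R))"
  have ends: "pathstart ?p = - (\<i> * of_real R)" "pathfinish ?p = \<i> * of_real R"
    unfolding pathstart_part_circlepath pathfinish_part_circlepath cis_conv_exp[symmetric]
    by (simp_all add: complex_eq_iff)
  have inU: "\<i> * of_real R \<in> U" "- of_real d \<in> U" "- (\<i> * of_real R) \<in> U"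
    using e R by (auto simp: U_def d_def)
  have segU: "closed_segment (\<i> * of_real R) (- of_real d) \<subseteq> U" "closed_segment (- of_real d) (- (\<i> * of_real R)) \<subseteq> U"
    using inU cU by (auto simp: closed_segment_subset)
  have pU: "path_image ?p \<subseteq> U"
  proof
    fix w assume "w \<in> path_image ?p"
    from right_half_circle[OF this R] have "\<bar>Im w\<bar> \<le> R" "Re w \<ge> 0" using abs_Im_le_cmod[of w] by auto
    then show "w \<in> U" using e R by (auto simp: U_def)
  qed
  let ?seg = "closed_segment (\<i> * of_real R) (- of_real d) \<union> closed_segment (- of_real d) (- (\<i> * of_real R))"
  have "continuous_on ?seg H"
    using holH segU holomorphic_on_imp_continuous_on continuous_on_subset by (metis Un_least)
  then have "compact (H ` ?seg)" by (intro compact_continuous_image compact_Un) auto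
  then have "bounded (H ` ?seg)" by (rule compact_imp_bounded)
  then obtain M0 where M0: "M0 > 0" "\<And>w. w \<in> ?seg \<Longrightarrow> norm (H w) \<le> M0"
    unfolding bounded_pos by blast
  define c where "c = (d + R) * (2 * R + d) / (d * R\<^sup>2)"
  have c0: "c \<ge> 0" using d R by (simp add: c_def)
  define M where "M = M0 * c * (d + R)"
  show ?thesis
  proof (rule that[of M])
    fix N :: nat assume N: "N \<ge> 2"
    define L where "L = ln (real N)"
    have L: "L > 0" using N by (simp add: L_def)
    define s where "s = (\<lambda>z. \<Sum>n\<le>N. a n * of_nat n powr (-(1 + z)))"
    define k where "k = (\<lambda>z :: complex. (1 + z\<^sup>2 / of_real R ^ 2) * exp (z * of_real L))"
    define Q where "Q = (\<lambda>z. H z * k z)"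
    define A where "A = (\<lambda>z. s z * k z)"
    have nexp: "norm (exp (w * of_real L)) = real N powr Re w" for w
      using N by (simp add: L_def powr_def norm_exp_eq_Re)
    have holk: "k holomorphic_on X" for X unfolding k_def using R by (intro holomorphic_intros) auto
    have hols: "s holomorphic_on X" for X
    proof -
      have "(\<lambda>z. a n * of_nat n powr (-(1 + z))) holomorphic_on X" for n
        by (cases "n = 0") (auto intro!: holomorphic_intros)
      then show ?thesis unfolding s_def by (intro holomorphic_intros)
    qed
    have holA: "A holomorphic_on X" for X unfolding A_def by (intro holomorphic_intros holk hols)
    have holQ: "Q holomorphic_on U" unfolding Q_def by (intro holomorphic_intros holk holH)
    have cQ: "continuous_on X Q" if "X \<subseteq> U" for X
      using holQ that holomorphic_on_imp_continuous_on continuous_on_subset by blast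
    have cA: "continuous_on (path_image (part_circlepath 0 R x y)) (\<lambda>w. A w / w)" for x y
      using path_image_part_circlepath_subset'[of R 0 x y] R holA[of UNIV]
      by (intro continuous_intros holomorphic_on_imp_continuous_on[OF holA]) auto
    have Qp: "Q contour_integrable_on ?p"
      by (rule contour_integrable_continuous_part_circlepath[OF cQ[OF pU]])
    have Qs: "Q contour_integrable_on ?s1" "Q contour_integrable_on ?s2"
      using segU by (auto intro!: contour_integrable_continuous_linepath cQ)
    have "(Q has_contour_integral (contour_integral ?p Q + (contour_integral ?s1 Q + contour_integral ?s2 Q))) (?p +++ ?s1 +++ ?s2)"
      using Qp Qs ends by (intro has_contour_integral_join has_contour_integral_integral valid_path_join) auto
    moreover have "(Q has_contour_integral 0) (?p +++ ?s1 +++ ?s2)"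
    proof (rule Cauchy_theorem_convex_simple[OF holQ cU])
      show "path_image (?p +++ ?s1 +++ ?s2) \<subseteq> U"
        using pU segU ends by (simp add: path_image_join)
      show "valid_path (?p +++ ?s1 +++ ?s2)" using ends by (intro valid_path_join) auto
      show "pathfinish (?p +++ ?s1 +++ ?s2) = pathstart (?p +++ ?s1 +++ ?s2)" 
        unfolding pathstart_join pathfinish_join ends by simp
    qed
    ultimately have closed: "contour_integral ?p Q + (contour_integral ?s1 Q + contour_integral ?s2 Q) = 0"
      using contour_integral_unique by metis
    have seg: "norm (Q w) \<le> M0 * c / L" if w: "w \<in> ?seg" for w
    proof -
      have *: "Re w \<le> 0 \<and> norm (1 + w\<^sup>2 / of_real R ^ 2) \<le> c * \<bar>Re w\<bar>"
        using newman_kernel_segment_bound[of w _ d R] w R d unfolding c_def by (metis Un_iff closed_segment_commute)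
      \<comment> \<open>With x = \<bar>Re w\<bar> this says x exp (- x L) <= 1 / L: the zero of the
        kernel at the endpoints turns the decay of N^(Re w) into a bound O(1 / ln N) that is uniform
        on the segments.\<close>
      have "\<bar>Re w\<bar> * L \<le> exp (\<bar>Re w\<bar> * L)" using exp_ge_add_one_self[of "\<bar>Re w\<bar> * L"] by linarith
      then have "\<bar>Re w\<bar> * exp (Re w * L) \<le> 1 / L" using * L by (simp add: exp_minus field_simps)
      moreover have "norm (k w) \<le> c * \<bar>Re w\<bar> * exp (Re w * L)"
        unfolding k_def norm_mult using * c0 by (intro mult_mono) (auto simp: norm_exp_eq_Re mult_nonneg_nonpos)
      ultimately have "norm (k w) \<le> c * (1 / L)"
        using c0 by (smt (verit) mult.assoc mult_left_mono)
      then have "norm (H w) * norm (k w) \<le> M0 * (c * (1/L))"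
        using M0 w by (intro mult_mono) auto
      then show ?thesis by (simp add: Q_def norm_mult)
    qed
    have n1: "norm (- of_real d - \<i> * of_real R) \<le> d + R" "norm (- (\<i> * of_real R) - - of_real d) \<le> d + R"
      using norm_triangle_ineq4[of "- of_real d" "\<i> * of_real R"] norm_triangle_ineq4[of "- (\<i> * of_real R)" "- of_real d"] d R
      by (auto simp: norm_mult)
    have MC: "M0 * c / L \<ge> 0" using M0 c0 L by simp
    have I1: "norm (contour_integral ?s1 Q) \<le> M / L"
    proof -
      have "norm (contour_integral ?s1 Q) \<le> M0 * c / L * norm (- of_real d - \<i> * of_real R)"
        using has_contour_integral_integral[OF Qs(1)] MC seg by (rule has_contour_integral_bound_linepath) auto
      also have "\<dots> \<le> M0 * c / L * (d + R)" using n1 MC by (intro mult_left_mono) auto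
      finally show ?thesis by (simp add: M_def)
    qed
    have I2: "norm (contour_integral ?s2 Q) \<le> M / L"
    proof -
      have "norm (contour_integral ?s2 Q) \<le> M0 * c / L * norm (- (\<i> * of_real R) - - of_real d)"
        using has_contour_integral_integral[OF Qs(2)] MC seg by (rule has_contour_integral_bound_linepath) auto
      also have "\<dots> \<le> M0 * c / L * (d + R)" using n1 MC by (intro mult_left_mono) auto
      finally show ?thesis by (simp add: M_def)
    qed
    let ?ex = "{\<i> * of_real R, - (\<i> * of_real R)}"
    have Ap: "(\<lambda>w. A w / w) contour_integrable_on ?p" and Am: "(\<lambda>w. A w / w) contour_integrable_on ?m"
      by (rule contour_integrable_continuous_part_circlepath[OF cA])+
    \<comment> \<open>On the right arc the integrand is the tail of the series times the kernel.
      With x = Re w the three factors B N^(-x) / x, 2 x / R^2 and N^x multiply to 2 B / R^2. The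
      points \<plusminus>\<i> R, where x = 0, are left out as a finite exceptional set.\<close>
    have I3: "norm (contour_integral ?p (\<lambda>w. A w / w) - contour_integral ?p Q) \<le> 2 * B / R\<^sup>2 * R * (pi/2 - - pi/2)"
    proof (rule has_contour_integral_bound_part_circlepath_strong[where k = ?ex])
      show "((\<lambda>w. A w / w - Q w) has_contour_integral (contour_integral ?p (\<lambda>w. A w / w) - contour_integral ?p Q)) ?p"
        by (intro has_contour_integral_diff has_contour_integral_integral Ap Qp)
      fix w assume w: "w \<in> path_image ?p - ?ex"
      then have nw: "norm w = R" and "Re w \<ge> 0" using right_half_circle[of w R] R by auto
      then have x: "Re w > 0" using imaginary_on_circle[of w R] w by force
      have w0: "w \<noteq> 0" using nw R by auto
      have "(\<lambda>n. a (n + Suc N) * of_nat (n + Suc N) powr (-(1+w))) sums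
              (F (1 + w) - (\<Sum>n<Suc N. a n * of_nat n powr (-(1+w))))"
        using F[of "1 + w"] x by (intro sums_split_initial_segment) auto
      then have sm: "(\<lambda>n. a (n + Suc N) * of_nat (n + Suc N) powr (-(1+w))) sums (G w - s w)"
        by (simp add: G_def s_def lessThan_Suc_atMost)
      have "norm (G w - s w) \<le> B * (real N powr (- Re w) / Re w)"
      proof (rule LIMSEQ_le_const2[OF tendsto_norm[OF sm[unfolded sums_def]]], intro exI allI impI)
        fix m
        have "norm (\<Sum>n<m. a (n + Suc N) * of_nat (n + Suc N) powr (-(1+w))) \<le>
              (\<Sum>n<m. B * real (n + Suc N) powr (-1 - Re w))"
          using bd B0 by (intro sum_norm_le) (auto simp: norm_mult norm_nat_powr intro!: mult_mono simp del: of_nat_Suc of_nat_add)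
        also have "\<dots> = B * (\<Sum>n<m. real (n + Suc N) powr (-1 - Re w))" by (simp add: sum_distrib_left)
        also have "\<dots> \<le> B * (real N powr (- Re w) / Re w)"
          using sums_powr_tail_le[OF x, of N m] N B0 by (intro mult_left_mono) auto
        finally show "norm (\<Sum>n<m. a (n + Suc N) * of_nat (n + Suc N) powr (-(1+w))) \<le> B * (real N powr (- Re w) / Re w)" .
      qed
      moreover have "norm (A w / w - Q w) = norm (G w - s w) * (2 * \<bar>Re w\<bar> / R\<^sup>2) * real N powr Re w"
      proof -
        have "A w / w - Q w = ((s w - G w) / w) * k w"
          using w0 G0 by (simp add: A_def Q_def H_def diff_divide_distrib left_diff_distrib)
        also have "\<dots> = - ((G w - s w) * ((1 + w\<^sup>2 / of_real R ^ 2) / w) * exp (w * of_real L))"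
        proof -
          have "x / w * (\<kappa> * E) = - ((- x) * (\<kappa> / w) * E)" for x \<kappa> E :: complex by simp
          from this[of "s w - G w"] show ?thesis by (simp only: k_def minus_diff_eq)
        qed
        finally have "norm (A w / w - Q w) = norm ((G w - s w) * ((1 + w\<^sup>2 / of_real R ^ 2) / w) * exp (w * of_real L))"
          by simp
        then show ?thesis by (simp only: norm_mult norm_newman_kernel[OF nw R] nexp)
      qed
      ultimately have "norm (A w / w - Q w) \<le> B * (real N powr (- Re w) / Re w) * (2 * \<bar>Re w\<bar> / R\<^sup>2) * real N powr Re w"
        by (simp only:) (intro mult_right_mono, auto)
      also have "\<dots> = 2 * B / R\<^sup>2" using x N by (simp add: powr_minus field_simps)
      finally show "norm (A w / w - Q w) \<le> 2 * B / R\<^sup>2" .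
    qed (use R B0 in auto)
    \<comment> \<open>The partial sum \<open>s\<close> is entire, so its contour may stay on the
      circle also to the left of the axis; only the part with \<open>H\<close> has to be moved to
      the segments.\<close>
    have I4: "norm (contour_integral ?m (\<lambda>w. A w / w)) \<le> (2 * B / R\<^sup>2 + 2 * B / (real N * R)) * R * (3*pi/2 - pi/2)"
    proof (rule has_contour_integral_bound_part_circlepath_strong[where k = ?ex])
      show "((\<lambda>w. A w / w) has_contour_integral (contour_integral ?m (\<lambda>w. A w / w))) ?m"
        by (intro has_contour_integral_integral Am)
      fix w assume w: "w \<in> path_image ?m - ?ex"
      then have nw: "norm w = R" and "Re w \<le> 0" using left_half_circle[of w R] R by auto
      then have x: "Re w < 0" using imaginary_on_circle[of w R] w by force
      define y where "y = - Re w"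
      have y: "y > 0" "y \<le> R" using x nw abs_Re_le_cmod[of w] by (auto simp: y_def)
      have "norm (s w) \<le> (\<Sum>n\<le>N. B * real n powr (y - 1))" unfolding s_def
      proof (intro sum_norm_le)
        fix n
        have "norm (of_nat n powr (-(1 + w))) = real n powr (y - 1)"
          unfolding norm_nat_powr by (rule arg_cong[where f = "\<lambda>t. real n powr t"]) (simp add: y_def)
        then show "norm (a n * of_nat n powr (-(1 + w))) \<le> B * real n powr (y - 1)"
          using bd by (simp add: norm_mult mult_right_mono)
      qed
      also have "\<dots> = B * (\<Sum>n\<le>N. real n powr (y - 1))" by (simp add: sum_distrib_left)
      also have "\<dots> \<le> B * (real N powr y * (1 / y + 1 / real N))"
        using sum_powr_le[OF y(1), of N] N B0 by (intro mult_left_mono) auto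
      finally have "norm (s w) \<le> B * (real N powr y * (1 / y + 1 / real N))" .
      moreover have "norm (A w / w) = norm (s w) * (2 * y / R\<^sup>2) * real N powr (-y)"
      proof -
        have "A w / w = s w * ((1 + w\<^sup>2 / of_real R ^ 2) / w) * exp (w * of_real L)"
          by (simp add: A_def k_def)
        then have "norm (A w / w) = norm (s w) * (2 * \<bar>Re w\<bar> / R\<^sup>2) * real N powr Re w"
          by (simp only: norm_mult norm_newman_kernel[OF nw R] nexp)
        then show ?thesis using x by (simp add: y_def)
      qed
      ultimately have "norm (A w / w) \<le> B * (real N powr y * (1 / y + 1 / real N)) * (2 * y / R\<^sup>2) * real N powr (-y)"
        using y by (simp only:) (intro mult_right_mono, auto)
      also have "\<dots> = 2 * B / R\<^sup>2 + 2 * B * y / (real N * R\<^sup>2)" using y N R by (simp add: powr_minus field_simps)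
      also have "\<dots> \<le> 2 * B / R\<^sup>2 + 2 * B * R / (real N * R\<^sup>2)"
        using y B0 by (intro add_left_mono divide_right_mono mult_left_mono) auto
      also have "2 * B * R / (real N * R\<^sup>2) = 2 * B / (real N * R)" using R by (simp add: power2_eq_square)
      finally show "norm (A w / w) \<le> 2 * B / R\<^sup>2 + 2 * B / (real N * R)" .
    qed (use R B0 in auto)
    \<comment> \<open>The integral of \<open>Q\<close> over the right arc is the negative of that
      over the segments, so inserting it makes the small difference \<open>A w / w - Q w\<close>
      appear on the right arc.\<close>
    have "2 * pi * \<i> * A 0 = (contour_integral ?p (\<lambda>w. A w / w) - contour_integral ?p Q) +
        contour_integral ?m (\<lambda>w. A w / w) - contour_integral ?s1 Q - contour_integral ?s2 Q"
    proof -
      have "t = (x - q) + m - u - v" if "x + m = t" "q + (u + v) = 0" for x m t q u v :: complex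
      proof -
        have "q = - (u + v)" using that(2) by (rule iffD2[OF eq_neg_iff_add_eq_0])
        then show ?thesis using that(1) by simp
      qed
      from this[OF contour_integral_two_half_circles[OF holA R] closed] show ?thesis .
    qed
    then have "norm (2 * pi * \<i> * A 0) \<le> 2 * B / R\<^sup>2 * R * (pi/2 - - pi/2) + 
        (2 * B / R\<^sup>2 + 2 * B / (real N * R)) * R * (3*pi/2 - pi/2) + M / L + M / L"
      using I1 I2 I3 I4 by (smt (verit) norm_triangle_ineq norm_triangle_ineq4)
    also have "\<dots> = 2 * pi * (2 * B / R + B / real N) + 2 * (M / L)"
      using R N by (simp add: field_simps power2_eq_square)
    also have "norm (2 * pi * \<i> * A 0) = 2 * pi * norm (A 0)" by (simp add: norm_mult)
    finally have "2 * pi * norm (A 0) \<le> 2 * pi * (2 * B / R + B / real N) + 2 * (M / L)" .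
    moreover have "2 * (M / L) \<le> 2 * pi * (M / L)"
      using pi_ge_two M0 c0 d R L by (intro mult_right_mono) (auto simp: M_def)
    ultimately have "2 * pi * norm (A 0) \<le> 2 * pi * (2 * B / R + B / real N + M / L)"
      by (simp add: distrib_left)
    then have "norm (A 0) \<le> 2 * B / R + B / real N + M / L" by simp
    moreover have "A 0 = (\<Sum>n\<le>N. a n / of_nat n)"
      by (simp add: A_def s_def k_def powr_minus divide_inverse powr_nat') 
    ultimately show "norm (\<Sum>n\<le>N. a n / of_nat n) \<le> 2 * B / R + B / real N + M / ln (real N)"
      by (simp add: L_def)
  qed
qed


text \<open>Subtracting \<open>F 1\<close> from the coefficient at n = 1 gives a function vanishing
  at 1, as \<open>newman_estimate\<close> requires. There N tends to infinity for fixed R, which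
  leaves 2 C / R; the choice R = 4 (C + 1) / e makes this smaller than e.\<close>

theorem newman:
  fixes a :: "nat \<Rightarrow> complex" and F :: "complex \<Rightarrow> complex"
  assumes bd: "\<And>n. norm (a n) \<le> B"
    and S: "open S" "F holomorphic_on S" "{s. Re s \<ge> 1} \<subseteq> S"
    and F: "\<And>s. Re s > 1 \<Longrightarrow> (\<lambda>n. a n * of_nat n powr (-s)) sums F s"
  shows "(\<lambda>n. a n / of_nat n) sums F 1"
proof -
  define b where "b = (\<lambda>n. a n - (if n = 1 then F 1 else 0))"
  define G where "G = (\<lambda>s. F s - F 1)"
  define C where "C = B + norm (F 1)"
  have C: "norm (b n) \<le> C" for n
    using bd[of n] norm_triangle_ineq4[of "a n" "F 1"] by (auto simp: b_def C_def intro: add_increasing2)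
  have G: "(\<lambda>n. b n * of_nat n powr (-s)) sums G s" if "Re s > 1" for s
  proof -
    have "(\<lambda>n. if n = 1 then F 1 else 0) sums F 1" by (rule sums_single)
    from sums_diff[OF F[OF that] this] show ?thesis unfolding G_def
      by (rule sums_cong[THEN iffD1, rotated]) (auto simp: b_def algebra_simps)
  qed
  have "(\<lambda>N. \<Sum>n\<le>N. b n / of_nat n) \<longlonglongrightarrow> 0"
  proof (rule LIMSEQ_I)
    fix e :: real assume e: "e > 0"
    have hG: "G holomorphic_on S" unfolding G_def by (intro holomorphic_intros S)
    have C0: "C \<ge> 0" using C[of 0] norm_ge_zero order_trans by blast
    define R where "R = 4 * (C + 1) / e"
    have R: "R > 0" using C0 e by (simp add: R_def)
    obtain M where M: "\<And>N. N \<ge> 2 \<Longrightarrow> norm (\<Sum>n\<le>N. b n / of_nat n) \<le> 2 * C / R + C / real N + M / ln (real N)"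
      using newman_estimate[OF C S(1) hG S(3) G _ R] by (auto simp: G_def)
    have "(\<lambda>N::nat. 2 * C / R + C / real N + M / ln (real N)) \<longlonglongrightarrow> 2 * C / R"
      by real_asymp
    moreover have "2 * C / R < e"
    proof -
      have "2 * C / R = e * (C / (2 * (C + 1)))" using e C0 by (simp add: R_def field_simps)
      also have "C / (2 * (C + 1)) < 1" using C0 by (simp add: field_simps)
      finally show ?thesis using e by (simp add: mult_less_cancel_left1)
    qed
    ultimately have "\<forall>\<^sub>F N in sequentially. 2 * C / R + C / real N + M / ln (real N) < e"
      by (rule order_tendstoD)
    then have "\<forall>\<^sub>F N in sequentially. norm (\<Sum>n\<le>N. b n / of_nat n) < e"
      using eventually_ge_at_top[of 2] by eventually_elim (use M in fastforce)
    then show "\<exists>N0. \<forall>N\<ge>N0. norm ((\<Sum>n\<le>N. b n / of_nat n) - 0) < e"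
      by (simp add: eventually_sequentially)
  qed
  from tendsto_add[OF this tendsto_const[of "F 1"]]
  have "(\<lambda>N. (\<Sum>n\<le>N. b n / of_nat n) + F 1) \<longlonglongrightarrow> F 1" by simp
  moreover have "\<forall>\<^sub>F N in sequentially. (\<Sum>n\<le>N. b n / of_nat n) + F 1 = (\<Sum>n\<le>N. a n / of_nat n)"
    using eventually_ge_at_top[of 1]
  proof eventually_elim
    case (elim N)
    have "(\<Sum>n\<le>N. b n / of_nat n) = (\<Sum>n\<le>N. a n / of_nat n) - (\<Sum>n\<le>N. if n = 1 then F 1 else 0)"
      unfolding sum_subtractf[symmetric] by (intro sum.cong) (auto simp: b_def)
    also have "(\<Sum>n\<le>N. if n = 1 then F 1 else 0) = F 1" using elim by simp
    finally show ?case by simp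
  qed
  ultimately have "(\<lambda>N. \<Sum>n\<le>N. a n / of_nat n) \<longlonglongrightarrow> F 1" by (rule Lim_transform_eventually)
  then show ?thesis by (simp add: sums_def_le)
qed

section \<open>Analytic continuation of periodic Dirichlet series\<close>

lemma holomorphic_on_suminf:
  fixes f :: "nat \<Rightarrow> complex \<Rightarrow> complex"
  assumes "open S" "\<And>k. f k holomorphic_on S"
    and "\<And>z. z \<in> S \<Longrightarrow> \<exists>d>0. cball z d \<subseteq> S \<and> (\<exists>M. summable M \<and> (\<forall>k. \<forall>w\<in>cball z d. norm (f k w) \<le> M k))"
  shows "(\<lambda>w. \<Sum>k. f k w) holomorphic_on S"
proof (rule holomorphic_uniform_sequence[OF assms(1)])
  show "(\<lambda>w. \<Sum>k<n. f k w) holomorphic_on S" for n by (intro holomorphic_intros assms(2))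
  fix z assume "z \<in> S"
  then obtain d M where d: "d > 0" "cball z d \<subseteq> S" "summable M" "\<forall>k. \<forall>w\<in>cball z d. norm (f k w) \<le> M k"
    using assms(3)[OF \<open>z \<in> S\<close>] by blast
  have "uniform_limit (cball z d) (\<lambda>n w. \<Sum>k<n. f k w) (\<lambda>w. \<Sum>k. f k w) sequentially"
    using d by (intro Weierstrass_m_test) auto
  then show "\<exists>d>0. cball z d \<subseteq> S \<and> uniform_limit (cball z d) (\<lambda>n w. \<Sum>k<n. f k w) (\<lambda>w. \<Sum>k. f k w) sequentially"
    using d by blast
qed

text \<open>A continuous \<open>g\<close> is bounded on a small disc, and there the exponent - Re s
  - 1 stays below a constant less than -1, which gives a summable majorant near every point.\<close>

lemma holomorphic_on_suminf_halfplane: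
  fixes f :: "nat \<Rightarrow> complex \<Rightarrow> complex"
  assumes "\<And>k. f k holomorphic_on {s. Re s > 0}" and "continuous_on UNIV g"
    and "\<And>k s. Re s > 0 \<Longrightarrow> norm (f k s) \<le> g s * real (Suc k) powr (- Re s - 1)"
  shows "(\<lambda>w. \<Sum>k. f k w) holomorphic_on {s. Re s > 0}"
    and "\<And>s. Re s > 0 \<Longrightarrow> summable (\<lambda>k. f k s)"
proof -
  have summ: "summable (\<lambda>k. C * real (Suc k) powr (- d - 1))" if "d > 0" for C d :: real
  proof -
    have "summable (\<lambda>k. real k powr (- d - 1))" using that by (simp add: summable_real_powr_iff)
    then have "summable (\<lambda>k. real (Suc k) powr (- d - 1))" by (rule iffD2[OF summable_Suc_iff])
    then show ?thesis by (rule summable_mult)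
  qed
  show "summable (\<lambda>k. f k s)" if "Re s > 0" for s
    by (rule summable_comparison_test'[OF summ[OF that, of "g s"], of 0]) (use assms(3) that in auto)
  show "(\<lambda>w. \<Sum>k. f k w) holomorphic_on {s. Re s > 0}"
  proof (rule holomorphic_on_suminf[OF open_halfspace_Re_gt assms(1)])
    fix z assume z: "z \<in> {s. Re s > 0}"
    define d where "d = Re z / 2"
    have d: "d > 0" using z by (simp add: d_def)
    have "compact (g ` cball z d)"
      using assms(2) by (intro compact_continuous_image) (auto intro: continuous_on_subset)
    then have "bounded (g ` cball z d)" by (rule compact_imp_bounded)
    then obtain C where C: "C > 0" "\<And>w. w \<in> cball z d \<Longrightarrow> norm (g w) \<le> C"
      unfolding bounded_pos by blast
    have re: "Re w \<ge> d" if "w \<in> cball z d" for w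
      using that abs_Re_le_cmod[of "z - w"] by (auto simp: d_def dist_norm)
    have "norm (f k w) \<le> C * real (Suc k) powr (- d - 1)" if "w \<in> cball z d" for k w
    proof -
      have "norm (f k w) \<le> g w * real (Suc k) powr (- Re w - 1)"
        using re[OF that] d by (intro assms(3)) auto
      also have "\<dots> \<le> C * real (Suc k) powr (- d - 1)"
        using re[OF that] C(1) C(2)[OF that] by (intro mult_mono powr_mono) auto
      finally show ?thesis .
    qed
    moreover have "cball z d \<subseteq> {s. Re s > 0}" using re d by force
    ultimately show "\<exists>d>0. cball z d \<subseteq> {s. Re s > 0} \<and>
        (\<exists>M. summable M \<and> (\<forall>k. \<forall>w\<in>cball z d. norm (f k w) \<le> M k))"
      using d summ by blast
  qed
qed

lemma real_segment_complex:
  assumes "z \<in> closed_segment (complex_of_real x) (of_real y)" "x \<le> y"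
  obtains t where "z = of_real t" "x \<le> t" "t \<le> y"
proof -
  have "closed_segment (complex_of_real x) (of_real y) = complex_of_real ` {x..y}"
    using assms(2) by (simp add: closed_segment_of_real closed_segment_eq_real_ivl)
  then show ?thesis using assms(1) that by auto
qed

lemma powr_diff_bound:
  fixes x y :: real and s :: complex
  assumes "0 < x" "x \<le> y" "Re s > 0"
  shows "norm (of_real y powr (-s) - of_real x powr (-s)) \<le> norm s * x powr (- Re s - 1) * (y - x)"
proof -
  let ?S = "closed_segment (complex_of_real x) (of_real y)"
  have "norm (of_real y powr (-s) - of_real x powr (-s)) \<le> norm s * x powr (- Re s - 1) * norm (of_real y - of_real x :: complex)"
  proof (rule field_differentiable_bound[where S = ?S and f' = "\<lambda>z. - s * z powr (- s - 1)"])
    fix z assume "z \<in> ?S"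
    then obtain t where t: "z = of_real t" "x \<le> t" "t \<le> y" using real_segment_complex assms by blast
    have nn: "z \<notin> \<real>\<^sub>\<le>\<^sub>0" using t assms by simp
    show "((\<lambda>z. z powr (- s)) has_field_derivative - s * z powr (- s - 1)) (at z within ?S)"
      using has_field_derivative_powr[OF nn, of "-s"] has_field_derivative_at_within by blast
    have "norm (z powr (- s - 1)) = t powr (- Re s - 1)"
      using t assms by (simp add: norm_powr_real_powr)
    also have "\<dots> \<le> x powr (- Re s - 1)" using t assms by (intro powr_mono2') auto
    finally show "norm (- s * z powr (- s - 1)) \<le> norm s * x powr (- Re s - 1)"
      by (simp add: norm_mult mult_left_mono)
  qed auto
  also have "norm (of_real y - of_real x :: complex) = y - x"
    using assms by (simp flip: of_real_diff)
  finally show ?thesis .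
qed

text \<open>The expression is the increment from n to n + 1 of z \<mapsto> (s - 1) n^(-s) z + z^(1 -
  s). The derivative (s - 1) (n^(-s) - z^(-s)) vanishes at z = n, which gains one power of n through
  \<open>powr_diff_bound\<close>.\<close>

lemma zeta_term_bound:
  fixes n :: nat and s :: complex
  assumes "n \<ge> 1" "Re s > 0"
  shows "norm ((s - 1) * of_nat n powr (-s) - of_nat n powr (1 - s) + of_nat (Suc n) powr (1 - s))
     \<le> norm (s - 1) * norm s * real n powr (- Re s - 1)"
proof -
  let ?S = "closed_segment (complex_of_real (real n)) (of_real (real (Suc n)))"
  define h where "h = (\<lambda>z::complex. (s - 1) * of_nat n powr (-s) * z + z powr (1 - s))"
  have "norm (h (of_real (real (Suc n))) - h (of_real (real n))) \<le> norm (s - 1) * norm s * real n powr (- Re s - 1) * norm (of_real (real (Suc n)) - of_real (real n) :: complex)"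
    unfolding h_def
  proof (rule field_differentiable_bound[where S = ?S and f' = "\<lambda>z. (s - 1) * (of_nat n powr (-s) - z powr (-s))"])
    fix z assume "z \<in> ?S"
    then obtain t where t: "z = of_real t" "real n \<le> t" "t \<le> real (Suc n)"
      using real_segment_complex[of z "real n" "real (Suc n)"] by auto
    have nn: "z \<notin> \<real>\<^sub>\<le>\<^sub>0" using t assms by simp
    have "((\<lambda>z. (s - 1) * of_nat n powr (-s) * z + z powr (1 - s)) has_field_derivative 
        (s - 1) * of_nat n powr (-s) * 1 + (1 - s) * z powr (1 - s - 1)) (at z within ?S)"
      using has_field_derivative_powr[OF nn, of "1 - s"] has_field_derivative_at_within
      by (intro DERIV_add DERIV_cmult DERIV_ident) blast
    also have "(s - 1) * of_nat n powr (-s) * 1 + (1 - s) * z powr (1 - s - 1) = (s - 1) * (of_nat n powr (-s) - z powr (-s))"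
      by (simp add: algebra_simps)
    finally show "((\<lambda>z. (s - 1) * of_nat n powr (-s) * z + z powr (1 - s)) has_field_derivative 
        (s - 1) * (of_nat n powr (-s) - z powr (-s))) (at z within ?S)" .
    have "norm (of_real t powr (-s) - of_real (real n) powr (-s)) \<le> norm s * real n powr (- Re s - 1) * (t - real n)"
      using assms t by (intro powr_diff_bound) auto
    also have "\<dots> \<le> norm s * real n powr (- Re s - 1) * 1"
      using t by (intro mult_left_mono) auto
    finally have "norm (of_nat n powr (-s) - z powr (-s)) \<le> norm s * real n powr (- Re s - 1)"
      using t by (simp add: norm_minus_commute)
    then show "norm ((s - 1) * (of_nat n powr (-s) - z powr (-s))) \<le> norm (s - 1) * norm s * real n powr (- Re s - 1)"
      by (simp add: norm_mult mult_left_mono mult.assoc)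
  qed auto
  moreover have "h (of_real (real (Suc n))) - h (of_real (real n)) =
      (s - 1) * of_nat n powr (-s) - of_nat n powr (1 - s) + of_nat (Suc n) powr (1 - s)"
    by (simp add: h_def algebra_simps)
  ultimately show ?thesis by simp
qed

lemma sums_nat_powr_summable:
  fixes s :: complex and c :: "nat \<Rightarrow> complex"
  assumes "Re s > 1" "\<And>n. norm (c n) \<le> B"
  shows "summable (\<lambda>n. norm (c n * of_nat n powr (-s)))"
proof (rule summable_comparison_test')
  show "summable (\<lambda>n. B * real n powr (- Re s))"
    using assms by (intro summable_mult) (simp add: summable_real_powr_iff)
  show "norm (norm (c n * of_nat n powr (-s))) \<le> B * real n powr (- Re s)" for n
    using assms by (cases "n = 0") (auto simp: norm_mult norm_powr_real_powr mult_right_mono)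
qed

text \<open>\<open>Z s\<close> is (s - 1) times zeta. From (s - 1) n^(-s) the telescoping difference
  n^(1 - s) - (n + 1)^(1 - s), whose sum is 1 for Re s > 1, is subtracted; what remains converges
  for Re s > 0. At s = 1 every remaining term is 0, so \<open>Z 1 = 1\<close>.\<close>

lemma zeta_continuation:
  obtains Z where "Z holomorphic_on {s. Re s > 0}" "Z 1 = 1"
    "\<And>s. Re s > 1 \<Longrightarrow> (\<lambda>n. of_nat n powr (-s)) sums (Z s / (s - 1))"
proof -
  define f where "f = (\<lambda>k s. (s - 1) * of_nat (Suc k) powr (-s) - of_nat (Suc k) powr (1 - s) + of_nat (Suc (Suc k)) powr (1 - s) :: complex)"
  define Z where "Z = (\<lambda>s. 1 + (\<Sum>k. f k s))"
  have hol: "f k holomorphic_on {s. Re s > 0}" for k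
    unfolding f_def by (intro holomorphic_intros) (auto simp: complex_nonpos_Reals_iff)
  have bnd: "norm (f k s) \<le> norm (s - 1) * norm s * real (Suc k) powr (- Re s - 1)" if "Re s > 0" for k s
    unfolding f_def using zeta_term_bound[of "Suc k" s] that by simp
  have cont: "continuous_on UNIV (\<lambda>s::complex. norm (s - 1) * norm s)" by (intro continuous_intros)
  note H = holomorphic_on_suminf_halfplane[OF hol cont bnd]
  show ?thesis
  proof
    show "Z holomorphic_on {s. Re s > 0}" unfolding Z_def by (intro holomorphic_intros H(1)) auto
    show "Z 1 = 1" by (simp add: Z_def f_def del: of_nat_Suc)
    fix s :: complex assume s: "Re s > 1"
    have "(\<lambda>k. f k s) sums (\<Sum>k. f k s)" using s by (intro summable_sums H(2)) auto
    moreover have "(\<lambda>k. of_nat (Suc (Suc k)) powr (1 - s) - of_nat (Suc k) powr (1 - s)) sums (0 - of_nat (Suc 0) powr (1 - s))"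
    proof (rule telescope_sums)
      have "(\<lambda>k. norm (of_nat (Suc k) powr (1 - s))) \<longlonglongrightarrow> 0"
      proof -
        have "(\<lambda>k. real (Suc k) powr (1 - Re s)) \<longlonglongrightarrow> 0" using s by real_asymp
        then show ?thesis by (simp add: norm_powr_real_powr del: of_nat_Suc)
      qed
      then show "(\<lambda>k. of_nat (Suc k) powr (1 - s)) \<longlonglongrightarrow> 0" by (rule tendsto_norm_zero_cancel)
    qed
    ultimately have "(\<lambda>k. f k s - (of_nat (Suc (Suc k)) powr (1 - s) - of_nat (Suc k) powr (1 - s))) sums
        ((\<Sum>k. f k s) - (0 - of_nat (Suc 0) powr (1 - s)))" by (rule sums_diff)
    then have "(\<lambda>k. (s - 1) * of_nat (Suc k) powr (-s)) sums Z s"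
      by (simp add: f_def Z_def algebra_simps)
    note base = this
    have "(\<lambda>k. of_nat (Suc k) powr (-s)) sums (Z s / (s - 1))"
    proof -
      have "s \<noteq> 1" using s by auto
      with sums_divide[OF base, of "s - 1"] show ?thesis by (simp del: of_nat_Suc)
    qed
    then show "(\<lambda>n. of_nat n powr (-s)) sums (Z s / (s - 1))"
      by (subst (asm) sums_Suc_iff) simp
  qed
qed

section \<open>Dirichlet series with periodic coefficients\<close>

lemma periodic_mod:
  assumes "\<And>n. c (n + q) = c n"
  shows "c (n mod q) = c (n :: nat)"
proof -
  have "c (r + k * q) = c r" for r k 
  proof (induction k)
    case (Suc k)
    then show ?case using assms[of "r + k * q"] by (simp add: algebra_simps)
  qed auto
  from this[of "n mod q" "n div q"] show ?thesis by simp
qed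

lemma periodic_sum_block:
  fixes c :: "nat \<Rightarrow> complex"
  assumes "\<And>n. c (n + q) = c n"
  shows "(\<Sum>n\<in>{k*q..<k*q+q}. c n) = (\<Sum>n<q. c n)"
proof -
  have "c (n + k * q) = c n" for n using periodic_mod[of c q "n + k * q"] periodic_mod[of c q n] assms by simp
  moreover have "(\<Sum>n\<in>{k*q..<k*q+q}. c n) = (\<Sum>n<q. c (n + k * q))"
    using sum.shift_bounds_nat_ivl[of c 0 "k*q" q] by (simp add: lessThan_atLeast0 add.commute)
  ultimately show ?thesis by simp
qed

text \<open>Terms are grouped by periods. As the coefficients of a block sum to zero, n^(-s) may be
  replaced by its difference to the value at the start of the block, which gains one power of the
  block number. Block 0 starts at 0, where this comparison fails, and is treated apart.\<close>

lemma periodic_continuation: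
  fixes c :: "nat \<Rightarrow> complex"
  assumes q: "q > 0" and per: "\<And>n. c (n + q) = c n" and zero: "(\<Sum>n<q. c n) = 0"
    and bd: "\<And>n. norm (c n) \<le> B"
  obtains D where "D holomorphic_on {s. Re s > 0}"
    "\<And>s. Re s > 1 \<Longrightarrow> (\<lambda>n. c n * of_nat n powr (-s)) sums D s"
proof -
  define b where "b = (\<lambda>k s. \<Sum>n\<in>{k*q..<k*q+q}. c n * of_nat n powr (-s))"
  have B0: "B \<ge> 0" using bd[of 0] norm_ge_zero order_trans by blast
  have hol: "b k holomorphic_on X" for k X
  proof -
    have "(\<lambda>s. c n * of_nat n powr (-s)) holomorphic_on X" for n
      by (cases "n = 0") (auto intro!: holomorphic_intros)
    then show ?thesis unfolding b_def by (intro holomorphic_intros)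
  qed
  define g where "g = (\<lambda>s::complex. real q * (B * (norm s * real q)))"
  have cont: "continuous_on UNIV g" unfolding g_def by (intro continuous_intros)
  have bnd: "norm (b (Suc k) s) \<le> g s * real (Suc k) powr (- Re s - 1)" if s: "Re s > 0" for k s
  proof -
    let ?m = "Suc k * q"
    have "b (Suc k) s = (\<Sum>n\<in>{?m..<?m+q}. c n * of_nat n powr (-s)) - (\<Sum>n\<in>{?m..<?m+q}. c n) * of_nat ?m powr (-s)"
      using periodic_sum_block[of c q "Suc k"] per zero by (simp add: b_def)
    also have "\<dots> = (\<Sum>n\<in>{?m..<?m+q}. c n * (of_nat n powr (-s) - of_nat ?m powr (-s)))"
      by (simp add: sum_distrib_right sum_subtractf right_diff_distrib del: of_nat_mult)
    also have "norm \<dots> \<le> (\<Sum>n\<in>{?m..<?m+q}. B * (norm s * real q * real (Suc k) powr (- Re s - 1)))"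
    proof (rule sum_norm_le)
      fix n assume n: "n \<in> {?m..<?m+q}"
      have "norm (of_real (real n) powr (-s) - of_real (real ?m) powr (-s)) \<le> norm s * real ?m powr (- Re s - 1) * (real n - real ?m)"
        using n q s by (intro powr_diff_bound) (auto simp del: of_nat_mult of_nat_Suc)
      also have "\<dots> \<le> norm s * real (Suc k) powr (- Re s - 1) * real q"
      proof (intro mult_mono)
        show "real ?m powr (- Re s - 1) \<le> real (Suc k) powr (- Re s - 1)"
          using q s by (intro powr_mono2') (auto simp del: of_nat_Suc of_nat_mult mult_Suc)
        have "n \<le> ?m + q" using n by simp
        then have "real n \<le> real ?m + real q" by (metis of_nat_add of_nat_mono)
        then show "real n - real ?m \<le> real q" by simp
      qed (use n in \<open>auto simp del: of_nat_mult of_nat_Suc\<close>)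
      finally have "norm (of_nat n powr (-s) - of_nat ?m powr (-s)) \<le> norm s * real q * real (Suc k) powr (- Re s - 1)"
        by (simp add: mult_ac)
      then show "norm (c n * (of_nat n powr (-s) - of_nat ?m powr (-s))) \<le> B * (norm s * real q * real (Suc k) powr (- Re s - 1))"
        unfolding norm_mult using bd B0 by (intro mult_mono) auto
    qed
    also have "\<dots> = g s * real (Suc k) powr (- Re s - 1)" by (simp add: g_def)
    finally show ?thesis .
  qed
  note H = holomorphic_on_suminf_halfplane[OF hol cont bnd]
  define D where "D = (\<lambda>s. b 0 s + (\<Sum>k. b (Suc k) s))"
  have blk: "(\<lambda>k. b k s) sums D s" if "Re s > 0" for s
  proof -
    have "(\<lambda>k. b (Suc k) s) sums (\<Sum>k. b (Suc k) s)" using H(2) that by (simp add: summable_sums)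
    then show ?thesis by (subst (asm) sums_Suc_iff) (simp add: D_def add.commute)
  qed
  show ?thesis
  proof
    show "D holomorphic_on {s. Re s > 0}" unfolding D_def by (intro holomorphic_intros H(1) hol) auto
    show "(\<lambda>n. c n * of_nat n powr (-s)) sums D s" if "Re s > 1" for s
    proof -
      have "summable (\<lambda>n. c n * of_nat n powr (-s))"
        using sums_nat_powr_summable[OF that bd] by (rule summable_norm_cancel)
      then have S: "(\<lambda>n. c n * of_nat n powr (-s)) sums (\<Sum>n. c n * of_nat n powr (-s))" by (rule summable_sums)
      from sums_group[OF this q] have "(\<lambda>k. b k s) sums (\<Sum>n. c n * of_nat n powr (-s))"
        by (simp add: b_def)
      with blk[of s] that have "D s = (\<Sum>n. c n * of_nat n powr (-s))" by (simp add: sums_unique2)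
      then show ?thesis using S by simp
    qed
  qed
qed

lemma has_sum_suminf_nat:
  fixes f :: "nat \<Rightarrow> complex"
  assumes "summable (\<lambda>n. norm (f n))"
  shows "(f has_sum (\<Sum>n. f n)) UNIV"
  by (intro norm_summable_imp_has_sum assms summable_sums summable_norm_cancel[OF assms])

section \<open>Non-vanishing on the line Re s = 1\<close>

definition rough :: "nat set \<Rightarrow> nat set" where
  "rough P = {n. n > 0 \<and> (\<forall>p\<in>P. \<not> p dvd n)}"

text \<open>Multiplication by p maps \<open>rough P\<close> onto those of its elements that p
  divides, and f (p n) = f p f n; removing them therefore multiplies the sum by 1 - f p. This is the
  Euler product over finitely many primes.\<close>

lemma euler_sieve:
  fixes f :: "nat \<Rightarrow> complex"
  assumes mult: "\<And>m n. f (m * n) = f m * f n" and f0: "f 0 = 0"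
    and S: "(f has_sum D) UNIV"
    and P: "finite P" "\<And>p. p \<in> P \<Longrightarrow> prime p"
  shows "(f has_sum (D * (\<Prod>p\<in>P. 1 - f p))) (rough P)"
  using P
proof (induction P rule: finite_induct)
  case empty
  have "(f has_sum D) {0<..}"
    using S by (rule has_sum_cong_neutral[THEN iffD1, rotated -1]) (auto simp: f0)
  then show ?case by (simp add: rough_def greaterThan_def)
next
  case (insert p P)
  define X where "X = D * (\<Prod>p\<in>P. 1 - f p)"
  have X: "(f has_sum X) (rough P)" using insert unfolding X_def by auto
  have p: "prime p" using insert by auto
  have inj: "inj_on ((*) p) (rough P)" using p by (auto simp: inj_on_def)
  have "((\<lambda>n. f p * f n) has_sum (f p * X)) (rough P)" by (rule has_sum_cmult_right[OF X])
  then have "(f \<circ> ((*) p) has_sum (f p * X)) (rough P)" by (simp add: o_def mult)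
  then have "(f has_sum (f p * X)) ((*) p ` rough P)" using has_sum_reindex[OF inj] by blast
  moreover have sub: "(*) p ` rough P \<subseteq> rough P"
  proof
    fix n assume "n \<in> (*) p ` rough P"
    then obtain m where m: "n = p * m" "m \<in> rough P" by auto
    have "\<not> r dvd n" if "r \<in> P" for r
    proof
      assume "r dvd n"
      moreover have "prime r" using insert that by auto
      ultimately have "r dvd p \<or> r dvd m" using m by (simp add: prime_dvd_mult_iff)
      then have "r = p" using m that p \<open>prime r\<close> primes_dvd_imp_eq[of r p] by (auto simp: rough_def)
      then show False using that insert by auto
    qed
    then show "n \<in> rough P" using m p by (auto simp: rough_def prime_gt_0_nat)
  qed
  ultimately have "(f has_sum (X - f p * X)) (rough P - (*) p ` rough P)"
    by (rule has_sum_Diff[OF X])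
  moreover have "rough P - (*) p ` rough P = rough (insert p P)"
  proof -
    have "n \<in> (*) p ` rough P" if "p dvd n" "n \<in> rough P" for n
    proof -
      obtain m where m: "n = p * m" using \<open>p dvd n\<close> by (auto elim: dvdE)
      then have "m \<in> rough P" using that by (auto simp: rough_def)
      then show ?thesis using m by blast
    qed
    then show ?thesis using sub by (auto simp: rough_def)
  qed
  moreover have "X - f p * X = D * (\<Prod>p\<in>insert p P. 1 - f p)"
    using insert by (simp add: X_def algebra_simps)
  ultimately show ?case by simp
qed

text \<open>Every number other than 1 without prime factors up to N exceeds N, so the sifted sum
  differs from f 1 = 1 by at most a tail of the absolutely convergent series.\<close>

lemma euler_product_limit:
  fixes f :: "nat \<Rightarrow> complex"
  assumes mult: "\<And>m n. f (m * n) = f m * f n" and f0: "f 0 = 0" and f1: "f 1 = 1"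
    and S: "summable (\<lambda>n. norm (f n))"
  shows "(\<lambda>N. (\<Sum>n. f n) * (\<Prod>p | prime p \<and> p \<le> N. 1 - f p)) \<longlonglongrightarrow> 1"
proof -
  define P where "P = (\<lambda>N. {p. prime p \<and> p \<le> (N::nat)})"
  have fin: "finite (P N)" for N by (rule finite_subset[of _ "{..N}"]) (auto simp: P_def)
  have hs: "(f has_sum ((\<Sum>n. f n) * (\<Prod>p\<in>P N. 1 - f p))) (rough (P N))" for N
    using euler_sieve[OF mult f0 has_sum_suminf_nat[OF S] fin] by (auto simp: P_def)
  have sub: "rough (P N) - {1} \<subseteq> {N<..}" for N
  proof
    fix n assume n: "n \<in> rough (P N) - {1}"
    then have "n \<noteq> 1" "n > 0" by (auto simp: rough_def)
    then obtain p where p: "prime p" "p dvd n" using prime_factor_nat by blast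
    then have "p \<notin> P N" using n by (auto simp: rough_def)
    then have "p > N" using p by (auto simp: P_def)
    then show "n \<in> {N<..}" using p \<open>n > 0\<close> dvd_imp_le[of p n] by auto
  qed
  have tail: "norm ((\<Sum>n. f n) * (\<Prod>p\<in>P N. 1 - f p) - 1) \<le> (\<Sum>n. norm (f (n + Suc N)))" for N
  proof -
    have "(\<lambda>n. norm (f n)) summable_on UNIV"
      using S by (intro norm_summable_imp_summable_on) simp
    then have abssum: "(\<lambda>n. norm (f n)) summable_on X" for X
      by (rule summable_on_subset_banach) auto
    have 1: "1 \<in> rough (P N)" by (auto simp: rough_def P_def)
    have "(f has_sum ((\<Sum>n. f n) * (\<Prod>p\<in>P N. 1 - f p) - f 1)) (rough (P N) - {1})"
      using has_sum_Diff[OF hs[of N], where a = "f 1" and A = "{1}"] 1 by (simp add: has_sum_finiteI)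
    then have "infsum f (rough (P N) - {1}) = (\<Sum>n. f n) * (\<Prod>p\<in>P N. 1 - f p) - f 1" by (rule infsumI)
    then have "norm ((\<Sum>n. f n) * (\<Prod>p\<in>P N. 1 - f p) - 1) \<le> infsum (\<lambda>n. norm (f n)) (rough (P N) - {1})"
      using norm_infsum_bound[OF abssum, of "rough (P N) - {1}"] f1 by simp
    also have "\<dots> \<le> infsum (\<lambda>n. norm (f n)) {N<..}"
    proof (rule infsum_mono_neutral)
      show "(\<lambda>n. norm (f n)) summable_on (rough (P N) - {1})" "(\<lambda>n. norm (f n)) summable_on {N<..}"
        by (rule abssum)+
    qed (use sub in auto)
    also have "{N<..} = (\<lambda>n. n + Suc N) ` UNIV"
    proof -
      have "n \<in> (\<lambda>n. n + Suc N) ` UNIV" if "n > N" for n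
        using that by (intro image_eqI[of _ _ "n - Suc N"]) auto
      then show ?thesis by auto
    qed
    also have "infsum (\<lambda>n. norm (f n)) \<dots> = infsum (\<lambda>n. norm (f (n + Suc N))) UNIV"
      by (subst infsum_reindex) (auto simp: inj_on_def o_def)
    also have "\<dots> = (\<Sum>n. norm (f (n + Suc N)))"
      using summable_ignore_initial_segment[OF S, of "Suc N"]
      by (intro infsumI norm_summable_imp_has_sum) (auto intro: summable_sums)
    finally show ?thesis .
  qed
  have lim0: "(\<lambda>N. (\<Sum>n. norm (f (n + Suc N)))) \<longlonglongrightarrow> 0"
    using LIMSEQ_Suc[OF suminf_exist_split2[OF S]] by simp 
  have "(\<lambda>N. (\<Sum>n. f n) * (\<Prod>p\<in>P N. 1 - f p) - 1) \<longlonglongrightarrow> 0"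
    by (rule Lim_null_comparison[OF always_eventually[OF allI] lim0]) (rule tail)
  then show ?thesis unfolding P_def by (rule LIM_zero_cancel)
qed

text \<open>In the logarithm, the power series of ln \<bar>1 - r z^i\<bar> for i = 0, 1, 2 with
  weights 3, 4, 1 combine termwise to - r^n / n times 3 + 4 Re u + Re (u^2) with u = z^n, and this
  last factor is 2 (1 + Re u)^2.\<close>

lemma three_four_one:
  fixes r :: real and z :: complex
  assumes r: "0 \<le> r" "r < 1" and z: "norm z = 1"
  shows "norm (1 - complex_of_real r) ^ 3 * norm (1 - of_real r * z) ^ 4 * norm (1 - of_real r * z\<^sup>2) \<le> 1"
proof -
  define w where "w = (\<lambda>i. - (of_real r * z ^ i))"
  have nw: "norm (w i) < 1" for i using r z by (simp add: w_def norm_mult norm_power)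
  have ne: "1 + w i \<noteq> 0" for i
    by (metis add_eq_0_iff2 nw norm_minus_cancel norm_one less_irrefl)
  have S: "(\<lambda>n. Re (- ((- w i) ^ n) / of_nat n)) sums ln (norm (1 + w i))" for i
    using sums_Re[OF Ln_series'[OF nw[of i]]] ne[of i] by simp
  have "(\<lambda>n. 3 * Re (- ((- w 0) ^ n) / of_nat n) + 4 * Re (- ((- w 1) ^ n) / of_nat n) + Re (- ((- w 2) ^ n) / of_nat n)) sums
     (3 * ln (norm (1 + w 0)) + 4 * ln (norm (1 + w 1)) + ln (norm (1 + w 2)))"
    by (intro sums_add sums_mult S)
  moreover have "3 * Re (- ((- w 0) ^ n) / of_nat n) + 4 * Re (- ((- w 1) ^ n) / of_nat n) + Re (- ((- w 2) ^ n) / of_nat n) \<le> 0" for n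
  proof -
    define u where "u = z ^ n"
    have nu: "norm u = 1" using z by (simp add: u_def norm_power)
    have "Re (u\<^sup>2) = 2 * (Re u)\<^sup>2 - 1"
      using nu by (simp add: cmod_def power2_eq_square algebra_simps real_sqrt_eq_1_iff)
    then have "3 + 4 * Re u + Re (u\<^sup>2) = 2 * (1 + Re u)\<^sup>2" by (simp add: power2_eq_square algebra_simps)
    then have "3 + 4 * Re u + Re (u\<^sup>2) \<ge> 0" by simp
    moreover have "3 * Re (- ((- w 0) ^ n) / of_nat n) + 4 * Re (- ((- w 1) ^ n) / of_nat n) + Re (- ((- w 2) ^ n) / of_nat n)
       = - (r ^ n / real n) * (3 + 4 * Re u + Re (u\<^sup>2))"
    proof -
      have "(- w i) ^ n = of_real (r ^ n) * u ^ i" for i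
        by (simp add: w_def u_def power_mult_distrib mult.commute flip: power_mult)
      then have "- ((- w i) ^ n) / of_nat n = of_real (- (r ^ n / real n)) * u ^ i" for i
        by simp
      then have "Re (- ((- w i) ^ n) / of_nat n) = - (r ^ n / real n) * Re (u ^ i)" for i
        by (simp only: Re_complex_of_real Im_complex_of_real times_complex.sel mult_zero_left diff_zero)
      then show ?thesis by (simp only: power_0 power_one_right one_complex.sel) (simp add: algebra_simps)
    qed
    moreover have "r ^ n / real n \<ge> 0" using r by simp
    ultimately show ?thesis by (metis mult_minus_left mult_nonneg_nonneg neg_le_0_iff_le)
  qed
  ultimately have le: "3 * ln (norm (1 + w 0)) + 4 * ln (norm (1 + w 1)) + ln (norm (1 + w 2)) \<le> 0"
    by (metis (no_types, lifting) sums_le sums_zero)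
  have pos: "norm (1 + w i) > 0" for i using ne by simp
  have "ln (norm (1 + w 0) ^ 3 * norm (1 + w 1) ^ 4 * norm (1 + w 2)) \<le> 0"
    using le pos by (simp add: ln_mult ln_realpow)
  then have "norm (1 + w 0) ^ 3 * norm (1 + w 1) ^ 4 * norm (1 + w 2) \<le> 1"
    using pos by (subst (asm) ln_le_zero_iff) (auto intro!: mult_pos_pos)
  then show ?thesis by (simp add: w_def)
qed

lemma zeta_real_bound:
  assumes "\<sigma> > 1"
  shows "(\<Sum>n. real n powr (-\<sigma>)) \<le> 1 + 1 / (\<sigma> - 1)"
proof -
  have S: "summable (\<lambda>n. real n powr (-\<sigma>))" using assms by (simp add: summable_real_powr_iff)
  have "(\<Sum>n. real n powr (-\<sigma>)) = (\<Sum>n. real (n + 2) powr (-\<sigma>)) + (\<Sum>n<2. real n powr (-\<sigma>))"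
    by (rule suminf_split_initial_segment[OF S])
  also have "(\<Sum>n<2. real n powr (-\<sigma>)) = 1" by (simp add: numeral_2_eq_2)
  also have "(\<Sum>n. real (n + 2) powr (-\<sigma>)) \<le> 1 / (\<sigma> - 1)"
  proof (rule suminf_le_const)
    show "summable (\<lambda>n. real (n + 2) powr (-\<sigma>))" using summable_ignore_initial_segment[OF S] .
    show "(\<Sum>n<M. real (n + 2) powr (-\<sigma>)) \<le> 1 / (\<sigma> - 1)" for M
      using sums_powr_tail_le[of "\<sigma> - 1" 1 M] assms by simp
  qed
  finally show ?thesis by simp
qed

lemma powr_nat_mult: "complex_of_nat (m * n) powr s = of_nat m powr s * of_nat n powr s"
  using powr_times_real[of "of_nat m" "of_nat n" s] by simp

text \<open>The inequality for single primes bounds the corresponding product of finite Euler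
  factors by 1, while each series times its Euler factors tends to 1; so the product of the series
  values is at least 1 in the limit. The first series is then estimated by zeta (\<sigma>) <= 1 + 1
  / (\<sigma> - 1).\<close>

lemma one_line_lower_bound:
  fixes ch :: "nat \<Rightarrow> complex" and \<sigma> t :: real
  assumes mult: "\<And>m n. ch (m * n) = ch m * ch n" and one: "ch 1 = 1"
    and nrm: "\<And>n. ch n = 0 \<or> norm (ch n) = 1" and \<sigma>: "\<sigma> > 1"
    and D1: "(\<lambda>n. ch n * of_nat n powr (- Complex \<sigma> t)) sums D1"
    and D2: "(\<lambda>n. ch n ^ 2 * of_nat n powr (- Complex \<sigma> (2 * t))) sums D2"
  shows "1 \<le> (1 + 1 / (\<sigma> - 1)) ^ 3 * norm D1 ^ 4 * norm D2"
proof -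
  \<comment> \<open>For i = 0 the coefficient is \<open>norm (ch n)\<close> and not
    \<open>ch n ^ 0\<close>, so that at a prime where \<open>ch\<close> vanishes all three Euler
    factors are 1.\<close>
  define f where "f = (\<lambda>(i::nat) n. (if i = 0 then of_real (norm (ch n)) else ch n ^ i) * of_nat n powr (- Complex \<sigma> (real i * t)))"
  have le1: "norm (ch n) \<le> 1" for n using nrm[of n] by auto
  have m: "f i (m * n) = f i m * f i n" for i m n
    unfolding f_def powr_nat_mult mult by (simp add: norm_mult power_mult_distrib)
  have z: "f i 0 = 0" for i by (simp add: f_def)
  have o: "f i 1 = 1" for i using one by (simp add: f_def)
  have S: "summable (\<lambda>n. norm (f i n))" for i
    unfolding f_def using \<sigma> le1
    by (intro sums_nat_powr_summable[where B = 1]) (auto simp: norm_power power_le_one)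
  define D where "D = (\<lambda>i. \<Sum>n. f i n)"
  define E where "E = (\<lambda>i N. \<Prod>p | prime p \<and> p \<le> N. 1 - f i p)"
  have lim: "(\<lambda>N. D i * E i N) \<longlonglongrightarrow> 1" for i
    unfolding D_def E_def by (rule euler_product_limit[OF m z o S])
  have "(\<lambda>N. norm (D 0 * E 0 N) ^ 3 * norm (D 1 * E 1 N) ^ 4 * norm (D 2 * E 2 N)) \<longlonglongrightarrow> norm (1::complex) ^ 3 * norm (1::complex) ^ 4 * norm (1::complex)"
    by (intro tendsto_intros lim)
  moreover have "norm (D 0 * E 0 N) ^ 3 * norm (D 1 * E 1 N) ^ 4 * norm (D 2 * E 2 N) \<le> norm (D 0) ^ 3 * norm (D 1) ^ 4 * norm (D 2)" for N
  proof -
    have loc: "norm (1 - f 0 p) ^ 3 * norm (1 - f 1 p) ^ 4 * norm (1 - f 2 p) \<le> 1" if p: "prime p" for p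
    proof (cases "ch p = 0")
      case False
      define r where "r = real p powr (-\<sigma>)"
      define z where "z = ch p * of_nat p powr (- Complex 0 t)"
      have p0: "p > 1" using p by (rule prime_gt_1_nat)
      have r: "0 \<le> r" "r < 1" using p0 \<sigma> by (auto simp: r_def powr_less_one)
      have nz: "norm z = 1" using nrm[of p] False p0 by (simp add: z_def norm_mult norm_powr_real_powr)
      have pw: "of_nat p powr (- Complex \<sigma> u) = of_real r * of_nat p powr (- Complex 0 u)" for u
      proof -
        have "- Complex \<sigma> u = of_real (-\<sigma>) + (- Complex 0 u)" by (simp add: complex_eq_iff)
        then have "of_nat p powr (- Complex \<sigma> u) = of_nat p powr (of_real (-\<sigma>)) * of_nat p powr (- Complex 0 u)"
          by (simp only: powr_add)
        moreover have "of_nat p powr (of_real (-\<sigma>)) = complex_of_real r"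
          unfolding r_def using powr_of_real[of "real p" "-\<sigma>"] by simp
        ultimately show ?thesis by simp
      qed
      have "f 0 p = of_real r" using pw[of 0] nrm[of p] False p0 by (simp add: f_def zero_complex.code[symmetric])
      moreover have "f 1 p = of_real r * z" using pw[of t] by (simp add: f_def z_def)
      moreover have "f 2 p = of_real r * z\<^sup>2"
      proof -
        have "of_nat p powr (- Complex 0 (2 * t)) = (of_nat p powr (- Complex 0 t))\<^sup>2"
        proof -
          have "- Complex 0 (2 * t) = (- Complex 0 t) + (- Complex 0 t)" by (simp add: complex_eq_iff)
          then show ?thesis by (simp only: powr_add power2_eq_square)
        qed
        then show ?thesis using pw[of "2 * t"] by (simp add: f_def z_def power_mult_distrib)
      qed
      ultimately show ?thesis using three_four_one[OF r nz] by simp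
    qed (simp add: f_def)
    have "norm (E 0 N) ^ 3 * norm (E 1 N) ^ 4 * norm (E 2 N) = 
        (\<Prod>p | prime p \<and> p \<le> N. norm (1 - f 0 p) ^ 3 * norm (1 - f 1 p) ^ 4 * norm (1 - f 2 p))"
      by (simp add: E_def prod_norm[symmetric] prod.distrib prod_power_distrib)
    also have "\<dots> \<le> 1" using loc by (intro prod_le_1) auto
    finally have E1: "norm (E 0 N) ^ 3 * norm (E 1 N) ^ 4 * norm (E 2 N) \<le> 1" .
    have "norm (D 0 * E 0 N) ^ 3 * norm (D 1 * E 1 N) ^ 4 * norm (D 2 * E 2 N) =
      (norm (D 0) ^ 3 * norm (D 1) ^ 4 * norm (D 2)) * (norm (E 0 N) ^ 3 * norm (E 1 N) ^ 4 * norm (E 2 N))"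
      by (simp add: norm_mult power_mult_distrib)
    also have "\<dots> \<le> norm (D 0) ^ 3 * norm (D 1) ^ 4 * norm (D 2)"
      using E1 by (intro mult_right_le_one_le) auto
    finally show ?thesis .
  qed
  ultimately have ge: "1 \<le> norm (D 0) ^ 3 * norm (D 1) ^ 4 * norm (D 2)"
    by (intro LIMSEQ_le_const2) auto
  have "norm (D 0) \<le> (\<Sum>n. norm (f 0 n))" unfolding D_def by (rule summable_norm[OF S])
  also have "\<dots> \<le> (\<Sum>n. real n powr (-\<sigma>))"
  proof (rule suminf_le[OF _ S])
    show "norm (f 0 n) \<le> real n powr (-\<sigma>)" for n
      using le1[of n] by (simp add: f_def norm_mult norm_nat_powr mult_left_le_one_le)
    show "summable (\<lambda>n. real n powr (-\<sigma>))" using \<sigma> by (simp add: summable_real_powr_iff)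
  qed
  also have "\<dots> \<le> 1 + 1 / (\<sigma> - 1)" by (rule zeta_real_bound[OF \<sigma>])
  finally have D0: "norm (D 0) \<le> 1 + 1 / (\<sigma> - 1)" .
  have "D 1 = D1" "D 2 = D2"
    using D1 D2 by (auto simp: D_def f_def sums_iff)
  moreover have "norm (D 0) ^ 3 * norm (D 1) ^ 4 * norm (D 2) \<le> (1 + 1 / (\<sigma> - 1)) ^ 3 * norm (D 1) ^ 4 * norm (D 2)"
    using D0 by (intro mult_right_mono power_mono) auto
  ultimately show ?thesis using ge by simp
qed

text \<open>At distance e to the right of a zero of \<open>K\<close> the fourth power of
  \<open>K\<close> is O(e^4), which outweighs the factor (1 + 1 / e)^3 as long as \<open>L\<close>,
  the series of the square at height 2 t, stays bounded. The lower bound 1 is then violated as e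
  tends to 0.\<close>

lemma nonvanishing_one_line:
  fixes ch :: "nat \<Rightarrow> complex" and t :: real
  assumes mult: "\<And>m n. ch (m * n) = ch m * ch n" and one: "ch 1 = 1"
    and nrm: "\<And>n. ch n = 0 \<or> norm (ch n) = 1"
    and K: "K field_differentiable (at (Complex 1 t))" "\<And>s. Re s > 1 \<Longrightarrow> (\<lambda>n. ch n * of_nat n powr (- s)) sums K s"
    and L: "isCont L (Complex 1 (2 * t))" "\<And>s. Re s > 1 \<Longrightarrow> (\<lambda>n. ch n ^ 2 * of_nat n powr (- s)) sums L s"
  shows "K (Complex 1 t) \<noteq> 0"
proof
  assume zero: "K (Complex 1 t) = 0"
  define e where "e = (\<lambda>k::nat. 1 / real (Suc k))"
  have e0: "e k > 0" for k by (simp add: e_def)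
  have e: "e \<longlonglongrightarrow> 0" unfolding e_def by real_asymp
  have ge: "1 \<le> (1 + 1 / e k) ^ 3 * norm (K (Complex 1 t + of_real (e k))) ^ 4 * norm (L (Complex 1 (2 * t) + of_real (e k)))" for k
  proof -
    have eq: "Complex 1 u + of_real (e k) = Complex (1 + e k) u" for u by (simp add: complex_eq_iff)
    show ?thesis
      using one_line_lower_bound[OF mult one nrm, of "1 + e k" t] e0[of k] K(2)[of "Complex (1 + e k) t"] L(2)[of "Complex (1 + e k) (2*t)"]
      by (simp add: eq)
  qed
  obtain d where "(K has_field_derivative d) (at (Complex 1 t))"
    using K(1) by (auto simp: field_differentiable_def)
  then have "((\<lambda>h. (K (Complex 1 t + h) - K (Complex 1 t)) / h) \<longlongrightarrow> d) (at 0)" by (simp add: DERIV_def)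
  moreover have "filterlim (\<lambda>k. complex_of_real (e k)) (at 0) sequentially"
    using e0 e tendsto_of_real[OF e, where 'a = complex] by (auto simp: filterlim_at intro!: always_eventually less_imp_neq[THEN not_sym])
  ultimately have "(\<lambda>k. (K (Complex 1 t + of_real (e k)) - K (Complex 1 t)) / of_real (e k)) \<longlonglongrightarrow> d"
    by (rule filterlim_compose)
  then have q: "(\<lambda>k. K (Complex 1 t + of_real (e k)) / of_real (e k)) \<longlonglongrightarrow> d" using zero by simp
  have ec: "(\<lambda>k. complex_of_real (e k)) \<longlonglongrightarrow> 0" using tendsto_of_real[OF e, where 'a = complex] by simp
  have "(\<lambda>k. L (Complex 1 (2 * t) + of_real (e k))) \<longlonglongrightarrow> L (Complex 1 (2 * t))"
    by (rule isCont_tendsto_compose[OF L(1)]) (use tendsto_add[OF tendsto_const ec] in auto)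
  then have "(\<lambda>k. (1 + e k) ^ 3 * norm (K (Complex 1 t + of_real (e k)) / of_real (e k)) ^ 4 * e k * norm (L (Complex 1 (2 * t) + of_real (e k))))
     \<longlonglongrightarrow> (1 + 0) ^ 3 * norm d ^ 4 * 0 * norm (L (Complex 1 (2 * t)))"
    by (intro tendsto_intros e q)
  moreover have "(1 + e k) ^ 3 * norm (K (Complex 1 t + of_real (e k)) / of_real (e k)) ^ 4 * e k * norm (L (Complex 1 (2 * t) + of_real (e k)))
     = (1 + 1 / e k) ^ 3 * norm (K (Complex 1 t + of_real (e k))) ^ 4 * norm (L (Complex 1 (2 * t) + of_real (e k)))" for k
  proof -
    have "(1 + 1 / e k) = (1 + e k) / e k" using e0[of k] by (simp add: field_simps)
    then show ?thesis using e0[of k] by (simp add: norm_divide power_divide power3_eq_cube power4_eq_xxxx)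
  qed
  ultimately have "(1::real) \<le> 0" using ge by (intro LIMSEQ_le_const) auto
  then show False by simp
qed

section \<open>Characters\<close>

text \<open>The space that the characters modulo q span. It contains the indicator of the solutions
  of r n = 1 modulo q, which is all that is needed of it.\<close>

definition residue_fun :: "nat \<Rightarrow> (nat \<Rightarrow> complex) \<Rightarrow> bool" where
  "residue_fun q f \<longleftrightarrow> (\<forall>n. f (n + q) = f n) \<and> (\<forall>n. \<not> coprime n q \<longrightarrow> f n = 0)"

text \<open>Dirichlet characters modulo q, extended by 0. That the values at units have norm 1 is
  derived from Euler's theorem in \<open>character_norm\<close>.\<close>

definition character :: "nat \<Rightarrow> (nat \<Rightarrow> complex) \<Rightarrow> bool" where
  "character q f \<longleftrightarrow> residue_fun q f \<and> (\<forall>m n. f (m * n) = f m * f n) \<and> f 1 = 1"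

lemma residue_fun_cong:
  assumes "residue_fun q f" "[m = n] (mod q)"
  shows "f m = f n"
proof -
  have "f (r + k * q) = f r" for r k
  proof (induction k)
    case (Suc k)
    then show ?case using assms(1) unfolding residue_fun_def by (metis add.assoc add.commute mult_Suc)
  qed auto
  from this[of "m mod q" "m div q"] this[of "n mod q" "n div q"] show ?thesis
    using assms(2) by (simp add: cong_def)
qed

lemma sum_roots_of_unity:
  fixes N j :: nat
  assumes "N > 0"
  shows "(\<Sum>k<N. cis (2 * pi * real k / real N) ^ j) = (if N dvd j then of_nat N else 0)"
proof -
  define w where "w = cis (2 * pi * real j / real N)"
  have "(\<Sum>k<N. cis (2 * pi * real k / real N) ^ j) = (\<Sum>k<N. w ^ k)"
    by (intro sum.cong) (auto simp: w_def Complex.DeMoivre mult_ac)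
  also have "\<dots> = (if N dvd j then of_nat N else 0)"
  proof (cases "N dvd j")
    case True
    then obtain m where "j = N * m" by auto
    then have "w = 1" using assms cis_multiple_2pi[of "real m"] by (simp add: w_def mult_ac)
    then show ?thesis using True by simp
  next
    case False
    have "w \<noteq> 1"
    proof
      assume "w = 1"
      then have "cos (2 * pi * real j / real N) = 1" by (simp add: w_def complex_eq_iff)
      then obtain i :: int where "2 * pi * real j / real N = of_int i * 2 * pi" using cos_one_2pi_int by auto
      then have "real j = of_int i * real N" using assms by (simp add: field_simps)
      then have "int j = i * int N" by (metis of_int_eq_iff of_int_mult of_int_of_nat_eq)
      then have "int N dvd int j" by simp
      then show False using False by (simp add: int_dvd_int_iff)
    qed
    moreover have "w ^ N = 1"
      using assms cis_multiple_2pi[of "real j"] by (simp add: w_def Complex.DeMoivre)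
    ultimately show ?thesis using False by (simp add: geometric_sum)
  qed
  finally show ?thesis .
qed

text \<open>Every residue function is a linear combination of characters: averaging over the powers of
  a unit \<open>h\<close> splits a function into eigenfunctions of the translation by \<open>h\<close>, and a common
  eigenfunction of all translations is a multiple of a character. This replaces the
  orthogonality relations.\<close>
lemma residue_fun_induct [consumes 2, case_names char scale sum]:
  assumes q: "q > 0" and f: "residue_fun q f"
    and char: "\<And>ch. character q ch \<Longrightarrow> T ch"
    and scale: "\<And>c g. T g \<Longrightarrow> T (\<lambda>n. c * g n)"
    and sum: "\<And>g (N::nat). (\<And>k. k < N \<Longrightarrow> T (g k)) \<Longrightarrow> T (\<lambda>n. \<Sum>k<N. g k n)"
  shows "T f"
proof -
  have zero: "T (\<lambda>n. 0)" using sum[of 0 "\<lambda>_ _. 0"] by simp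
  define U where "U = {h. h < q + 1 \<and> coprime h q}"
  have finU: "finite U" unfolding U_def by auto
  \<comment> \<open>\<open>A\<close> holds the units for which \<open>g\<close> need not yet be an
    eigenfunction. Each induction step removes one of them and replaces \<open>g\<close> by finitely
    many eigencomponents.\<close>
  have main: "T g" if "A \<subseteq> U" "residue_fun q g" "\<And>h. h \<in> U - A \<Longrightarrow> \<exists>w. \<forall>n. g (h * n) = w * g n" for A g
    using finite_subset[OF that(1) finU] that
  proof (induction A arbitrary: g rule: finite_induct)
    case empty
    have eig: "\<exists>w. \<forall>n. g (h * n) = w * g n" if "coprime h q" for h
    proof -
      have "h mod q \<in> U" using that q by (auto simp: U_def less_Suc_eq)
      then obtain w where w: "\<And>n. g ((h mod q) * n) = w * g n" using empty by blast
      have "g (h * n) = g ((h mod q) * n)" for n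
        by (rule residue_fun_cong[OF empty(2)]) (simp add: cong_def mod_mult_left_eq)
      then show ?thesis using w by auto
    qed
    \<comment> \<open>The eigenvalue is found at n = 1: it is g h / g 1. Hence g / g 1 is
      multiplicative whenever g 1 is nonzero.\<close>
    have gh: "g (h * n) * g 1 = g h * g n" if h: "coprime h q" for h n
    proof -
      obtain w where w: "\<And>n. g (h * n) = w * g n" using eig[OF h] by blast
      show ?thesis using w[of n] w[of 1] by simp
    qed
    have nz: "g n = 0" if "\<not> coprime n q" for n using empty(2) that by (auto simp: residue_fun_def)
    show ?case
    proof (cases "g 1 = 0")
      case True
      have "g n = 0" for n
      proof (cases "coprime n q")
        case True
        obtain w where "\<And>m. g (n * m) = w * g m" using eig[OF True] by blast
        from this[of 1] \<open>g 1 = 0\<close> show ?thesis by simp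
      qed (use nz in auto)
      then have "g = (\<lambda>n. 0)" by auto
      then show ?thesis using zero by simp
    next
      case False
      define ch where "ch = (\<lambda>n. g n / g 1)"
      have "ch (m * n) = ch m * ch n" for m n
      proof (cases "coprime m q")
        case True
        then show ?thesis using gh[OF True, of n] False by (simp add: ch_def field_simps)
      next
        case False
        then have "\<not> coprime (m * n) q" by simp
        then show ?thesis using nz False by (simp add: ch_def)
      qed
      then have "character q ch" using empty(2) False by (auto simp: character_def residue_fun_def ch_def)
      then have "T (\<lambda>n. g 1 * ch n)" using char scale by blast
      moreover have "(\<lambda>n. g 1 * ch n) = g" using False by (auto simp: ch_def)
      ultimately show ?thesis by simp
    qed
  next
    case (insert h A)
    have h: "h \<in> U" "coprime h q" using insert by (auto simp: U_def)
    define N where "N = totient q"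
    have N: "N > 0" using q by (simp add: N_def)
    have hN: "[h ^ N = 1] (mod q)" unfolding N_def using h by (intro euler_theorem) auto
    define \<omega> where "\<omega> = (\<lambda>k::nat. cis (2 * pi * real k / real N))"
    have \<omega>N: "\<omega> k ^ N = 1" for k using N cis_multiple_2pi[of "real k"] by (simp add: \<omega>_def Complex.DeMoivre)
    \<comment> \<open>Up to the factor 1 / N, \<open>p k\<close> projects onto the eigenspace of
      translation by \<open>h\<close> with eigenvalue \<omega> k. The exponent N - j stands for - j,
      which is the same because \<omega> k is an N-th root of unity.\<close>
    define p where "p = (\<lambda>k n. \<Sum>j<N. \<omega> k ^ (N - j) * g (h ^ j * n))"
    have p_eig: "p k (h * n) = \<omega> k * p k n" for k n
    proof -
      \<comment> \<open>Translation by \<open>h\<close> shifts the index of \<open>F\<close> by one,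
        and the two ends of the sum agree because h^N = 1 modulo q.\<close>
      define F where "F = (\<lambda>j. \<omega> k ^ (Suc N - j) * g (h ^ j * n))"
      have "p k (h * n) = (\<Sum>j<N. F (Suc j))"
        unfolding p_def F_def by (intro sum.cong) (auto simp: mult_ac)
      also have "\<dots> = (\<Sum>j<N. F j) + F N - F 0"
        using sum.lessThan_Suc_shift[of F N] sum.lessThan_Suc[of F N] by (simp add: algebra_simps)
      also have "F N = F 0"
      proof -
        have "g (h ^ N * n) = g n"
          using cong_mult[OF hN cong_refl[of n]] by (intro residue_fun_cong[OF insert.prems(2)]) simp
        then show ?thesis using \<omega>N by (simp add: F_def)
      qed
      also have "(\<Sum>j<N. F j) + F 0 - F 0 = \<omega> k * p k n"
        unfolding p_def F_def sum_distrib_left by (auto intro!: sum.cong simp: Suc_diff_le mult_ac)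
      finally show ?thesis .
    qed
    \<comment> \<open>Translations commute, so the projection keeps the eigenfunction property
      already secured for other units.\<close>
    have p_eig': "\<exists>w. \<forall>n. p k (h' * n) = w * p k n" if "h' \<in> U - A" for k h'
    proof (cases "h' = h")
      case True
      then show ?thesis using p_eig by blast
    next
      case False
      then have "h' \<in> U - insert h A" using that by auto
      then obtain w where w: "\<And>n. g (h' * n) = w * g n" using insert.prems(3) by blast
      have "p k (h' * n) = w * p k n" for n
      proof -
        have "g (h ^ j * (h' * n)) = w * g (h ^ j * n)" for j using w[of "h ^ j * n"] by (simp add: mult_ac)
        then show ?thesis unfolding p_def by (simp add: sum_distrib_left mult_ac)
      qed
      then show ?thesis by blast
    qed
    have p_res: "residue_fun q (p k)" for k
      unfolding residue_fun_def
    proof (intro conjI allI impI)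
      fix n
      have "g (h ^ j * (n + q)) = g (h ^ j * n)" for j
        by (rule residue_fun_cong[OF insert.prems(2)]) (simp add: cong_def distrib_left)
      then show "p k (n + q) = p k n" by (simp add: p_def)
      assume "\<not> coprime n q"
      then have "\<not> coprime (h ^ j * n) q" for j by simp
      then have "g (h ^ j * n) = 0" for j using insert.prems(2) by (auto simp: residue_fun_def)
      then show "p k n = 0" by (simp add: p_def)
    qed
    have "T (p k)" for k
      using insert.prems(1) p_eig' by (intro insert.IH p_res) auto
    then have "T (\<lambda>n. 1 / of_nat N * (\<Sum>k<N. p k n))" by (intro scale sum) auto
    moreover have "1 / of_nat N * (\<Sum>k<N. p k n) = g n" for n
    proof -
      have "(\<Sum>k<N. p k n) = (\<Sum>j<N. (\<Sum>k<N. \<omega> k ^ (N - j)) * g (h ^ j * n))"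
        unfolding p_def by (subst sum.swap) (simp add: sum_distrib_right)
      also have "\<dots> = (\<Sum>j<N. if j = 0 then of_nat N * g n else 0)"
      proof (intro sum.cong refl)
        fix j assume j: "j \<in> {..<N}"
        have "N dvd (N - j) \<longleftrightarrow> j = 0" using j dvd_imp_le[of N "N - j"] by auto
        then show "(\<Sum>k<N. \<omega> k ^ (N - j)) * g (h ^ j * n) = (if j = 0 then of_nat N * g n else 0)"
          using sum_roots_of_unity[OF N, of "N - j"] by (auto simp: \<omega>_def)
      qed
      also have "\<dots> = of_nat N * g n" using N by simp
      finally show ?thesis using N by simp
    qed
    ultimately show ?case by simp
  qed
  show ?thesis by (rule main[of U]) (use f in auto)
qed

lemma character_norm:
  assumes "character q ch" "q > 0" "coprime n q"
  shows "norm (ch n) = 1"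
proof -
  have pow: "ch (n ^ k) = ch n ^ k" for k
    by (induction k) (use assms(1) in \<open>auto simp: character_def\<close>)
  have "ch (n ^ totient q) = ch 1"
    using assms euler_theorem[of n q] by (intro residue_fun_cong[of q]) (auto simp: character_def)
  then have "ch n ^ totient q = 1" using pow assms by (simp add: character_def)
  then show ?thesis using power_eq_1_iff[of "ch n" "totient q"] assms by simp
qed

lemma character_norm_le: "character q ch \<Longrightarrow> q > 0 \<Longrightarrow> norm (ch n) \<le> 1"
  using character_norm[of q ch n] by (cases "coprime n q") (auto simp: character_def residue_fun_def)

lemma character_sum_zero:
  assumes ch: "character q ch" and q: "q > 0" and a: "coprime a q" "ch a \<noteq> 1"
  shows "(\<Sum>n<q. ch n) = 0"
proof -
  have "bij_betw (\<lambda>n. a * n mod q) {..<q} {..<q}"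
  proof -
    have "inj_on (\<lambda>n. a * n mod q) {..<q}"
    proof (rule inj_onI)
      fix x y assume xy: "x \<in> {..<q}" "y \<in> {..<q}" "a * x mod q = a * y mod q"
      then have "[a * x = a * y] (mod q)" by (simp add: cong_def)
      then have "[x = y] (mod q)" using a by (simp add: cong_mult_lcancel_nat)
      then show "x = y" using xy by (simp add: cong_def)
    qed
    moreover have "(\<lambda>n. a * n mod q) ` {..<q} \<subseteq> {..<q}" using q by auto
    ultimately show ?thesis by (simp add: bij_betw_def card_image card_subset_eq)
  qed
  then have "(\<Sum>n<q. ch (a * n mod q)) = (\<Sum>n<q. ch n)" by (rule sum.reindex_bij_betw)
  moreover have "ch (a * n mod q) = ch a * ch n" for n
    using ch residue_fun_cong[of q ch "a * n mod q" "a * n"] by (auto simp: character_def cong_def)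
  ultimately have "ch a * (\<Sum>n<q. ch n) = (\<Sum>n<q. ch n)" by (simp add: sum_distrib_left)
  then show ?thesis using a by (metis mult_cancel_right1)
qed

section \<open>Non-vanishing at s = 1\<close>

lemma sum_divisors_prime_power_mult:
  fixes f :: "nat \<Rightarrow> real"
  assumes mult: "\<And>m n. f (m * n) = f m * f n" and p: "prime p" "\<not> p dvd m" and m: "m > 0"
  shows "(\<Sum>d | d dvd p ^ k * m. f d) = (\<Sum>j\<le>k. f p ^ j) * (\<Sum>d | d dvd m. f d)"
proof -
  have f1: "f (p ^ j * d) = f p ^ j * f d" for j d
    by (induction j) (auto simp: mult mult_ac)
  have "bij_betw (\<lambda>(j, d). p ^ j * d) ({..k} \<times> {d. d dvd m}) {d. d dvd p ^ k * m}"
  proof (rule bij_betw_imageI)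
    show "inj_on (\<lambda>(j, d). p ^ j * d) ({..k} \<times> {d. d dvd m})"
    proof (rule inj_onI, clarsimp)
      fix i j d e assume *: "d dvd m" "e dvd m" "p ^ i * d = p ^ j * e"
      have nd: "\<not> p dvd d" "\<not> p dvd e" using * p by (auto dest: dvd_trans)
      then have "d \<noteq> 0" "e \<noteq> 0" by (metis dvd_0_right)+
      have "multiplicity p (p ^ i * d) = i" "multiplicity p (p ^ j * e) = j"
        using nd p \<open>d \<noteq> 0\<close> \<open>e \<noteq> 0\<close> by (auto simp: prime_elem_multiplicity_mult_distrib not_dvd_imp_multiplicity_0 prime_gt_0_nat)
      then have "i = j" using * by simp
      then show "i = j \<and> d = e" using * p by (auto simp: prime_gt_0_nat)
    qed
    show "(\<lambda>(j, d). p ^ j * d) ` ({..k} \<times> {d. d dvd m}) = {d. d dvd p ^ k * m}"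
    proof (intro equalityI subsetI)
      fix x assume "x \<in> {d. d dvd p ^ k * m}"
      then obtain a b where ab: "x = a * b" "a dvd p ^ k" "b dvd m" by (metis division_decomp mem_Collect_eq)
      then obtain i where "i \<le> k" "a = p ^ i" using p divides_primepow_nat by blast
      then show "x \<in> (\<lambda>(j, d). p ^ j * d) ` ({..k} \<times> {d. d dvd m})" using ab by auto
    qed (auto intro!: mult_dvd_mono le_imp_power_dvd)
  qed
  then have "(\<Sum>d | d dvd p ^ k * m. f d) = (\<Sum>x\<in>{..k} \<times> {d. d dvd m}. f (case x of (j, d) \<Rightarrow> p ^ j * d))"
    by (rule sum.reindex_bij_betw[symmetric])
  also have "\<dots> = (\<Sum>j\<le>k. \<Sum>d | d dvd m. f p ^ j * f d)"
    using f1 by (simp add: sum.cartesian_product split_def)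
  also have "\<dots> = (\<Sum>j\<le>k. f p ^ j) * (\<Sum>d | d dvd m. f d)"
    by (simp add: sum_product)
  finally show ?thesis .
qed

text \<open>The full power p^k is split off. Its factor 1 + f p + ... + f p^k is k + 1, 1, or for f
  p = -1 the parity indicator of k; it is never negative, and at least 1 for even k. In a square all
  exponents are even.\<close>

lemma sum_divisors_real_char:
  fixes f :: "nat \<Rightarrow> real"
  assumes mult: "\<And>m n. f (m * n) = f m * f n" and f1: "f 1 = 1" and vals: "\<And>n. f n \<in> {-1, 0, 1}"
    and n: "n > 0"
  shows "(\<Sum>d | d dvd n. f d) \<ge> 0 \<and> (\<forall>m. n = m\<^sup>2 \<longrightarrow> (\<Sum>d | d dvd n. f d) \<ge> 1)"
  using n
proof (induction n rule: less_induct)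
  case (less n)
  show ?case
  proof (cases "n = 1")
    case True
    then show ?thesis using f1 by (auto simp: power2_eq_square)
  next
    case False
    then obtain p where p: "prime p" "p dvd n" using prime_factor_nat by blast
    define k where "k = multiplicity p n"
    obtain m where m: "n = p ^ k * m" "\<not> p dvd m"
      using multiplicity_decompose'[of n p] p less.prems unfolding k_def by (metis not_prime_unit not_gr0)
    have k: "k > 0" using p less.prems by (simp add: k_def prime_multiplicity_gt_zero_iff)
    have m0: "m > 0" using m by (auto intro: gr0I)
    have "1 < p ^ k" using p k one_less_power[of p k] prime_gt_1_nat[of p] by simp
    then have mn: "m < n" using m m0 by simp
    note IH = less.IH[OF mn m0]
    have eq: "(\<Sum>d | d dvd n. f d) = (\<Sum>j\<le>k. f p ^ j) * (\<Sum>d | d dvd m. f d)"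
      using sum_divisors_prime_power_mult[OF mult p(1) m(2) m0] m(1) by simp
    have g: "(\<Sum>j\<le>k. f p ^ j) \<ge> 0 \<and> (even k \<longrightarrow> (\<Sum>j\<le>k. f p ^ j) \<ge> 1)"
    proof -
      consider "f p = 1" | "f p = 0" | "f p = -1" using vals[of p] by auto
      then show ?thesis
      proof cases
        case 3
        have "(\<Sum>j\<le>k. (-1::real) ^ j) = (if even k then 1 else 0)" by (induction k) auto
        then show ?thesis using 3 by simp
      qed (auto simp: power_0_left)
    qed
    have "(\<Sum>d | d dvd n. f d) \<ge> 1" if sq: "n = r\<^sup>2" for r
    proof -
      have "r > 0" using sq less.prems by (auto intro: gr0I)
      have "k = 2 * multiplicity p r"
        unfolding k_def sq using p \<open>r > 0\<close> by (simp add: prime_elem_multiplicity_power_distrib)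
      then have ev: "even k" by simp
      obtain j where j: "k = 2 * j" using ev by (auto elim: evenE)
      have "(p ^ j)\<^sup>2 dvd r\<^sup>2" using sq m j by (metis dvd_triv_left mult.commute power_mult)
      then have "p ^ j dvd r" by (simp add: pow_divides_pow_iff)
      then obtain e where e: "r = p ^ j * e" by auto
      have "p ^ k * m = p ^ k * e\<^sup>2" using sq m j e by (simp add: power_mult_distrib power_mult[symmetric] mult.commute)
      then have "m = e\<^sup>2" using p by (simp add: prime_gt_0_nat)
      then have "(\<Sum>d | d dvd m. f d) \<ge> 1" using IH by blast
      then have "1 * 1 \<le> (\<Sum>j\<le>k. f p ^ j) * (\<Sum>d | d dvd m. f d)"
        using g ev by (intro mult_mono) auto
      then show ?thesis using eq by simp
    qed
    moreover have "(\<Sum>d | d dvd n. f d) \<ge> 0" using eq g IH by simp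
    ultimately show ?thesis by blast
  qed
qed

section \<open>Lambert series\<close>

text \<open>Terms i and n - 1 - i are paired and estimated by the inequality between arithmetic and
  geometric mean. With u the square root of t it bounds 1 + t + ... + t^(n - 1) from below.\<close>

lemma geometric_am_gm:
  fixes u :: real
  assumes "u \<ge> 0"
  shows "(\<Sum>i<n. u ^ (2 * i)) \<ge> real n * u ^ (n - 1)"
proof -
  have "(\<Sum>i<n. u ^ (2 * i)) = (\<Sum>i<n. u ^ (2 * (n - 1 - i)))"
    using sum.nat_diff_reindex[of "\<lambda>i. u ^ (2 * i)" n] by simp
  then have "2 * (\<Sum>i<n. u ^ (2 * i)) = (\<Sum>i<n. u ^ (2 * i) + u ^ (2 * (n - 1 - i)))"
    by (simp add: sum.distrib)
  also have "\<dots> \<ge> (\<Sum>i<n. 2 * u ^ (n - 1))"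
  proof (rule sum_mono)
    fix i assume "i \<in> {..<n}"
    then have "u ^ (n - 1) = u ^ i * u ^ (n - 1 - i)" by (simp flip: power_add)
    then show "2 * u ^ (n - 1) \<le> u ^ (2 * i) + u ^ (2 * (n - 1 - i))"
      using sum_squares_bound[of "u ^ i" "u ^ (n - 1 - i)"] by (simp add: power_mult[symmetric] mult_ac)
  qed
  finally show ?thesis by simp
qed

text \<open>With S n = 1 + t + ... + t^(n - 1), consecutive Lambert terms differ by t^n / (S n S (n
  + 1) (1 - t)), and consecutive terms 1 / (n (1 - t)) by 1 / (n (n + 1) (1 - t)). So the claim is n
  (n + 1) t^n <= S n S (n + 1), which the previous lemma gives with half a power of t to
  spare.\<close>

lemma lambert_decreasing:
  fixes t :: real
  assumes t: "0 < t" "t < 1" and n: "n \<ge> 1"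
  shows "1 / (real (Suc n) * (1 - t)) - t ^ Suc n / (1 - t ^ Suc n) \<le> 1 / (real n * (1 - t)) - t ^ n / (1 - t ^ n)"
proof -
  define S where "S = (\<lambda>n. \<Sum>i<n. t ^ i)"
  have S: "1 - t ^ n = (1 - t) * S n" for n unfolding S_def by (simp add: one_diff_power_eq)
  have Spos: "S n > 0" if "n \<ge> 1" for n using t that unfolding S_def by (intro sum_pos) (auto simp: lessThan_empty_iff)
  define u where "u = sqrt t"
  have u: "u > 0" "u\<^sup>2 = t" "u \<le> 1" using t by (auto simp: u_def)
  have Su: "S n \<ge> real n * u ^ (n - 1)" for n
    using geometric_am_gm[of u n] u by (simp add: S_def power_mult)
  have "real n * real (Suc n) * t ^ n \<le> (real n * u ^ (n - 1)) * (real (Suc n) * u ^ n)"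
  proof -
    have "t ^ n = u ^ (2 * n)" using u by (simp add: power_mult)
    also have "\<dots> \<le> u ^ (n - 1 + n)" using u by (intro power_decreasing) auto
    finally show ?thesis by (simp add: power_add mult_mono mult_ac mult_left_mono del: of_nat_Suc)
  qed
  also have "\<dots> \<le> S n * S (Suc n)"
    using Su[of n] Su[of "Suc n"] u Spos[OF n] by (intro mult_mono) auto
  finally have "t ^ n / (S n * S (Suc n)) \<le> 1 / (real n * real (Suc n))"
    using Spos[OF n] Spos[of "Suc n"] n by (subst pos_divide_le_eq) (auto simp: pos_le_divide_eq mult_ac simp del: of_nat_Suc)
  moreover have "t ^ n / (1 - t ^ n) - t ^ Suc n / (1 - t ^ Suc n) = t ^ n / (S n * S (Suc n)) / (1 - t)"
  proof -
    have "t ^ n * S (Suc n) - t ^ Suc n * S n = t ^ n * (S (Suc n) - t * S n)" by (simp add: algebra_simps)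
    also have "S (Suc n) - t * S n = 1" by (simp add: S_def sum.lessThan_Suc_shift sum_distrib_left del: sum.lessThan_Suc)
    finally have "t ^ n * S (Suc n) - t ^ Suc n * S n = t ^ n" by simp
    then have "t ^ n / (S n * S (Suc n)) = t ^ n / S n - t ^ Suc n / S (Suc n)"
      using Spos[OF n] Spos[of "Suc n"] by (simp add: diff_frac_eq mult_ac)
    then show ?thesis unfolding S by (simp add: diff_divide_distrib mult_ac)
  qed
  moreover have "1 / (real n * (1 - t)) - 1 / (real (Suc n) * (1 - t)) = 1 / (real n * real (Suc n)) / (1 - t)"
    using t n by (simp add: divide_simps)
  ultimately have "t ^ n / (1 - t ^ n) - t ^ Suc n / (1 - t ^ Suc n) \<le> 1 / (real n * (1 - t)) - 1 / (real (Suc n) * (1 - t))"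
    using t by (simp only:) (intro divide_right_mono, auto)
  then show ?thesis by linarith
qed


lemma has_sum_divisor_pairs:
  assumes "(F has_sum V) ({0<..} \<times> {0<..})"
  shows "((\<lambda>(n, d). F (d, n div d)) has_sum V) (Sigma {0<..} (\<lambda>n::nat. {d. d dvd n}))"
proof -
  have bij: "bij_betw (\<lambda>(n, d). (d, n div d)) (Sigma {0<..} (\<lambda>n::nat. {d. d dvd n})) ({0<..} \<times> {0<..})"
    by (rule bij_betwI[where g = "\<lambda>(d, k). (d * k, d)"]) (auto simp: dvd_imp_le intro!: Nat.gr0I elim!: dvdE)
  have "((\<lambda>x. F ((\<lambda>(n, d). (d, n div d)) x)) has_sum V) (Sigma {0<..} (\<lambda>n. {d. d dvd n}))"
    using has_sum_reindex_bij_betw[OF bij] assms by blast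
  then show ?thesis by (simp add: case_prod_unfold)
qed

lemma lambert_expansion:
  fixes f :: "nat \<Rightarrow> real" and t :: real
  assumes bd: "\<And>n. \<bar>f n\<bar> \<le> 1" and t: "0 < t" "t < 1"
  shows "(\<lambda>n. f (Suc n) * (t ^ Suc n / (1 - t ^ Suc n))) sums (\<Sum>n. (\<Sum>d | d dvd Suc n. f d) * t ^ Suc n)"
    and "summable (\<lambda>n. (\<Sum>d | d dvd Suc n. f d) * t ^ Suc n)"
proof -
  let ?P = "{0<..} :: nat set"
  have tn: "t ^ n < 1" if "n > 0" for n using t that by (simp add: power_less_one_iff)
  have geo: "((\<lambda>k. g * t ^ (n * k)) has_sum (g * (t ^ n / (1 - t ^ n)))) ?P" if "n > 0" for n and g :: real
  proof -
    have "(\<lambda>k. (t ^ n) ^ k) sums (1 / (1 - t ^ n))" using tn[OF that] t by (intro geometric_sums) auto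
    then have "((\<lambda>k. (t ^ n) ^ k) has_sum (1 / (1 - t ^ n))) UNIV"
      using t by (intro sums_nonneg_imp_has_sum) auto
    from has_sum_cmult_right[OF this, of "t ^ n"] have "((\<lambda>k. t ^ (n * Suc k)) has_sum (t ^ n / (1 - t ^ n))) UNIV"
      by (simp add: power_mult power_add)
    then have "((\<lambda>k. t ^ (n * k)) \<circ> Suc has_sum (t ^ n / (1 - t ^ n))) UNIV" by (simp add: o_def)
    then have "((\<lambda>k. t ^ (n * k)) has_sum (t ^ n / (1 - t ^ n))) (range Suc)" using has_sum_reindex[of Suc UNIV "\<lambda>k. t ^ (n * k)"] by simp
    moreover have "range Suc = ?P" using gr0_conv_Suc by auto
    ultimately show ?thesis by (metis has_sum_cmult_right)
  qed
  have summ_t: "(\<lambda>n. t ^ n / (1 - t)) summable_on ?P"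
  proof -
    have "summable (\<lambda>n. t ^ n / (1 - t))" using t by (intro summable_divide summable_geometric) auto
    then have "(\<lambda>n. t ^ n / (1 - t)) summable_on UNIV" using t by (intro summable_nonneg_imp_summable_on) auto
    then show ?thesis by (rule summable_on_subset_banach) auto
  qed
  have "(\<lambda>(n, k). 1 * t ^ (n * k)) summable_on (?P \<times> ?P)"
  proof (rule summable_on_SigmaI[where g = "\<lambda>n. 1 * (t ^ n / (1 - t ^ n))"])
    show "((\<lambda>y. case (n, y) of (n, k) \<Rightarrow> 1 * t ^ (n * k)) has_sum 1 * (t ^ n / (1 - t ^ n))) ?P" if "n \<in> ?P" for n
      using geo[of n 1] that by simp
    show "(\<lambda>n. 1 * (t ^ n / (1 - t ^ n))) summable_on ?P"
    proof (rule summable_on_comparison_test[OF summ_t])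
      fix n assume n: "n \<in> ?P"
      have "t ^ n \<le> t ^ 1" using n t by (intro power_decreasing) auto
      then show "1 * (t ^ n / (1 - t ^ n)) \<le> t ^ n / (1 - t)" using t by (simp add: divide_left_mono frac_le)
      show "0 \<le> 1 * (t ^ n / (1 - t ^ n))" using t tn[of n] n by simp
    qed
  qed (use t in auto)
  then have "(\<lambda>(n, k). norm (f n * t ^ (n * k))) summable_on (?P \<times> ?P)"
    by (rule summable_on_comparison_test) (use bd t in \<open>auto simp: abs_mult mult_left_le_one_le\<close>)
  then have S: "(\<lambda>(n, k). f n * t ^ (n * k)) summable_on (?P \<times> ?P)"
    using abs_summable_summable[of "\<lambda>(n, k). f n * t ^ (n * k)" "?P \<times> ?P"] by (simp add: case_prod_unfold)
  define V where "V = infsum (\<lambda>(n, k). f n * t ^ (n * k)) (?P \<times> ?P)"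
  have V: "((\<lambda>(n, k). f n * t ^ (n * k)) has_sum V) (?P \<times> ?P)" unfolding V_def using S by (rule has_sum_infsum)
  have A: "((\<lambda>n. f n * (t ^ n / (1 - t ^ n))) has_sum V) ?P"
    by (rule has_sum_SigmaD[OF V]) (use geo in auto)
  have B0: "((\<lambda>(n, d). f d * t ^ n) has_sum V) (Sigma ?P (\<lambda>n. {d. d dvd n}))"
    using has_sum_divisor_pairs[OF V] by (rule has_sum_cong[THEN iffD1, rotated]) auto
  have B: "((\<lambda>n. (\<Sum>d | d dvd n. f d) * t ^ n) has_sum V) ?P"
  proof (rule has_sum_SigmaD[OF B0])
    fix n assume "n \<in> ?P"
    then show "((\<lambda>y. case (n, y) of (n, d) \<Rightarrow> f d * t ^ n) has_sum (\<Sum>d | d dvd n. f d) * t ^ n) {d. d dvd n}"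
      by (intro has_sum_finiteI) (auto simp: sum_distrib_right)
  qed
  have conv: "(\<lambda>n. g (Suc n)) sums V" if "(g has_sum V) ?P" for g
  proof -
    have "range Suc = ?P" using gr0_conv_Suc by auto
    then have "(g \<circ> Suc has_sum V) UNIV" using that has_sum_reindex[of Suc UNIV g V] by simp
    then show ?thesis using has_sum_imp_sums by (auto simp: o_def)
  qed
  show "summable (\<lambda>n. (\<Sum>d | d dvd Suc n. f d) * t ^ Suc n)" using conv[OF B] by (rule sums_summable)
  show "(\<lambda>n. f (Suc n) * (t ^ Suc n / (1 - t ^ Suc n))) sums (\<Sum>n. (\<Sum>d | d dvd Suc n. f d) * t ^ Suc n)"
    using conv[OF A] conv[OF B] by (simp add: sums_iff)
qed


text \<open>Monsky's argument: if the sum were \<open>0\<close>, the Lambert series of \<open>f\<close> would stay bounded as \<open>t\<close> tends to \<open>1\<close>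
  (subtract \<open>1 / (1 - t)\<close> times the sum and sum by parts), but its coefficients are nonnegative and at least \<open>1\<close> at squares.\<close>
theorem real_character_nonvanishing:
  fixes f :: "nat \<Rightarrow> real"
  assumes mult: "\<And>m n. f (m * n) = f m * f n" and f1: "f 1 = 1" and vals: "\<And>n. f n \<in> {-1, 0, 1}"
    and psum: "\<And>N. \<bar>\<Sum>n<N. f n\<bar> \<le> C" and f0: "f 0 = 0"
  shows "\<not> (\<lambda>n. f n / real n) sums 0"
proof
  assume "(\<lambda>n. f n / real n) sums 0"
  then have L: "(\<lambda>n. f (Suc n) / real (Suc n)) sums 0"
    by (subst sums_Suc_iff) (simp add: f0)
  have bd: "\<bar>f n\<bar> \<le> 1" for n using vals[of n] by auto
  have C0: "C \<ge> 0" using psum[of 0] by simp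
  define A where "A = (\<lambda>N. \<Sum>n<N. f (Suc n))"
  have A: "\<bar>A N\<bar> \<le> C" for N
    using psum[of "Suc N"] sum.lessThan_Suc_shift[of f N] by (simp add: A_def f0 del: sum.lessThan_Suc)
  have upper: "(\<Sum>n. (\<Sum>d | d dvd Suc n. f d) * t ^ Suc n) \<le> C" if t: "0 < t" "t < 1" for t
  proof -
    define b where "b = (\<lambda>n. 1 / (real (Suc n) * (1 - t)) - t ^ Suc n / (1 - t ^ Suc n))"
    have dec: "b (Suc n) \<le> b n" for n
      unfolding b_def using lambert_decreasing[OF t, of "Suc n"] by simp
    \<comment> \<open>1 / (1 - t) - t / (1 - t) = 1: the first and largest weight does not depend on
      t, and this makes the bound \<open>C\<close> uniform as t tends to 1.\<close>
    have b0: "b 0 = 1" using t by (simp add: b_def field_simps)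
    have blim: "b \<longlonglongrightarrow> 0"
    proof -
      have "(\<lambda>n. t ^ Suc n) \<longlonglongrightarrow> 0" using t by (intro LIMSEQ_Suc LIMSEQ_power_zero) auto
      then have "(\<lambda>n. t ^ Suc n / (1 - t ^ Suc n)) \<longlonglongrightarrow> 0 / (1 - 0)" by (intro tendsto_intros) auto
      moreover have "(\<lambda>n. 1 / (real (Suc n) * (1 - t))) \<longlonglongrightarrow> 0" using t by real_asymp
      ultimately show ?thesis unfolding b_def by (auto intro: tendsto_eq_intros)
    qed
    have b_nonneg: "b n \<ge> 0" for n
      using decseq_ge[OF _ blim, of n] dec by (simp add: decseq_Suc_iff)
    have "(\<lambda>n. f (Suc n) / real (Suc n) / (1 - t) - f (Suc n) * (t ^ Suc n / (1 - t ^ Suc n))) sums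
       (0 / (1 - t) - (\<Sum>n. (\<Sum>d | d dvd Suc n. f d) * t ^ Suc n))"
      by (intro sums_diff sums_divide L lambert_expansion bd t)
    then have S: "(\<lambda>n. f (Suc n) * b n) sums (- (\<Sum>n. (\<Sum>d | d dvd Suc n. f d) * t ^ Suc n))"
      by (simp add: b_def algebra_simps)
    have parts: "(\<Sum>n<N. f (Suc n) * b n) = A N * b N + (\<Sum>n<N. A (Suc n) * (b n - b (Suc n)))" for N
      by (induction N) (auto simp: A_def algebra_simps)
    have "- C \<le> (\<Sum>n<N. f (Suc n) * b n)" for N
    proof -
      have "\<bar>\<Sum>n<N. f (Suc n) * b n\<bar> \<le> \<bar>A N * b N\<bar> + (\<Sum>n<N. \<bar>A (Suc n) * (b n - b (Suc n))\<bar>)"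
        unfolding parts by (intro order_trans[OF abs_triangle_ineq] add_left_mono sum_abs)
      also have "\<dots> \<le> C * b N + (\<Sum>n<N. C * (b n - b (Suc n)))"
        unfolding abs_mult using A b_nonneg dec C0 by (intro add_mono mult_mono sum_mono) auto
      also have "\<dots> = C * b 0"
        unfolding sum_distrib_left[symmetric] sum_lessThan_telescope' by (simp add: algebra_simps)
      finally show ?thesis using b0 by simp
    qed
    then have "- C \<le> - (\<Sum>n. (\<Sum>d | d dvd Suc n. f d) * t ^ Suc n)"
      using S unfolding sums_def by (intro LIMSEQ_le_const) auto
    then show ?thesis by simp
  qed
  have lower: "real K * t ^ (K\<^sup>2) \<le> (\<Sum>n. (\<Sum>d | d dvd Suc n. f d) * t ^ Suc n)" if t: "0 < t" "t < 1" for t K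
  proof -
    define c where "c = (\<lambda>n. (\<Sum>d | d dvd Suc n. f d) * t ^ Suc n)"
    have c0: "c n \<ge> 0" for n using sum_divisors_real_char[OF mult f1 vals, of "Suc n"] t by (simp add: c_def)
    \<comment> \<open>The coefficient of t^(n + 1) has index n, so the square k^2 sits at index k^2
      - 1.\<close>
    let ?I = "(\<lambda>k. k\<^sup>2 - 1) ` {1..K}"
    have inj: "inj_on (\<lambda>k. k\<^sup>2 - 1 :: nat) {1..K}"
    proof (rule inj_onI)
      fix x y :: nat assume *: "x \<in> {1..K}" "y \<in> {1..K}" "x\<^sup>2 - 1 = y\<^sup>2 - 1"
      then have "x\<^sup>2 > 0" "y\<^sup>2 > 0" by auto
      then have "x\<^sup>2 = y\<^sup>2" using * by linarith
      then show "x = y" by simp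
    qed
    have "real K * t ^ (K\<^sup>2) = (\<Sum>k\<in>{1..K}. t ^ (K\<^sup>2))" by simp
    also have "\<dots> \<le> (\<Sum>k\<in>{1..K}. c (k\<^sup>2 - 1))"
    proof (rule sum_mono)
      fix k assume k: "k \<in> {1..K}"
      then have sk: "Suc (k\<^sup>2 - 1) = k\<^sup>2" by simp
      have "(\<Sum>d | d dvd k\<^sup>2. f d) \<ge> 1" using sum_divisors_real_char[OF mult f1 vals, of "k\<^sup>2"] k by auto
      moreover have "t ^ (K\<^sup>2) \<le> t ^ (k\<^sup>2)" using k t by (intro power_decreasing power_mono) auto
      ultimately have "1 * t ^ (K\<^sup>2) \<le> (\<Sum>d | d dvd k\<^sup>2. f d) * t ^ (k\<^sup>2)" using t by (intro mult_mono) auto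
      then show "t ^ (K\<^sup>2) \<le> c (k\<^sup>2 - 1)" unfolding c_def sk by simp
    qed
    also have "\<dots> = sum c ?I" by (simp only: sum.reindex[OF inj] o_def)
    also have "\<dots> \<le> suminf c"
      using lambert_expansion(2)[OF bd t] c0 by (intro sum_le_suminf) (auto simp: c_def)
    finally show ?thesis by (simp add: c_def)
  qed
  obtain K :: nat where K: "real K > C + 1" using reals_Archimedean2 by blast
  have "real K * t ^ (K\<^sup>2) \<le> C" if "0 < t" "t < 1" for t using lower[OF that] upper[OF that] order_trans by blast
  \<comment> \<open>K is fixed and t tends to 1 through 1 - 1 / (n + 2), where the 2 keeps t
    positive. In the limit K <= C, against the choice of K.\<close>
  then have "\<forall>\<^sub>F n::nat in sequentially. real K * (1 - 1 / real (n + 2)) ^ (K\<^sup>2) \<le> C"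
  proof (intro always_eventually allI)
    fix n :: nat
    show "real K * (1 - 1 / real (n + 2)) ^ (K\<^sup>2) \<le> C"
      if "\<And>t. 0 < t \<Longrightarrow> t < 1 \<Longrightarrow> real K * t ^ (K\<^sup>2) \<le> C"
      by (rule that) auto
  qed
  moreover have "(\<lambda>n::nat. real K * (1 - 1 / real (n + 2)) ^ (K\<^sup>2)) \<longlonglongrightarrow> real K * (1 - 0) ^ (K\<^sup>2)"
  proof (intro tendsto_intros)
    show "(\<lambda>n::nat. 1 / real (n + 2)) \<longlonglongrightarrow> 0" by real_asymp
  qed
  ultimately have "real K * (1 - 0) ^ (K\<^sup>2) \<le> C" by (intro tendsto_upperbound) auto
  then show False using K by simp
qed

section \<open>Mean values of arithmetic functions\<close>

definition moebius_mu :: "nat \<Rightarrow> int" where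
  "moebius_mu n = (if squarefree n then (-1) ^ card (prime_factors n) else 0)"

lemma moebius_abs_le: "\<bar>moebius_mu n\<bar> \<le> 1"
  by (simp add: moebius_mu_def)

lemma moebius_1: "moebius_mu 1 = 1"
  by (simp add: moebius_mu_def)

lemma moebius_prime_mult:
  assumes "prime p" "d > 0"
  shows "moebius_mu (p * d) = (if p dvd d then 0 else - moebius_mu d)"
proof (cases "p dvd d")
  case True
  then have "p\<^sup>2 dvd p * d" by (simp add: power2_eq_square)
  then have "\<not> squarefree (p * d)" using assms by (auto simp: squarefree_def)
  then show ?thesis using True by (simp add: moebius_mu_def)
next
  case False
  then have cop: "coprime p d" using assms by (simp add: prime_imp_coprime)
  have sf: "squarefree (p * d) \<longleftrightarrow> squarefree d"
    using squarefree_mult_coprime[OF cop] squarefree_prime[of p] assms squarefree_mono[of d "p * d"] by auto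
  have "prime_factors (p * d) = insert p (prime_factors d)"
    using assms by (simp add: prime_factors_product prime_prime_factors)
  moreover have "p \<notin> prime_factors d" using False by auto
  ultimately show ?thesis using False sf by (simp add: moebius_mu_def)
qed

text \<open>For a prime p dividing n, a divisor d prime to p and the divisor p d cancel, and all
  remaining divisors are multiples of p^2, where \<mu> vanishes.\<close>

lemma sum_moebius_divisors:
  assumes "n > 0"
  shows "(\<Sum>d | d dvd n. moebius_mu d) = (if n = 1 then 1 else 0)"
proof (cases "n = 1")
  case True
  then show ?thesis using moebius_1 by simp
next
  case False
  then obtain p where p: "prime p" "p dvd n" using prime_factor_nat by blast
  define A where "A = {d. d dvd n \<and> \<not> p dvd d}"
  have fin: "finite {d. d dvd n}" using assms by simp
  then have finA: "finite A" by (rule finite_subset[rotated]) (auto simp: A_def)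
  have inj: "inj_on ((*) p) A" using p by (auto simp: inj_on_def)
  have pA: "p * d dvd n" if "d \<in> A" for d
    using that p by (auto simp: A_def prime_imp_coprime intro: divides_mult)
  have "(\<Sum>d | d dvd n. moebius_mu d) = (\<Sum>d\<in>A \<union> (*) p ` A. moebius_mu d)"
  proof (rule sum.mono_neutral_right[OF fin])
    show "A \<union> (*) p ` A \<subseteq> {d. d dvd n}" using pA by (auto simp: A_def)
    show "\<forall>d\<in>{d. d dvd n} - (A \<union> (*) p ` A). moebius_mu d = 0"
    proof
      fix d assume d: "d \<in> {d. d dvd n} - (A \<union> (*) p ` A)"
      then have "p dvd d" "d dvd n" by (auto simp: A_def)
      then obtain e where e: "d = p * e" by auto
      have "e dvd n" using e \<open>d dvd n\<close> dvd_mult_right by blast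
      moreover have "e \<notin> A" using d e by auto
      ultimately have "p dvd e" by (simp add: A_def)
      moreover have "e > 0" using \<open>e dvd n\<close> assms by (auto intro: gr0I)
      ultimately show "moebius_mu d = 0" using moebius_prime_mult[OF p(1)] e by simp
    qed
  qed
  also have "\<dots> = (\<Sum>d\<in>A. moebius_mu d) + (\<Sum>d\<in>(*) p ` A. moebius_mu d)"
    using finA by (intro sum.union_disjoint) (auto simp: A_def)
  also have "(\<Sum>d\<in>(*) p ` A. moebius_mu d) = (\<Sum>d\<in>A. - moebius_mu d)"
  proof (subst sum.reindex[OF inj], rule sum.cong[OF refl])
    fix d assume d: "d \<in> A"
    then have "d > 0" using assms by (auto simp: A_def intro: gr0I)
    then show "(moebius_mu \<circ> (*) p) d = - moebius_mu d" using moebius_prime_mult[OF p(1)] d by (auto simp: A_def)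
  qed
  finally show ?thesis using False by (simp add: sum_negf)
qed

text \<open>The product of the two absolutely convergent series is rearranged by the value n = d k;
  as \<open>ch\<close> is completely multiplicative, the inner sum is \<open>ch n\<close> times the
  divisor sum of \<mu>, so only n = 1 remains. The product being 1 also yields the non-vanishing for
  Re s > 1.\<close>

lemma moebius_series:
  fixes ch :: "nat \<Rightarrow> complex"
  assumes mult: "\<And>m n. ch (m * n) = ch m * ch n" and one: "ch 1 = 1" and bd: "\<And>n. norm (ch n) \<le> 1"
    and s: "Re s > 1" and D: "(\<lambda>n. ch n * of_nat n powr (-s)) sums D"
  shows "D \<noteq> 0" "(\<lambda>n. of_int (moebius_mu n) * ch n * of_nat n powr (-s)) sums (1 / D)"
proof -
  let ?P = "{0<..} :: nat set"
  define f where "f = (\<lambda>n. ch n * of_nat n powr (-s))"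
  define g where "g = (\<lambda>n. of_int (moebius_mu n) * ch n * of_nat n powr (-s))"
  have fm: "f (m * n) = f m * f n" for m n unfolding f_def powr_nat_mult mult by simp
  have gf: "g n = of_int (moebius_mu n) * f n" for n by (simp add: g_def f_def)
  have f1: "f 1 = 1" using one by (simp add: f_def)
  have z: "f 0 = 0" "g 0 = 0" by (simp_all add: f_def g_def)
  have mb: "norm (of_int (moebius_mu n) :: complex) \<le> 1" for n using moebius_abs_le[of n] by (simp add: norm_of_int)
  have sf: "summable (\<lambda>n. norm (f n))" unfolding f_def by (rule sums_nat_powr_summable[OF s bd])
  have sg: "summable (\<lambda>n. norm (g n))" unfolding g_def
    using mb bd by (intro sums_nat_powr_summable[OF s, of _ 1]) (auto simp: norm_mult intro!: mult_le_one)
  have restrict: "(h has_sum S) ?P" if "(h has_sum S) UNIV" "h 0 = 0" for h :: "nat \<Rightarrow> complex" and S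
    using that(1) by (rule has_sum_cong_neutral[THEN iffD1, rotated -1]) (use that(2) in auto)
  have Df: "(\<Sum>n. f n) = D" using D by (simp add: f_def sums_iff)
  have F: "(f has_sum D) ?P" using restrict[OF has_sum_suminf_nat[OF sf] z(1)] Df by simp
  have G: "(g has_sum (\<Sum>n. g n)) ?P" by (rule restrict[OF has_sum_suminf_nat[OF sg] z(2)])
  have absf: "(\<lambda>n. norm (f n)) summable_on ?P" and absg: "(\<lambda>n. norm (g n)) summable_on ?P"
    using sf sg by (auto intro!: summable_on_subset_banach[OF summable_nonneg_imp_summable_on])
  have "(\<lambda>(d, k). norm (g d) * norm (f k)) summable_on (?P \<times> ?P)"
    by (rule summable_on_SigmaI[where g = "\<lambda>d. norm (g d) * infsum (\<lambda>k. norm (f k)) ?P"])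
      (auto intro!: has_sum_cmult_right has_sum_infsum absf summable_on_cmult_left absg)
  then have S: "(\<lambda>(d, k). g d * f k) summable_on (?P \<times> ?P)"
    using abs_summable_summable[of "\<lambda>(d, k). g d * f k" "?P \<times> ?P"] by (simp add: case_prod_unfold norm_mult)
  define V where "V = infsum (\<lambda>(d, k). g d * f k) (?P \<times> ?P)"
  have V: "((\<lambda>(d, k). g d * f k) has_sum V) (?P \<times> ?P)" unfolding V_def using S by (rule has_sum_infsum)
  have "((\<lambda>d. g d * D) has_sum V) ?P"
    by (rule has_sum_SigmaD[OF V]) (auto intro: has_sum_cmult_right F)
  then have V1: "V = (\<Sum>n. g n) * D" using has_sum_cmult_left[OF G, of D] has_sum_unique by blast
  have B0: "((\<lambda>(n, d). of_int (moebius_mu d) * f n) has_sum V) (Sigma ?P (\<lambda>n. {d. d dvd n}))"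
    using has_sum_divisor_pairs[OF V] by (rule has_sum_cong[THEN iffD1, rotated]) (auto simp: gf fm[symmetric])
  have "((\<lambda>n. if n = 1 then 1 else 0) has_sum V) ?P"
  proof (rule has_sum_SigmaD[OF B0])
    fix n assume n: "n \<in> ?P"
    have "(\<Sum>d | d dvd n. of_int (moebius_mu d) * f n) = of_int (\<Sum>d | d dvd n. moebius_mu d) * f n"
      by (simp add: sum_distrib_right)
    also have "\<dots> = (if n = 1 then 1 else 0)" using sum_moebius_divisors[of n] n f1 by auto
    finally show "((\<lambda>y. case (n, y) of (n, d) \<Rightarrow> of_int (moebius_mu d) * f n) has_sum (if n = 1 then 1 else 0)) {d. d dvd n}"
      using n by (intro has_sum_finiteI) auto
  qed
  moreover have "((\<lambda>n. if n = (1::nat) then 1 else 0 :: complex) has_sum 1) ?P"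
  proof -
    have "((\<lambda>n. if n = (1::nat) then 1 else 0 :: complex) has_sum 1) {1}" by (rule has_sum_finiteI) auto
    then show ?thesis by (rule has_sum_cong_neutral[THEN iffD1, rotated -1]) auto
  qed
  ultimately have V2: "V = 1" using has_sum_unique by blast
  then show "D \<noteq> 0" using V1 by auto
  then have "(\<Sum>n. g n) = 1 / D" using V1 V2 by (simp add: field_simps)
  then show "(\<lambda>n. of_int (moebius_mu n) * ch n * of_nat n powr (-s)) sums (1 / D)"
    using summable_sums[OF summable_norm_cancel[OF sg]] by (simp add: g_def)
qed

text \<open>With A the partial sums of a n / n, summation by parts turns the sum of a n up to N into
  N A N minus the sum of the earlier A n. Divided by N, both parts tend to \<open>S\<close>, the
  second as a Cesaro mean.\<close>

lemma kronecker_mean: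
  fixes a :: "nat \<Rightarrow> complex"
  assumes "(\<lambda>n. a n / of_nat n) sums S"
  shows "(\<lambda>N. (\<Sum>n=1..N. a n) / of_nat N) \<longlonglongrightarrow> 0"
proof -
  define A where "A = (\<lambda>N. \<Sum>n=1..N. a n / of_nat n)"
  have "(\<lambda>N. \<Sum>n\<le>N. a n / of_nat n) \<longlonglongrightarrow> S" using assms by (simp add: sums_def_le)
  moreover have "(\<Sum>n\<le>N. a n / of_nat n) = A N" for N
    unfolding A_def by (rule sum.mono_neutral_right) auto
  ultimately have A: "A \<longlonglongrightarrow> S" by simp
  have mean: "(\<lambda>N. (\<Sum>n<N. A n) / of_nat N) \<longlonglongrightarrow> S"
  proof (rule LIMSEQ_I)
    fix e :: real assume e: "e > 0"
    obtain M where M: "\<And>n. n \<ge> M \<Longrightarrow> norm (A n - S) < e / 2"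
      using LIMSEQ_D[OF A, of "e/2"] e by auto
    define K where "K = (\<Sum>n<M. norm (A n - S))"
    obtain N0 :: nat where N0: "real N0 > 2 * K / e" using reals_Archimedean2 by blast
    show "\<exists>no. \<forall>N\<ge>no. norm ((\<Sum>n<N. A n) / of_nat N - S) < e"
    proof (intro exI allI impI)
      fix N assume N: "N \<ge> max (Suc M) (Suc N0)"
      have "(\<Sum>n<N. A n) / of_nat N - S = (\<Sum>n<N. A n - S) / of_nat N"
        using N by (simp add: sum_subtractf field_simps)
      also have "norm \<dots> = norm (\<Sum>n<N. A n - S) / real N" by (simp add: norm_divide)
      also have "\<dots> \<le> (\<Sum>n<N. norm (A n - S)) / real N" by (intro divide_right_mono norm_sum) auto
      also have "(\<Sum>n<N. norm (A n - S)) = K + (\<Sum>n\<in>{M..<N}. norm (A n - S))"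
        unfolding K_def using N by (subst sum.atLeastLessThan_concat[of 0 M N, symmetric, unfolded atLeast0LessThan]) auto
      also have "\<dots> \<le> K + (\<Sum>n\<in>{M..<N}. e / 2)"
        using M by (intro add_left_mono sum_mono less_imp_le) auto
      also have "\<dots> \<le> K + real N * (e / 2)" using e by (simp add: mult_right_mono)
      finally have "norm ((\<Sum>n<N. A n) / of_nat N - S) \<le> (K + real N * (e / 2)) / real N"
        by (simp add: divide_right_mono)
      also have "\<dots> = K / real N + e / 2" using N by (simp add: field_simps)
      also have "K / real N < e / 2"
      proof -
        have "2 * K / e < real N" using N0 N by linarith
        then show ?thesis using N e by (simp add: field_simps)
      qed
      finally show "norm ((\<Sum>n<N. A n) / of_nat N - S) < e" by simp
    qed
  qed
  have parts: "(\<Sum>n=1..N. a n) = of_nat N * A N - (\<Sum>n<N. A n)" for N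
  proof (induction N)
    case (Suc N)
    have "of_nat (Suc N) * A (Suc N) = of_nat (Suc N) * A N + a (Suc N)"
      by (simp add: A_def distrib_left del: of_nat_Suc)
    then show ?case using Suc by (simp add: algebra_simps)
  qed simp
  have "(\<lambda>N. A N - (\<Sum>n<N. A n) / of_nat N) \<longlonglongrightarrow> S - S" by (intro tendsto_diff A mean)
  moreover have "\<forall>\<^sub>F N in sequentially. A N - (\<Sum>n<N. A n) / of_nat N = (\<Sum>n=1..N. a n) / of_nat N"
    using eventually_ge_at_top[of 1] by eventually_elim (simp add: parts[unfolded One_nat_def] diff_divide_distrib)
  ultimately show ?thesis by (simp add: Lim_transform_eventually)
qed

section \<open>Convolution with a function of mean value zero\<close>

lemma sum_inverse_sqrt_le: "(\<Sum>n=1..N. 1 / sqrt (real n)) \<le> 2 * sqrt (real N)"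
proof (induction N)
  case (Suc N)
  have "1 / sqrt (real (Suc N)) \<le> 2 * (sqrt (real (Suc N)) - sqrt (real N))"
  proof -
    have "(sqrt (real (Suc N)) - sqrt (real N)) * (sqrt (real (Suc N)) + sqrt (real N)) = 1"
      by (simp add: algebra_simps)
    moreover have "0 < sqrt (real (Suc N)) + sqrt (real N)" by (simp add: add_pos_nonneg)
    ultimately have "sqrt (real (Suc N)) - sqrt (real N) = 1 / (sqrt (real (Suc N)) + sqrt (real N))"
      by (simp add: field_simps)
    moreover have "1 / (2 * sqrt (real (Suc N))) \<le> 1 / (sqrt (real (Suc N)) + sqrt (real N))"
      by (intro divide_left_mono mult_pos_pos) (auto simp: add_pos_nonneg)
    ultimately show ?thesis by simp
  qed
  then show ?case using Suc by simp
qed auto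

lemma sum_divisors_swap:
  fixes u v :: "nat \<Rightarrow> 'a :: comm_semiring_1"
  shows "(\<Sum>n=1..x. \<Sum>d | d dvd n. u d * v (n div d)) = (\<Sum>a=1..x. u a * (\<Sum>b=1..x div a. v b))"
proof -
  have "(\<Sum>n=1..x. \<Sum>d | d dvd n. u d * v (n div d)) = (\<Sum>(n, d)\<in>Sigma {1..x} (\<lambda>n. {d. d dvd n}). u d * v (n div d))"
    by (rule sum.Sigma) auto
  also have "\<dots> = (\<Sum>(a, b)\<in>Sigma {1..x} (\<lambda>a. {1..x div a}). u a * v b)"
    by (rule sum.reindex_bij_witness[where i = "\<lambda>(a, b). (a * b, a)" and j = "\<lambda>(n, d). (d, n div d)"])
      (auto simp: dvd_imp_le less_eq_div_iff_mult_less_eq mult.commute div_le_mono Suc_le_eq dvd_div_eq_0_iff intro!: Nat.gr0I elim!: dvdE dest: dvd_imp_le,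
       metis One_nat_def Suc_leI mult.right_neutral mult_le_mono2 order_trans)
  also have "\<dots> = (\<Sum>a=1..x. u a * (\<Sum>b=1..x div a. v b))"
    by (simp add: sum.Sigma[symmetric] sum_distrib_left)
  finally show ?thesis .
qed

text \<open>The hyperbola method with a cutoff at \<open>b \<le> K\<close>: for small \<open>b\<close> one uses that \<open>u\<close> has mean zero,
  for large \<open>b\<close> (that is, \<open>a \<le> x / K\<close>) the bound on the partial sums of \<open>v\<close>.\<close>
lemma axer:
  fixes u v :: "nat \<Rightarrow> complex"
  assumes u: "\<And>n. norm (u n) \<le> 1" and U: "(\<lambda>N. (\<Sum>n=1..N. u n) / of_nat N) \<longlonglongrightarrow> 0"
    and v: "\<And>y. norm (\<Sum>n=1..y. v n) \<le> C * sqrt (real y)"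
  shows "(\<lambda>x. (\<Sum>n=1..x. \<Sum>d | d dvd n. u d * v (n div d)) / of_nat x) \<longlonglongrightarrow> 0"
proof (rule LIMSEQ_I)
  fix e :: real assume e: "e > 0"
  have C0: "C \<ge> 0" 
  proof -
    have "norm (v 1) \<le> C" using v[of 1] by simp
    then show ?thesis using norm_ge_zero[of "v 1"] by linarith
  qed
  \<comment> \<open>\<open>K\<close> makes the part with a <= T at most 2 C x / sqrt K <= x e / 2.
    Only then is \<open>d\<close> chosen, since the rest is at most 2 d x V with \<open>V\<close>
    depending on \<open>K\<close>.\<close>
  obtain K :: nat where K: "real K > (4 * (C + 1) / e)\<^sup>2" using reals_Archimedean2 by blast
  have K0: "K > 0" using K by (metis gr0I of_nat_0 not_less zero_le_power2)
  have sK: "sqrt (real K) > 4 * (C + 1) / e" using K by (simp add: real_less_rsqrt)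
  define M where "M = (\<lambda>N. \<Sum>n=1..N. u n)"
  define V where "V = (\<Sum>b=1..K. norm (v b))"
  have V0: "V \<ge> 0" by (simp add: V_def sum_nonneg)
  define d where "d = e / (8 * (V + 1))"
  have d: "d > 0" using e V0 by (simp add: d_def)
  obtain N0 where N0: "\<And>N. N \<ge> N0 \<Longrightarrow> norm (M N / of_nat N) < d"
    using LIMSEQ_D[OF U d] by (auto simp: M_def)
  have Mle: "norm (M N) \<le> d * real N" if "N \<ge> N0" for N
  proof (cases "N = 0")
    case False
    then show ?thesis using N0[OF that] by (simp add: norm_divide field_simps)
  qed (simp add: M_def)
  show "\<exists>no. \<forall>x\<ge>no. norm ((\<Sum>n=1..x. \<Sum>d | d dvd n. u d * v (n div d)) / of_nat x - 0) < e"
  proof (intro exI allI impI)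
    fix x assume x: "x \<ge> Suc (K * Suc N0)"
    define T where "T = x div K"
    have x0: "x > 0" using x by simp
    have TN: "T \<ge> N0"
    proof -
      have "Suc N0 * K div K \<le> x div K" using x by (intro div_le_mono) (auto simp: mult.commute)
      then show ?thesis using K0 by (simp add: T_def)
    qed
    have Tx: "T \<le> x" by (simp add: T_def)
    define B where "B = (\<lambda>y. \<Sum>b=1..y. v b)"
    have "(\<Sum>n=1..x. \<Sum>d | d dvd n. u d * v (n div d)) = (\<Sum>a=1..x. u a * B (x div a))"
      unfolding B_def by (rule sum_divisors_swap)
    also have "\<dots> = (\<Sum>a=1..T. u a * B (x div a)) + (\<Sum>a=Suc T..x. u a * B (x div a))"
      using sum.ub_add_nat[of 1 T "\<lambda>a. u a * B (x div a)" "x - T"] Tx by simp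
    \<comment> \<open>For a > T = x div K the quotient x div a is at most K, so b stays in a fixed
      finite range after the exchange of summations, and for each b the sum over a is a difference
      of two values of \<open>M\<close>.\<close>
    also have "(\<Sum>a=Suc T..x. u a * B (x div a)) = (\<Sum>b=1..K. v b * (M (x div b) - M T))" (is "?L = ?R")
    proof -
      have "?L = (\<Sum>a=Suc T..x. \<Sum>b=1..K. if b \<le> x div a then u a * v b else 0)"
      proof (rule sum.cong[OF refl])
        fix a assume a: "a \<in> {Suc T..x}"
        have "x div a \<le> K"
        proof -
          have "x < K * Suc T" unfolding T_def using dividend_less_times_div[OF K0, of x] by simp
          also have "\<dots> \<le> K * a" using a by (intro mult_left_mono) auto
          finally have "x < K * a" .
          then have "x div a < K" using a by (simp add: div_less_iff_less_mult mult.commute)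
          then show ?thesis by simp
        qed
        then have "{b \<in> {1..K}. b \<le> x div a} = {1..x div a}" by auto
        then show "u a * B (x div a) = (\<Sum>b=1..K. if b \<le> x div a then u a * v b else 0)"
          by (simp add: sum.inter_filter[symmetric] B_def sum_distrib_left)
      qed
      also have "\<dots> = (\<Sum>b=1..K. \<Sum>a=Suc T..x. if b \<le> x div a then u a * v b else 0)" by (rule sum.swap)
      also have "\<dots> = ?R"
      proof (rule sum.cong[OF refl])
        fix b assume b: "b \<in> {1..K}"
        have iff: "b \<le> x div a \<longleftrightarrow> a \<le> x div b" if "a \<ge> 1" for a
          using that b by (simp add: less_eq_div_iff_mult_less_eq mult.commute)
        have "T \<le> x div b" unfolding T_def using b by (intro div_le_mono2) auto
        moreover have "{a \<in> {Suc T..x}. b \<le> x div a} = {Suc T..x div b}"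
          using iff by (auto intro: order_trans[OF _ div_le_dividend])
        moreover have "M (x div b) - M T = (\<Sum>a=Suc T..x div b. u a)"
          using sum.ub_add_nat[of 1 T u "x div b - T"] \<open>T \<le> x div b\<close> by (simp add: M_def)
        ultimately show "(\<Sum>a=Suc T..x. if b \<le> x div a then u a * v b else 0) = v b * (M (x div b) - M T)"
          by (simp add: sum.inter_filter[symmetric] sum_distrib_left mult.commute)
      qed
      finally show ?thesis .
    qed
    finally have eq: "(\<Sum>n=1..x. \<Sum>d | d dvd n. u d * v (n div d)) =
       (\<Sum>a=1..T. u a * B (x div a)) + (\<Sum>b=1..K. v b * (M (x div b) - M T))" .
    have "norm (\<Sum>a=1..T. u a * B (x div a)) \<le> (\<Sum>a=1..T. 1 * (C * sqrt (real x) * (1 / sqrt (real a))))"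
    proof (rule sum_norm_le)
      fix a assume a: "a \<in> {1..T}"
      have "norm (B (x div a)) \<le> C * sqrt (real (x div a))" unfolding B_def by (rule v)
      also have "\<dots> \<le> C * sqrt (real x / real a)"
        using C0 by (intro mult_left_mono) (auto simp: of_nat_div_le_of_nat)
      also have "\<dots> = C * sqrt (real x) * (1 / sqrt (real a))" by (simp add: real_sqrt_divide)
      finally show "norm (u a * B (x div a)) \<le> 1 * (C * sqrt (real x) * (1 / sqrt (real a)))"
        unfolding norm_mult using u by (intro mult_mono) auto
    qed
    also have "\<dots> = C * sqrt (real x) * (\<Sum>a=1..T. 1 / sqrt (real a))" by (simp add: sum_distrib_left)
    also have "\<dots> \<le> C * sqrt (real x) * (2 * sqrt (real T))"
      using C0 by (intro mult_left_mono sum_inverse_sqrt_le) auto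
    also have "\<dots> \<le> C * sqrt (real x) * (2 * sqrt (real x / real K))"
      unfolding T_def using C0 by (intro mult_left_mono) (auto simp: of_nat_div_le_of_nat)
    also have "\<dots> = 2 * C * real x / sqrt (real K)" by (simp add: real_sqrt_divide)
    also have "\<dots> \<le> real x * (e / 2)"
    proof -
      have "4 * C \<le> e * sqrt (real K)" using sK e by (simp add: field_simps)
      then have "real x * (4 * C) \<le> real x * (e * sqrt (real K))" by (intro mult_left_mono) auto
      then show ?thesis using K0 by (simp add: field_simps)
    qed
    finally have 1: "norm (\<Sum>a=1..T. u a * B (x div a)) \<le> real x * (e / 2)" .
    have "norm (\<Sum>b=1..K. v b * (M (x div b) - M T)) \<le> (\<Sum>b=1..K. norm (v b) * (2 * d * real x))"
    proof (rule sum_norm_le)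
      fix b assume b: "b \<in> {1..K}"
      have "T \<le> x div b" unfolding T_def using b by (intro div_le_mono2) auto
      then have "norm (M (x div b)) \<le> d * real (x div b)" using TN by (intro Mle) auto
      also have "\<dots> \<le> d * real x" using d by (intro mult_left_mono) auto
      finally have A: "norm (M (x div b)) \<le> d * real x" .
      have "norm (M T) \<le> d * real T" using TN by (rule Mle)
      also have "\<dots> \<le> d * real x" using d Tx by (intro mult_left_mono) auto
      finally have "norm (M (x div b) - M T) \<le> 2 * d * real x"
        using A norm_triangle_ineq4[of "M (x div b)" "M T"] by simp
      then show "norm (v b * (M (x div b) - M T)) \<le> norm (v b) * (2 * d * real x)"
        by (simp add: norm_mult mult_left_mono)
    qed
    also have "\<dots> = V * (2 * d * real x)" by (simp add: V_def sum_distrib_right)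
    also have "\<dots> = (V / (V + 1)) * (e / 4) * real x" using V0 by (simp add: d_def field_simps)
    also have "\<dots> < 1 * (e / 2) * real x"
    proof -
      have "V / (V + 1) \<le> 1" using V0 by simp
      then have "(V / (V + 1)) * (e / 4) \<le> 1 * (e / 4)" using e by (intro mult_right_mono) auto
      also have "\<dots> < 1 * (e / 2)" using e by simp
      finally show ?thesis using x0 by (intro mult_strict_right_mono) auto
    qed
    finally have "norm (\<Sum>n=1..x. \<Sum>d | d dvd n. u d * v (n div d)) < real x * e"
      unfolding eq using 1 norm_triangle_ineq[of "\<Sum>a=1..T. u a * B (x div a)" "\<Sum>b=1..K. v b * (M (x div b) - M T)"]
      by (simp add: algebra_simps)
    then show "norm ((\<Sum>n=1..x. \<Sum>d | d dvd n. u d * v (n div d)) / of_nat x - 0) < e"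
      using x0 by (simp add: norm_divide field_simps)
  qed
qed

text \<open>The error starts at 1 for y = 1 and grows by at most 1 / (y + 1) per step. This is
  enlarged to 1 / sqrt (y + 1) since an error of order sqrt y is what \<open>axer\<close>
  tolerates.\<close>

lemma sum_ln_estimate:
  assumes "y \<ge> 1"
  shows "\<bar>(\<Sum>n=1..y. ln (real n)) - (real y * ln (real y) - real y)\<bar> \<le> 2 * sqrt (real y)"
proof -
  define E where "E = (\<lambda>y::nat. (\<Sum>n=1..y. ln (real n)) - (real y * ln (real y) - real y))"
  have step: "0 \<le> E (Suc y) - E y \<and> E (Suc y) - E y \<le> 1 / sqrt (real (Suc y))" if "y \<ge> 1" for y
  proof -
    define L where "L = ln (real (Suc y)) - ln (real y)"
    have eq: "E (Suc y) - E y = 1 - real y * L" by (simp add: E_def L_def algebra_simps)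
    have up: "L \<le> 1 / real y" using ln_diff_le_inverse[of "real y"] that by (simp add: L_def add.commute)
    have "L = - ln (real y / real (Suc y))" using that by (simp add: L_def ln_div)
    moreover have "ln (real y / real (Suc y)) \<le> real y / real (Suc y) - 1"
      using that by (intro ln_le_minus_one) auto
    moreover have "real y / real (Suc y) - 1 = - (1 / real (Suc y))" by (simp add: field_simps)
    ultimately have lo: "L \<ge> 1 / real (Suc y)" by linarith
    have "real y * L \<le> real y * (1 / real y)" using up by (intro mult_left_mono) auto
    then have a: "real y * L \<le> 1" using that by simp
    have "real y * (1 / real (Suc y)) \<le> real y * L" using lo by (intro mult_left_mono) auto
    then have "1 - real y * L \<le> 1 - real y / real (Suc y)" by simp
    also have "\<dots> = 1 / real (Suc y)" by (simp add: field_simps)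
    also have "\<dots> \<le> 1 / sqrt (real (Suc y))"
    proof (rule frac_le)
      show "sqrt (real (Suc y)) \<le> real (Suc y)" by (intro real_le_lsqrt) (auto simp: power2_eq_square algebra_simps)
    qed auto
    finally show ?thesis using a eq by simp
  qed
  have "0 \<le> E y \<and> E y \<le> (\<Sum>n=1..y. 1 / sqrt (real n))" using assms
  proof (induction y rule: dec_induct)
    case base
    then show ?case by (simp add: E_def)
  next
    case (step n)
    have "(\<Sum>k=1..Suc n. 1 / sqrt (real k)) = (\<Sum>k=1..n. 1 / sqrt (real k)) + 1 / sqrt (real (Suc n))" by simp
    then show ?case using step.IH \<open>\<And>y. y \<ge> 1 \<Longrightarrow> _ y\<close>[of n] step.hyps by linarith
  qed
  then show ?thesis using sum_inverse_sqrt_le[of y] by (simp add: E_def)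
qed

section \<open>Dirichlet's divisor problem\<close>

text \<open>A lattice point with a b <= y has a coordinate at most s. The points with a <= s and
  their mirror images thus cover the region under the hyperbola and overlap exactly in the square of
  side s.\<close>

lemma divisor_hyperbola:
  fixes s y :: nat
  assumes s: "s\<^sup>2 \<le> y" "y < (Suc s)\<^sup>2"
  shows "(\<Sum>a=1..y. y div a) + s\<^sup>2 = 2 * (\<Sum>a=1..s. y div a)"
proof -
  define P where "P = Sigma {1..y} (\<lambda>a. {1..y div a})"
  define A where "A = Sigma {1..s} (\<lambda>a. {1..y div a})"
  define B where "B = (\<lambda>(a, b). (b, a)) ` A"
  have iff: "b \<le> y div a \<longleftrightarrow> a * b \<le> y" if "a \<ge> 1" for a b
    using that by (simp add: less_eq_div_iff_mult_less_eq mult.commute)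
  have fin: "finite A" "finite B" by (auto simp: A_def B_def)
  have small: "a \<le> s \<or> b \<le> s" if "a * b \<le> y" for a b
  proof (rule ccontr)
    assume "\<not> (a \<le> s \<or> b \<le> s)"
    then have "Suc s * Suc s \<le> a * b" by (intro mult_le_mono) auto
    then show False using s that by (simp add: power2_eq_square)
  qed
  have memA: "(a, b) \<in> A \<longleftrightarrow> 1 \<le> a \<and> a \<le> s \<and> 1 \<le> b \<and> a * b \<le> y" for a b
    using iff[of a b] by (auto simp: A_def)
  have memB: "(a, b) \<in> B \<longleftrightarrow> 1 \<le> b \<and> b \<le> s \<and> 1 \<le> a \<and> a * b \<le> y" for a b
    using memA[of b a] by (force simp: B_def mult.commute)
  have le: "a \<le> y" if "a * b \<le> y" "1 \<le> b" for a b
    using order_trans[OF mult_le_mono2[OF that(2), of a] that(1)] by simp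
  have "x \<in> P \<longleftrightarrow> x \<in> A \<union> B" for x
  proof (cases x)
    case (Pair a b)
    have "(a, b) \<in> P \<longleftrightarrow> 1 \<le> a \<and> 1 \<le> b \<and> a * b \<le> y" using iff[of a b] le[of a b] by (auto simp: P_def)
    then show ?thesis using Pair memA[of a b] memB[of a b] small[of a b] by auto
  qed
  then have "P = A \<union> B" by blast
  moreover have "x \<in> A \<inter> B \<longleftrightarrow> x \<in> {1..s} \<times> {1..s}" for x
  proof (cases x)
    case (Pair a b)
    have "a * b \<le> y" if "a \<le> s" "b \<le> s" using mult_le_mono[OF that] s(1) by (simp add: power2_eq_square)
    then show ?thesis using Pair memA memB by auto
  qed
  then have "A \<inter> B = {1..s} \<times> {1..s}" by blast
  moreover have "card B = card A" unfolding B_def by (intro card_image) (auto simp: inj_on_def)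
  ultimately have "card P + s * s = 2 * card A"
    using card_Un_Int[OF fin] by (simp add: card_cartesian_product)
  then show ?thesis by (simp add: P_def A_def power2_eq_square)
qed

lemma divisor_sum_estimate:
  assumes "y \<ge> 1"
  shows "\<bar>real (\<Sum>a=1..y. y div a) - (real y * ln (real y) + 2 * euler_mascheroni * real y - real y)\<bar> \<le> 11 * sqrt (real y)"
proof -
  define s where "s = nat \<lfloor>sqrt (real y)\<rfloor>"
  have s1: "real s \<le> sqrt (real y)" "sqrt (real y) < real s + 1"
    by (auto simp: s_def)
  have s0: "s \<ge> 1" using assms s1(2) real_sqrt_ge_one[of "real y"] by linarith
  have "(real s)\<^sup>2 \<le> real y" using s1(1) by (metis of_nat_0_le_iff power_mono real_sqrt_pow2)
  then have sq1: "s\<^sup>2 \<le> y" by (metis of_nat_le_iff of_nat_power)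
  have "real y < (real s + 1)\<^sup>2" using s1(2) by (smt (verit) of_nat_0_le_iff power_strict_mono real_sqrt_ge_zero real_sqrt_pow2 pos2)
  then have sq2: "y < (Suc s)\<^sup>2" by (metis of_nat_Suc of_nat_less_iff of_nat_power add.commute)
  define H where "H = (\<Sum>k=1..s. real (y div k))"
  have D: "real (\<Sum>a=1..y. y div a) = 2 * H - (real s)\<^sup>2"
    using arg_cong[OF divisor_hyperbola[OF sq1 sq2], of real] by (simp add: H_def)
  have harm: "harm s = (\<Sum>k=1..s. 1 / real k)" by (simp add: harm_def divide_inverse)
  have Hup: "H \<le> real y * harm s"
    unfolding H_def harm sum_distrib_left by (intro sum_mono) (use of_nat_div_le_of_nat in \<open>auto\<close>)
  have "real y * harm s - real s = (\<Sum>k=1..s. real y * (1 / real k) - 1)"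
    by (simp add: harm sum_distrib_left sum_subtractf)
  also have "\<dots> \<le> H" unfolding H_def
  proof (rule sum_mono)
    fix k assume "k \<in> {1..s}"
    then have "y < k + k * (y div k)" by (intro dividend_less_times_div) auto
    then have "real y < real (k + k * (y div k))" by (simp only: of_nat_less_iff)
    then show "real y * (1 / real k) - 1 \<le> real (y div k)"
      using \<open>k \<in> {1..s}\<close> by (simp add: field_simps)
  qed
  finally have Hlo: "real y * harm s - real s \<le> H" .
  \<comment> \<open>The available bounds for \<open>euler_mascheroni\<close> compare
    \<open>harm s\<close> with ln (s + 1), not ln s; the quantity \<open>e\<close> below then
    compares 2 ln (s + 1) with ln y.\<close>
  define d where "d = harm s - euler_mascheroni - ln (real s + 1)"
  have d: "- 1 / (2 * real s) \<le> d" "d \<le> 0"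
    using euler_mascheroni_lower[of "s - 1"] euler_mascheroni_upper[of "s - 1"] s0
    by (auto simp: d_def field_simps) 
  have ys: "real y \<le> (real s + 1)\<^sup>2" "(real s)\<^sup>2 \<le> real y" using \<open>real y < (real s + 1)\<^sup>2\<close> \<open>(real s)\<^sup>2 \<le> real y\<close> by auto
  have ysd: "real y / real s \<le> 4 * real s"
  proof -
    have "(real s + 1)\<^sup>2 \<le> (2 * real s)\<^sup>2" using s0 by (intro power_mono) auto
    then have "real y \<le> (2 * real s)\<^sup>2" using ys(1) by simp
    then show ?thesis using s0 by (simp add: field_simps power2_eq_square)
  qed
  have yd: "- (2 * real s) \<le> real y * d" "real y * d \<le> 0"
  proof -
    have "- (real y * d) \<le> real y * (1 / (2 * real s))"
      using d by (simp only: mult_minus_right[symmetric]) (intro mult_left_mono, auto)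
    also have "\<dots> = (real y / real s) / 2" by simp
    also have "\<dots> \<le> 2 * real s" using ysd by simp
    finally show "- (2 * real s) \<le> real y * d" by simp
    show "real y * d \<le> 0" using d by (simp add: mult_nonneg_nonpos)
  qed
  define e where "e = 2 * ln (real s + 1) - ln (real y)"
  have e: "0 \<le> real y * e" "real y * e \<le> 2 * real s + 1"
  proof -
    have eq: "e = ln ((real s + 1)\<^sup>2 / real y)"
      using assms by (simp add: e_def ln_div ln_realpow)
    have "1 \<le> (real s + 1)\<^sup>2 / real y" using ys assms by (simp add: field_simps)
    then show "0 \<le> real y * e" unfolding eq by simp
    have "e \<le> (real s + 1)\<^sup>2 / real y - 1" unfolding eq
      using \<open>1 \<le> (real s + 1)\<^sup>2 / real y\<close> by (intro ln_le_minus_one) auto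
    then have "real y * e \<le> real y * ((real s + 1)\<^sup>2 / real y - 1)" by (intro mult_left_mono) auto
    also have "\<dots> = (real s + 1)\<^sup>2 - real y" using assms by (simp add: field_simps)
    also have "\<dots> \<le> (real s + 1)\<^sup>2 - (real s)\<^sup>2" using ys by simp
    also have "\<dots> = 2 * real s + 1" by (simp add: power2_eq_square algebra_simps)
    finally show "real y * e \<le> 2 * real s + 1" .
  qed
  have "real y * harm s = real y * euler_mascheroni + (real y * ln (real y)) / 2 + real y * d + (real y * e) / 2"
    by (simp add: d_def e_def field_simps)
  moreover have "real y - (real s)\<^sup>2 \<le> 2 * real s + 1" using ys(1) by (simp add: power2_eq_square algebra_simps)
  moreover have "\<bar>2 * H - S2 - (t + 2 * g - w)\<bar> \<le> 11 * S"
    if "h = g + t / 2 + d' + e' / 2" "w - S2 \<le> 2 * S + 1" "H \<le> h" "h - S \<le> H" "- (2 * S) \<le> d'" "d' \<le> 0"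
      "0 \<le> e'" "e' \<le> 2 * S + 1" "S2 \<le> w" "1 \<le> S" for h g t d' e' w S2 S :: real
    unfolding abs_le_iff using that by (intro conjI) linarith+
  ultimately have "\<bar>2 * H - (real s)\<^sup>2 - (real y * ln (real y) + 2 * (real y * euler_mascheroni) - real y)\<bar> \<le> 11 * real s"
    using Hup Hlo yd e ys(2) s0 by simp
  then have "\<bar>2 * H - (real s)\<^sup>2 - (real y * ln (real y) + 2 * euler_mascheroni * real y - real y)\<bar> \<le> 11 * real s"
    by (simp add: mult.assoc mult.commute[of "real y"])
  then show ?thesis unfolding D using s1 by linarith
qed

section \<open>Mean value zero for \<mu> and its twists by characters\<close>

lemma periodic_partial_sum_bound:
  fixes c :: "nat \<Rightarrow> complex"
  assumes q: "q > 0" and per: "\<And>n. c (n + q) = c n" and zero: "(\<Sum>n<q. c n) = 0" and bd: "\<And>n. norm (c n) \<le> 1"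
  shows "norm (\<Sum>n<N. c n) \<le> real q"
proof (induction N rule: less_induct)
  case (less N)
  show ?case
  proof (cases "N < q")
    case True
    have "norm (\<Sum>n<N. c n) \<le> (\<Sum>n<N. 1)" using bd by (intro sum_norm_le) auto
    then show ?thesis using True by simp
  next
    case False
    have "(\<Sum>n<N. c n) = (\<Sum>n<q. c n) + (\<Sum>n\<in>{q..<N}. c n)"
      using False by (simp add: lessThan_atLeast0 sum.atLeastLessThan_concat)
    also have "(\<Sum>n\<in>{q..<N}. c n) = (\<Sum>n<N - q. c (n + q))"
      using sum.shift_bounds_nat_ivl[of c 0 q "N - q"] False by (simp add: lessThan_atLeast0)
    finally have "(\<Sum>n<N. c n) = (\<Sum>n<N - q. c n)" using zero per by simp
    then show ?thesis using less.IH[of "N - q"] q False by simp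
  qed
qed

text \<open>The 3-4-1 argument needs the series of the squared character to have no pole at 1 + 2
  \<i> t. Its only possible pole is at 1, and it occurs only if the square is principal. So what
  remains is t = 0 with a real character, where Monsky's argument applies.\<close>

lemma character_mean_zero_nonvanishing:
  assumes ch: "character q ch" and q: "q > 0" and a: "coprime a q" "ch a \<noteq> 1"
    and D: "D holomorphic_on {s. Re s > 0}" "\<And>s. Re s > 1 \<Longrightarrow> (\<lambda>n. ch n * of_nat n powr (-s)) sums D s"
    and s: "Re s = 1"
  shows "D s \<noteq> 0"
proof -
  have mult: "\<And>m n. ch (m * n) = ch m * ch n" and one: "ch 1 = 1" and per: "\<And>n. ch (n + q) = ch n"
    and nc: "\<And>n. \<not> coprime n q \<Longrightarrow> ch n = 0"
    using ch by (auto simp: character_def residue_fun_def)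
  have nrm: "ch n = 0 \<or> norm (ch n) = 1" for n using character_norm[OF ch q, of n] nc[of n] by blast
  have bd: "norm (ch n) \<le> 1" for n by (rule character_norm_le[OF ch q])
  have zero: "(\<Sum>n<q. ch n) = 0" by (rule character_sum_zero[OF ch q a])
  have op: "open {s. Re s > 0}" by (rule open_halfspace_Re_gt)
  have st: "s = Complex 1 (Im s)" using s by (simp add: complex_eq_iff)
  have fd: "D field_differentiable at (Complex 1 t)" for t
    using D(1) op by (simp add: holomorphic_on_imp_differentiable_at)
  show ?thesis
  proof (cases "Im s = 0 \<and> (\<forall>n. coprime n q \<longrightarrow> ch n ^ 2 = 1)")
    case False
    \<comment> \<open>\<open>m\<close> is the mean of the squared character over a period.
      Subtracting it leaves coefficients with zero sum, so the series continues as a holomorphic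
      function plus \<open>m\<close> times zeta.\<close>
    define m where "m = (\<Sum>n<q. ch n ^ 2) / of_nat q"
    define c where "c = (\<lambda>n. ch n ^ 2 - m)"
    have "(\<Sum>n<q. c n) = 0" using q by (simp add: c_def sum_subtractf m_def)
    moreover have "c (n + q) = c n" for n by (simp add: c_def per)
    moreover have "norm (c n) \<le> 1 + norm m" for n
    proof -
      have "norm (ch n ^ 2) \<le> 1" using bd[of n] by (simp add: norm_power power_le_one)
      then show ?thesis using norm_triangle_ineq4[of "ch n ^ 2" m] by (simp add: c_def)
    qed
    ultimately obtain E where E: "E holomorphic_on {s. Re s > 0}"
      "\<And>s. Re s > 1 \<Longrightarrow> (\<lambda>n. c n * of_nat n powr (-s)) sums E s"
      using periodic_continuation[OF q, of c "1 + norm m"] by metis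
    obtain Z where Z: "Z holomorphic_on {s. Re s > 0}" "Z 1 = 1"
      "\<And>s. Re s > 1 \<Longrightarrow> (\<lambda>n. of_nat n powr (-s)) sums (Z s / (s - 1))"
      using zeta_continuation by metis
    define L2 where "L2 = (\<lambda>s. E s + m * (Z s / (s - 1)))"
    have L2: "(\<lambda>n. ch n ^ 2 * of_nat n powr (-s)) sums L2 s" if "Re s > 1" for s
      using sums_add[OF E(2)[OF that] sums_mult[OF Z(3)[OF that], of m]]
      by (simp add: c_def L2_def algebra_simps)
    have contE: "isCont E (Complex 1 t)" and contZ: "isCont Z (Complex 1 t)" for t
      using E(1) Z(1) op by (auto intro!: continuous_on_interior holomorphic_on_imp_continuous_on simp: interior_open)
    have "isCont L2 (Complex 1 (2 * Im s))"
    proof (cases "Im s = 0")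
      case True
      then obtain n where n: "coprime n q" "ch n ^ 2 \<noteq> 1" using False by blast
      have "character q (\<lambda>n. ch n ^ 2)"
        using ch by (auto simp: character_def residue_fun_def power_mult_distrib)
      then have "m = 0" using character_sum_zero[of q "\<lambda>n. ch n ^ 2" n] q n by (simp add: m_def)
      then show ?thesis using contE by (simp add: L2_def)
    next
      case False
      then show ?thesis unfolding L2_def
        by (intro continuous_intros contE contZ) (auto simp: complex_eq_iff)
    qed
    from nonvanishing_one_line[OF mult one nrm fd D(2) this L2] show ?thesis using st by metis
  next
    case True
    define f where "f = (\<lambda>n. Re (ch n))"
    have q1: "\<not> coprime 0 q"
    proof
      assume "coprime 0 q"
      then have "q = 1" by simp
      then have "ch a = ch 1" using ch by (intro residue_fun_cong[of q]) (auto simp: character_def)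
      then show False using a one by simp
    qed
    have real: "ch n = of_real (f n) \<and> f n \<in> {-1, 0, 1}" for n
    proof (cases "coprime n q")
      case True
      then have "ch n ^ 2 = 1" using \<open>Im s = 0 \<and> _\<close> by blast
      then have "ch n = 1 \<or> ch n = -1" by (simp add: power2_eq_1_iff)
      then show ?thesis by (auto simp: f_def)
    qed (auto simp: nc f_def)
    have fm: "f (m * n) = f m * f n" for m n
      using mult[of m n] real by (metis of_real_eq_iff of_real_mult)
    have "\<bar>\<Sum>n<N. f n\<bar> \<le> real q" for N
    proof -
      have "of_real (\<Sum>n<N. f n) = (\<Sum>n<N. ch n)" using real by simp
      then have "norm (of_real (\<Sum>n<N. f n) :: complex) \<le> real q"
        using periodic_partial_sum_bound[OF q per zero bd] by metis
      then show ?thesis by (simp only: norm_of_real)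
    qed
    moreover have "f 1 = 1" "f 0 = 0" using one nc[OF q1] by (simp_all add: f_def)
    ultimately have "\<not> (\<lambda>n. f n / real n) sums 0"
      using fm real by (intro real_character_nonvanishing) auto
    \<comment> \<open>\<open>D\<close> is known as the sum of its series only for Re s > 1; Newman's
      theorem applied to \<open>ch\<close> itself identifies the sum at s = 1.\<close>
    moreover have "(\<lambda>n. ch n / of_nat n) sums D 1"
      by (rule newman[OF bd op D(1) _ D(2)]) auto
    then have "(\<lambda>n. f n / real n) sums Re (D 1)"
      using sums_Re[of "\<lambda>n. ch n / of_nat n" "D 1"] by (simp add: f_def)
    moreover have "s = 1" using True s by (simp add: complex_eq_iff)
    ultimately show ?thesis by auto
  qed
qed

text \<open>The hypothesis describes the series by the reciprocal of \<open>F\<close>, so that F is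
  the continuation of the series of \<mu> times \<open>ch\<close>. For zeta this is (s - 1) / Z s,
  which is regular at 1.\<close>

lemma moebius_mean_zero:
  fixes ch F :: "_ \<Rightarrow> complex"
  assumes mult: "\<And>m n. ch (m * n) = ch m * ch n" and one: "ch 1 = 1" and bd: "\<And>n. norm (ch n) \<le> 1"
    and F: "F holomorphic_on S" "open S" "{s. Re s \<ge> 1} \<subseteq> S"
    and D: "\<And>s. Re s > 1 \<Longrightarrow> (\<lambda>n. ch n * of_nat n powr (-s)) sums (1 / F s)"
  shows "(\<lambda>N. (\<Sum>n=1..N. of_int (moebius_mu n) * ch n) / of_nat N) \<longlonglongrightarrow> 0"
proof (rule kronecker_mean, rule newman[OF _ F(2) F(1) F(3)])
  show "norm (of_int (moebius_mu n) * ch n) \<le> 1" for n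
    using moebius_abs_le[of n] bd[of n] by (auto simp: norm_mult norm_of_int intro!: mult_le_one)
  show "(\<lambda>n. of_int (moebius_mu n) * ch n * of_nat n powr (-s)) sums F s" if "Re s > 1" for s
    using moebius_series(2)[OF mult one bd that D[OF that]] by simp
qed

lemma moebius_character_mean_zero:
  assumes ch: "character q ch" and q: "q > 0" and a: "coprime a q" "ch a \<noteq> 1"
  shows "(\<lambda>N. (\<Sum>n=1..N. of_int (moebius_mu n) * ch n) / of_nat N) \<longlonglongrightarrow> 0"
proof -
  have mult: "\<And>m n. ch (m * n) = ch m * ch n" and one: "ch 1 = 1" and per: "\<And>n. ch (n + q) = ch n"
    using ch by (auto simp: character_def residue_fun_def)
  have bd: "norm (ch n) \<le> 1" for n by (rule character_norm_le[OF ch q])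
  obtain D where D: "D holomorphic_on {s. Re s > 0}"
      "\<And>s. Re s > 1 \<Longrightarrow> (\<lambda>n. ch n * of_nat n powr (-s)) sums D s"
    using periodic_continuation[OF q per character_sum_zero[OF ch q a] bd] by metis
  define S where "S = {s. Re s > 0} \<inter> D -` (- {0})"
  have op: "open S" unfolding S_def
    by (intro continuous_open_preimage holomorphic_on_imp_continuous_on D(1) open_halfspace_Re_gt) auto
  have nz: "D s \<noteq> 0" if "Re s \<ge> 1" for s
  proof (cases "Re s = 1")
    case False
    then show ?thesis using that D(2)[of s] moebius_series(1)[OF mult one bd, of s] by auto
  qed (rule character_mean_zero_nonvanishing[OF ch q a D])
  show ?thesis
  proof (rule moebius_mean_zero[OF mult one bd _ op])
    show "(\<lambda>s. 1 / D s) holomorphic_on S"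
      by (intro holomorphic_intros holomorphic_on_subset[OF D(1)]) (auto simp: S_def)
    show "{s. Re s \<ge> 1} \<subseteq> S" using nz by (auto simp: S_def)
    show "(\<lambda>n. ch n * of_nat n powr (-s)) sums (1 / (1 / D s))" if "Re s > 1" for s
      using D(2)[OF that] by simp
  qed
qed

lemma moebius_mean_zero_trivial: "(\<lambda>N. (\<Sum>n=1..N. of_int (moebius_mu n)) / (of_nat N :: complex)) \<longlonglongrightarrow> 0"
proof -
  obtain Z where Z: "Z holomorphic_on {s. Re s > 0}" "Z 1 = 1"
      "\<And>s. Re s > 1 \<Longrightarrow> (\<lambda>n. of_nat n powr (-s)) sums (Z s / (s - 1))"
    using zeta_continuation by metis
  define S where "S = {s. Re s > 0} \<inter> Z -` (- {0})"
  have opn: "open {s. Re s > 0}" by (rule open_halfspace_Re_gt)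
  have op: "open S" unfolding S_def
    by (intro continuous_open_preimage holomorphic_on_imp_continuous_on Z(1) opn) auto
  have nz: "Z s \<noteq> 0" if "Re s \<ge> 1" for s
  proof (cases "Re s = 1")
    case False
    then have "Z s / (s - 1) \<noteq> 0"
      using that Z(3)[of s] moebius_series(1)[of "\<lambda>_. 1" s "Z s / (s - 1)"] by auto
    then show ?thesis by auto
  next
    case True
    show ?thesis
    proof (cases "Im s = 0")
      case True
      then have "s = 1" using \<open>Re s = 1\<close> by (simp add: complex_eq_iff)
      then show ?thesis using Z(2) by simp
    next
      case False
      have st: "s = Complex 1 (Im s)" using True by (simp add: complex_eq_iff)
      have fd: "(\<lambda>s. Z s / (s - 1)) field_differentiable at (Complex 1 t)" if "t \<noteq> 0" for t
        using that Z(1) opn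
        by (intro derivative_intros holomorphic_on_imp_differentiable_at) (auto simp: complex_eq_iff)
      \<comment> \<open>For the constant character the series and that of its square are both zeta,
        and t \<noteq> 0 keeps 1 + \<i> t and 1 + 2 \<i> t away from the pole.\<close>
      have "(\<lambda>s. Z s / (s - 1)) (Complex 1 (Im s)) \<noteq> 0"
        by (rule nonvanishing_one_line[where ch = "\<lambda>_. 1" and L = "\<lambda>s. Z s / (s - 1)"])
          (use Z(3) fd False in \<open>auto intro!: field_differentiable_imp_continuous_at\<close>)
      then show ?thesis using st by auto
    qed
  qed
  have "(\<lambda>N. (\<Sum>n=1..N. of_int (moebius_mu n) * 1) / (of_nat N :: complex)) \<longlonglongrightarrow> 0"
  proof (rule moebius_mean_zero[where ch = "\<lambda>_. 1" and F = "\<lambda>s. (s - 1) / Z s" and S = S])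
    show "(\<lambda>s. (s - 1) / Z s) holomorphic_on S"
      by (intro holomorphic_intros holomorphic_on_subset[OF Z(1)]) (auto simp: S_def)
    show "{s. Re s \<ge> 1} \<subseteq> S" using nz by (auto simp: S_def)
  qed (use op Z(3) in auto)
  then show ?thesis by simp
qed

section \<open>From the Moebius to the von Mangoldt function\<close>

lemma moebius_inversion:
  fixes g :: "nat \<Rightarrow> real"
  assumes n: "n > 0"
  shows "(\<Sum>d | d dvd n. of_int (moebius_mu d) * (\<Sum>e | e dvd n div d. g e)) = g n"
proof -
  let ?A = "Sigma {d. d dvd n} (\<lambda>d. {e. e dvd n div d})"
  have "(\<Sum>d | d dvd n. of_int (moebius_mu d) * (\<Sum>e | e dvd n div d. g e)) = (\<Sum>(d, e)\<in>?A. of_int (moebius_mu d) * g e)"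
    unfolding sum_distrib_left using n by (intro sum.Sigma) (auto simp: dvd_div_eq_0_iff)
  also have "\<dots> = (\<Sum>(e, d)\<in>?A. of_int (moebius_mu d) * g e)"
  proof (rule sum.reindex_bij_witness[where i = "\<lambda>(e, d). (d, e)" and j = "\<lambda>(d, e). (e, d)"])
    have "e dvd n div d \<and> d dvd n \<longleftrightarrow> d dvd n div e \<and> e dvd n" for d e
      by (metis dvd_div_iff_mult dvd_mult_left dvd_mult_right mult.commute dvd_0_left_iff n neq0_conv dvd_div_eq_0_iff)
    then show "\<And>x. x \<in> ?A \<Longrightarrow> (case x of (d, e) \<Rightarrow> (e, d)) \<in> ?A"
      "\<And>x. x \<in> ?A \<Longrightarrow> (case x of (e, d) \<Rightarrow> (d, e)) \<in> ?A"
      by auto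
  qed auto
  also have "\<dots> = (\<Sum>e | e dvd n. \<Sum>d | d dvd n div e. of_int (moebius_mu d) * g e)"
    using n by (intro sum.Sigma[symmetric]) (auto simp: dvd_div_eq_0_iff)
  also have "\<dots> = (\<Sum>e | e dvd n. if e = n then g n else 0)"
  proof (rule sum.cong[OF refl])
    fix e assume e: "e \<in> {e. e dvd n}"
    then have "n div e > 0" using n by (auto simp: dvd_div_eq_0_iff intro: gr0I)
    then have "(\<Sum>d | d dvd n div e. moebius_mu d) = (if n div e = 1 then 1 else 0)" by (rule sum_moebius_divisors)
    moreover have "n div e = 1 \<longleftrightarrow> e = n" using e n by (auto elim!: dvdE)
    ultimately have "(\<Sum>d | d dvd n div e. moebius_mu d) = (if e = n then 1 else 0)" by simp
    then have "(\<Sum>d | d dvd n div e. real_of_int (moebius_mu d)) = (if e = n then 1 else 0)"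
      by (metis of_int_0 of_int_1 of_int_sum)
    then show "(\<Sum>d | d dvd n div e. of_int (moebius_mu d) * g e) = (if e = n then g n else 0)"
      by (simp add: sum_distrib_right[symmetric])
  qed
  also have "\<dots> = g n" using n by simp
  finally show ?thesis .
qed

lemma mangoldt_moebius:
  assumes n: "n > 0"
  shows "(\<Sum>d | d dvd n. of_int (moebius_mu d) * ln (real (n div d))) = (mangoldt n :: real)"
proof -
  have "ln (real (n div d)) = (\<Sum>e | e dvd n div d. mangoldt e)" if "d dvd n" for d
  proof -
    have "n div d \<noteq> 0" using n that by (auto simp: dvd_div_eq_0_iff)
    then show ?thesis using mangoldt_sum[of "n div d", where 'a = real] by simp
  qed
  then have "(\<Sum>d | d dvd n. of_int (moebius_mu d) * ln (real (n div d))) =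
      (\<Sum>d | d dvd n. of_int (moebius_mu d) * (\<Sum>e | e dvd n div d. mangoldt e :: real))"
    by (intro sum.cong) auto
  then show ?thesis using moebius_inversion[OF n, of mangoldt] by simp
qed

lemma ln_le_sqrt: "ln (real y) \<le> 2 * sqrt (real y)"
proof (cases "y = 0")
  case False
  then have "ln (real y) = 2 * ln (sqrt (real y))" by (simp add: ln_sqrt)
  also have "ln (sqrt (real y)) \<le> sqrt (real y) - 1" using False by (intro ln_le_minus_one) auto
  finally show ?thesis by simp
qed simp

text \<open>Summation by parts against the increasing logarithm gives 2 C ln y; the square root only
  brings this into the form that \<open>axer\<close> expects.\<close>

lemma character_log_sum_bound:
  fixes c :: "nat \<Rightarrow> complex"
  assumes A: "\<And>N. norm (\<Sum>n<N. c n) \<le> C" and c0: "c 0 = 0"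
  shows "norm (\<Sum>n=1..y. c n * of_real (ln (real n))) \<le> 4 * C * sqrt (real y)"
proof (cases "y = 0")
  case False
  define A where "A = (\<lambda>N. \<Sum>n=1..N. c n)"
  have AC: "norm (A N) \<le> C" for N
  proof -
    have "(\<Sum>n<Suc N. c n) = A N"
      unfolding A_def lessThan_Suc_atMost using c0 by (intro sum.mono_neutral_right) (auto simp: Suc_le_eq)
    then show ?thesis using assms(1)[of "Suc N"] by simp
  qed
  have C0: "C \<ge> 0" using AC[of 0] norm_ge_zero order_trans by blast
  have parts: "(\<Sum>n=1..y. c n * of_real (ln (real n))) = A y * of_real (ln (real y)) - (\<Sum>n=1..<y. A n * of_real (ln (real (Suc n)) - ln (real n)))" if "y \<ge> 1" for y
    using that
  proof (induction y rule: dec_induct)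
    case (step n)
    then show ?case by (simp add: A_def algebra_simps)
  qed (simp add: A_def)
  have lnn: "ln (real y) \<ge> 0" using False by simp
  have "norm (\<Sum>n=1..<y. A n * of_real (ln (real (Suc n)) - ln (real n))) \<le> (\<Sum>n=1..<y. C * (ln (real (Suc n)) - ln (real n)))"
  proof (rule sum_norm_le)
    fix n assume "n \<in> {1..<y}"
    then have "ln (real (Suc n)) - ln (real n) \<ge> 0" by simp
    then show "norm (A n * of_real (ln (real (Suc n)) - ln (real n))) \<le> C * (ln (real (Suc n)) - ln (real n))"
      unfolding norm_mult norm_of_real using AC C0 by (intro mult_mono) auto
  qed
  also have "\<dots> = C * (ln (real y) - ln (real 1))"
    unfolding sum_distrib_left[symmetric] using False by (subst sum_Suc_diff') auto
  finally have 1: "norm (\<Sum>n=1..<y. A n * of_real (ln (real (Suc n)) - ln (real n))) \<le> C * ln (real y)" by simp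
  have 2: "norm (A y * of_real (ln (real y))) \<le> C * ln (real y)"
    unfolding norm_mult norm_of_real using AC lnn C0 by (intro mult_mono) auto
  have "norm (\<Sum>n=1..y. c n * of_real (ln (real n))) \<le> 2 * (C * ln (real y))"
    using 1 2 parts[of y] False norm_triangle_ineq4[of "A y * of_real (ln (real y))" "\<Sum>n=1..<y. A n * of_real (ln (real (Suc n)) - ln (real n))"]
    by simp
  also have "\<dots> \<le> 2 * (C * (2 * sqrt (real y)))"
    using ln_le_sqrt[of y] C0 by (intro mult_left_mono) auto
  finally show ?thesis by simp
qed simp

lemma psi_character:
  assumes ch: "character q ch" and q: "q > 0" and a: "coprime a q" "ch a \<noteq> 1"
  shows "(\<lambda>x. (\<Sum>n=1..x. mangoldt n * ch n) / of_nat x) \<longlonglongrightarrow> 0"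
proof -
  have mult: "\<And>m n. ch (m * n) = ch m * ch n" and per: "\<And>n. ch (n + q) = ch n" and one: "ch 1 = 1"
    using ch by (auto simp: character_def residue_fun_def)
  have bd: "norm (ch n) \<le> 1" for n by (rule character_norm_le[OF ch q])
  have ch0: "ch 0 = 0"
  proof (cases "coprime 0 q")
    case True
    then have "ch a = ch 1" using ch by (intro residue_fun_cong[of q]) (auto simp: character_def)
    then show ?thesis using a one by simp
  qed (use ch in \<open>auto simp: character_def residue_fun_def\<close>)
  have "(\<lambda>x. (\<Sum>n=1..x. \<Sum>d | d dvd n. (of_int (moebius_mu d) * ch d) * (ch (n div d) * of_real (ln (real (n div d))))) / of_nat x) \<longlonglongrightarrow> 0"
  proof (rule axer)
    show "norm (of_int (moebius_mu n) * ch n) \<le> 1" for n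
      using moebius_abs_le[of n] bd[of n] by (auto simp: norm_mult norm_of_int intro!: mult_le_one)
    show "(\<lambda>N. (\<Sum>n=1..N. of_int (moebius_mu n) * ch n) / of_nat N) \<longlonglongrightarrow> 0"
      by (rule moebius_character_mean_zero[OF ch q a])
    show "norm (\<Sum>n=1..y. ch n * of_real (ln (real n))) \<le> (4 * real q) * sqrt (real y)" for y
      by (rule character_log_sum_bound[OF periodic_partial_sum_bound[OF q per character_sum_zero[OF ch q a] bd] ch0])
  qed
  moreover have "(\<Sum>d | d dvd n. (of_int (moebius_mu d) * ch d) * (ch (n div d) * of_real (ln (real (n div d))))) = mangoldt n * ch n" if "n \<in> {1..x}" for n x
  proof -
    have "(\<Sum>d | d dvd n. (of_int (moebius_mu d) * ch d) * (ch (n div d) * of_real (ln (real (n div d))))) =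
      (\<Sum>d | d dvd n. of_real (of_int (moebius_mu d) * ln (real (n div d))) * ch n)"
    proof (rule sum.cong[OF refl])
      fix d assume "d \<in> {d. d dvd n}"
      then have "ch n = ch d * ch (n div d)" by (simp add: mult[symmetric])
      then show "(of_int (moebius_mu d) * ch d) * (ch (n div d) * of_real (ln (real (n div d)))) = of_real (of_int (moebius_mu d) * ln (real (n div d))) * ch n"
        by simp
    qed
    also have "\<dots> = of_real (\<Sum>d | d dvd n. of_int (moebius_mu d) * ln (real (n div d))) * ch n"
      by (simp only: sum_distrib_right of_real_sum)
    also have "\<dots> = of_real (mangoldt n) * ch n"
      using mangoldt_moebius[of n] that by simp
    finally show ?thesis by simp
  qed
  then have "(\<Sum>n=1..x. \<Sum>d | d dvd n. (of_int (moebius_mu d) * ch d) * (ch (n div d) * of_real (ln (real (n div d))))) = (\<Sum>n=1..x. mangoldt n * ch n)" for x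
    by (rule sum.cong[OF refl])
  ultimately show ?thesis by (simp only:)
qed

lemma psi_asymptotic: "(\<lambda>x. (\<Sum>n=1..x. mangoldt n :: complex) / of_nat x) \<longlonglongrightarrow> 1"
proof -
  define \<gamma> where "\<gamma> = (euler_mascheroni :: real)"
  \<comment> \<open>The partial sums of ln and of the divisor function are y ln y - y and y ln y + 2
    \<gamma> y - y up to 2 sqrt y and 11 sqrt y, so those of \<open>v\<close> are at most 13 sqrt y.
    Convolution of \<mu> with the constant 2 \<gamma> changes only the value at n = 1.\<close>
  define v where "v = (\<lambda>n. of_real (ln (real n) - real (card {d. d dvd n}) + 2 * \<gamma>) :: complex)"
  define R where "R = (\<lambda>x. \<Sum>n=1..x. \<Sum>d | d dvd n. of_int (moebius_mu d) * v (n div d))"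
  have "(\<lambda>x. R x / of_nat x) \<longlonglongrightarrow> 0" unfolding R_def
  proof (rule axer)
    show "norm (of_int (moebius_mu n) :: complex) \<le> 1" for n
      using moebius_abs_le[of n] by (auto simp: norm_of_int)
    show "(\<lambda>N. (\<Sum>n=1..N. of_int (moebius_mu n)) / of_nat N :: complex) \<longlonglongrightarrow> 0" by (rule moebius_mean_zero_trivial)
    show "norm (\<Sum>n=1..y. v n) \<le> 13 * sqrt (real y)" for y
    proof (cases "y = 0")
      case False
      have tau: "(\<Sum>n=1..y. real (card {d. d dvd n})) = real (\<Sum>a=1..y. y div a)"
        using sum_divisors_swap[of "\<lambda>_. 1 :: nat" "\<lambda>_. 1" y] by (simp flip: of_nat_sum)
      have "(\<Sum>n=1..y. v n) = of_real ((\<Sum>n=1..y. ln (real n)) - real (\<Sum>a=1..y. y div a) + real y * (2 * \<gamma>))"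
        unfolding tau[symmetric] by (simp add: v_def sum.distrib sum_subtractf)
      then have "norm (\<Sum>n=1..y. v n) = \<bar>(\<Sum>n=1..y. ln (real n)) - real (\<Sum>a=1..y. y div a) + real y * (2 * \<gamma>)\<bar>"
        by (simp only: norm_of_real)
      also have "\<dots> \<le> 13 * sqrt (real y)"
      proof -
        have "\<bar>S - D + w * (2 * \<gamma>)\<bar> \<le> 13 * r"
          if "\<bar>S - (t - w)\<bar> \<le> 2 * r" "\<bar>D - (t + 2 * \<gamma> * w - w)\<bar> \<le> 11 * r" for S D t w r :: real
          using that by (auto simp: abs_le_iff algebra_simps)
        from this[OF sum_ln_estimate divisor_sum_estimate[folded \<gamma>_def]] show ?thesis using False by simp
      qed
      finally show ?thesis .
    qed simp
  qed
  moreover have "R x = (\<Sum>n=1..x. mangoldt n) - of_nat x + of_real (2 * \<gamma>)" if "x \<ge> 1" for x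
  proof -
    have "(\<Sum>d | d dvd n. of_int (moebius_mu d) * v (n div d)) = mangoldt n - 1 + (if n = 1 then of_real (2 * \<gamma>) else 0)" if "n \<in> {1..x}" for n
    proof -
      have n: "n > 0" using that by simp
      have m1: "(\<Sum>d | d dvd n. real_of_int (moebius_mu d)) = (if n = 1 then 1 else 0)"
        using sum_moebius_divisors[OF n] by (metis of_int_0 of_int_1 of_int_sum)
      have m2: "(\<Sum>d | d dvd n. real_of_int (moebius_mu d) * real (card {e. e dvd n div d})) = 1"
        using moebius_inversion[OF n, of "\<lambda>_. 1"] by simp
      have "(\<Sum>d | d dvd n. of_int (moebius_mu d) * v (n div d)) = of_real (\<Sum>d | d dvd n. real_of_int (moebius_mu d) * ln (real (n div d)) - real_of_int (moebius_mu d) * real (card {e. e dvd n div d}) + real_of_int (moebius_mu d) * (2 * \<gamma>))"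
        by (simp add: v_def algebra_simps)
      also have "(\<Sum>d | d dvd n. real_of_int (moebius_mu d) * ln (real (n div d)) - real_of_int (moebius_mu d) * real (card {e. e dvd n div d}) + real_of_int (moebius_mu d) * (2 * \<gamma>)) = 
        mangoldt n - 1 + (if n = 1 then 1 else 0) * (2 * \<gamma>)"
        unfolding sum.distrib sum_subtractf mangoldt_moebius[OF n] m2 sum_distrib_right[symmetric] m1 ..
      finally show ?thesis by simp
    qed
    then have "R x = (\<Sum>n=1..x. mangoldt n - 1 + (if n = 1 then of_real (2 * \<gamma>) else 0))" by (simp add: R_def)
    also have "\<dots> = (\<Sum>n=1..x. mangoldt n) - of_nat x + of_real (2 * \<gamma>)"
      using that by (simp add: sum.distrib sum_subtractf)
    finally show ?thesis .
  qed
  then have "\<forall>\<^sub>F x in sequentially. R x / of_nat x + 1 - of_real (2 * \<gamma>) / of_nat x = (\<Sum>n=1..x. mangoldt n :: complex) / of_nat x"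
    unfolding eventually_sequentially by (intro exI[of _ 1]) (simp add: field_simps)
  moreover have "(\<lambda>x. of_real (2 * \<gamma>) / of_nat x :: complex) \<longlonglongrightarrow> 0" by (rule lim_const_over_n)
  ultimately have "(\<lambda>x. (\<Sum>n=1..x. mangoldt n :: complex) / of_nat x) \<longlonglongrightarrow> 0 + 1 - 0"
    using \<open>(\<lambda>x. R x / of_nat x) \<longlonglongrightarrow> 0\<close>
    by (intro Lim_transform_eventually[OF tendsto_diff[OF tendsto_add[OF _ tendsto_const]]]) auto
  then show ?thesis by simp
qed

section \<open>The prime number theorem in arithmetic progressions\<close>

lemma prime_power_le_imp:
  assumes "prime p" "p ^ k \<le> x" "x \<ge> 1"
  shows "real k \<le> 2 * ln (real x)"
proof -
  have "2 ^ k \<le> p ^ k" using assms(1) by (intro power_mono prime_ge_2_nat) auto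
  then have "(2::nat) ^ k \<le> x" using assms by simp
  then have "ln (real (2 ^ k)) \<le> ln (real x)" using assms by (subst ln_le_cancel_iff) auto
  then have "real k * ln 2 \<le> ln (real x)" by (simp add: ln_realpow)
  moreover have "real k * (1/2) \<le> real k * ln 2" using ln2_ge_two_thirds by (intro mult_left_mono) auto
  ultimately show ?thesis by simp
qed

text \<open>Two sets of prime powers are discarded in this way: those whose prime divides q, where
  \<open>P\<close> is a fixed finite set, and the proper powers up to x, whose bases are at most
  sqrt x. The range of exponents comes from \<open>prime_power_le_imp\<close>.\<close>

lemma sum_mangoldt_bound:
  fixes g :: "nat \<Rightarrow> complex"
  assumes A: "A \<subseteq> (\<lambda>(p, k). p ^ k) ` (P \<times> {k. real k \<le> 2 * ln (real x)})" "finite P" "A \<subseteq> {1..x}"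
    and bd: "\<And>n. norm (g n) \<le> B" and x: "x \<ge> 1"
  shows "norm (\<Sum>n\<in>A. mangoldt n * g n) \<le> B * real (card P) * (2 * ln (real x) + 1) * ln (real x)"
proof -
  have B0: "B \<ge> 0" using bd[of 0] norm_ge_zero order_trans by blast
  have lx: "ln (real x) \<ge> 0" using x by simp
  have K: "{k. real k \<le> 2 * ln (real x)} = {..nat \<lfloor>2 * ln (real x)\<rfloor>}"
    using lx by (auto simp: le_nat_iff le_floor_iff)
  have "card A \<le> card ((\<lambda>(p, k). p ^ k) ` (P \<times> {k. real k \<le> 2 * ln (real x)}))"
    using A K by (intro card_mono) auto
  also have "\<dots> \<le> card (P \<times> {k. real k \<le> 2 * ln (real x)})"
    using A K by (intro card_image_le) auto
  also have "\<dots> = card P * (nat \<lfloor>2 * ln (real x)\<rfloor> + 1)" unfolding K by (simp add: card_cartesian_product)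
  finally have "real (card A) \<le> real (card P * (nat \<lfloor>2 * ln (real x)\<rfloor> + 1))" by (simp only: of_nat_le_iff)
  also have "\<dots> = real (card P) * (real (nat \<lfloor>2 * ln (real x)\<rfloor>) + 1)" by (simp add: distrib_left)
  also have "\<dots> \<le> real (card P) * (2 * ln (real x) + 1)"
    using lx by (intro mult_left_mono add_right_mono) auto
  finally have cA: "real (card A) \<le> real (card P) * (2 * ln (real x) + 1)" .
  have "norm (\<Sum>n\<in>A. mangoldt n * g n) \<le> (\<Sum>n\<in>A. ln (real x) * B)"
  proof (rule sum_norm_le)
    fix n assume "n \<in> A"
    then have n: "n \<ge> 1" "n \<le> x" using A by auto
    have "mangoldt n \<le> ln (real n)" using n by (intro mangoldt_le) auto
    also have "\<dots> \<le> ln (real x)" using n by simp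
    finally show "norm (mangoldt n * g n) \<le> ln (real x) * B"
      unfolding norm_mult norm_mangoldt using bd mangoldt_nonneg lx by (intro mult_mono) auto
  qed
  also have "\<dots> = real (card A) * (ln (real x) * B)" by simp
  also have "\<dots> \<le> real (card P) * (2 * ln (real x) + 1) * (ln (real x) * B)"
    using cA lx B0 by (intro mult_right_mono) auto
  finally show ?thesis by (simp add: mult_ac)
qed

lemma mangoldt_nonzero_prime_power:
  assumes "mangoldt n \<noteq> (0::complex)"
  obtains p k where "prime p" "k > 0" "n = p ^ k"
proof -
  have "primepow n" using assms by (auto simp: mangoldt_def split: if_splits)
  then show ?thesis using that by (auto simp: primepow_def)
qed

lemma psi_principal:
  assumes q: "q > 0"
  shows "(\<lambda>x. (\<Sum>n=1..x. mangoldt n * (if coprime n q then 1 else 0)) / of_nat x :: complex) \<longlonglongrightarrow> 1"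
proof -
  define R where "R = (\<lambda>x. \<Sum>n\<in>{n\<in>{1..x}. \<not> coprime n q \<and> mangoldt n \<noteq> (0::complex)}. mangoldt n * (1::complex))"
  have eq: "(\<Sum>n=1..x. mangoldt n * (if coprime n q then 1 else 0)) = (\<Sum>n=1..x. mangoldt n) - R x" for x
  proof -
    have "R x = (\<Sum>n=1..x. if \<not> coprime n q \<and> mangoldt n \<noteq> (0::complex) then mangoldt n * 1 else 0)"
      unfolding R_def by (rule sum.inter_filter) simp
    then show ?thesis unfolding eq_diff_eq
      by (simp only: sum.distrib[symmetric]) (intro sum.cong, auto)
  qed
  have bound: "norm (R x) \<le> real (card (prime_factors q)) * (2 * ln (real x) + 1) * ln (real x)" if x: "x \<ge> 1" for x
  proof -
    have "norm (R x) \<le> 1 * real (card (prime_factors q)) * (2 * ln (real x) + 1) * ln (real x)"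
      unfolding R_def
    proof (rule sum_mangoldt_bound[OF _ _ _ _ x])
      show "{n \<in> {1..x}. \<not> coprime n q \<and> mangoldt n \<noteq> (0::complex)} \<subseteq> (\<lambda>(p, k). p ^ k) ` (prime_factors q \<times> {k. real k \<le> 2 * ln (real x)})"
      proof
        fix n assume n: "n \<in> {n \<in> {1..x}. \<not> coprime n q \<and> mangoldt n \<noteq> (0::complex)}"
        then obtain p k where pk: "prime p" "k > 0" "n = p ^ k" using mangoldt_nonzero_prime_power by blast
        have "\<not> coprime p q" using n pk by auto
        then have "p dvd q" using pk prime_imp_coprime by blast
        then have "p \<in> prime_factors q" using pk q by (simp add: prime_factors_dvd)
        moreover have "real k \<le> 2 * ln (real x)" using n pk x by (intro prime_power_le_imp) auto
        ultimately show "n \<in> (\<lambda>(p, k). p ^ k) ` (prime_factors q \<times> {k. real k \<le> 2 * ln (real x)})"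
          using pk by force
      qed
    qed auto
    then show ?thesis by simp
  qed
  have "(\<lambda>x. R x / of_nat x) \<longlonglongrightarrow> 0"
  proof (rule Lim_null_comparison)
    show "\<forall>\<^sub>F x in sequentially. norm (R x / of_nat x) \<le> real (card (prime_factors q)) * (2 * ln (real x) + 1) * ln (real x) / real x"
      using eventually_ge_at_top[of 1] by eventually_elim (simp add: norm_divide divide_right_mono bound)
    show "(\<lambda>x. real (card (prime_factors q)) * (2 * ln (real x) + 1) * ln (real x) / real x) \<longlonglongrightarrow> 0"
      by real_asymp
  qed
  from tendsto_diff[OF psi_asymptotic this] show ?thesis unfolding eq by (simp add: diff_divide_distrib)
qed

lemma character_principal_sum:
  assumes "q > 0"
  shows "(\<Sum>n<q. if coprime n q then 1 else 0 :: complex) = of_nat (totient q)"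
proof (cases "q = 1")
  case False
  have "(\<Sum>n<q. if coprime n q then 1 else 0 :: complex) = of_nat (card {n\<in>{..<q}. coprime n q})"
    by (simp add: sum.inter_filter[symmetric])
  also have "{n\<in>{..<q}. coprime n q} = totatives q"
    using False assms by (auto simp: totatives_def le_less intro!: Nat.gr0I)
  finally show ?thesis by (simp add: totient_def)
qed simp

text \<open>Both sides are linear in \<open>f\<close>, so characters suffice: a nontrivial one gives
  0 on both sides, the principal one gives 1.\<close>

theorem psi_residue_fun:
  assumes q: "q > 0" and f: "residue_fun q f"
  shows "(\<lambda>x. (\<Sum>n=1..x. mangoldt n * f n) / of_nat x) \<longlonglongrightarrow> (\<Sum>n<q. f n) / of_nat (totient q)"
  using q f
proof (induction rule: residue_fun_induct)
  case (char ch)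
  show ?case
  proof (cases "\<exists>a. coprime a q \<and> ch a \<noteq> 1")
    case True
    then obtain a where a: "coprime a q" "ch a \<noteq> 1" by blast
    show ?thesis using psi_character[OF char q a] character_sum_zero[OF char q a] by simp
  next
    case False
    then have "ch = (\<lambda>n. if coprime n q then 1 else 0)" using char by (auto simp: character_def residue_fun_def)
    then show ?thesis using psi_principal[OF q] character_principal_sum[OF q] q by simp
  qed
next
  case (scale c g)
  have "(\<Sum>n=1..x. mangoldt n * (c * g n)) / of_nat x = c * ((\<Sum>n=1..x. mangoldt n * g n) / of_nat x)" for x
    by (simp add: sum_distrib_left mult_ac)
  moreover have "(\<Sum>n<q. c * g n) / of_nat (totient q) = c * ((\<Sum>n<q. g n) / of_nat (totient q))"
    by (simp add: sum_distrib_left)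
  ultimately show ?case using tendsto_mult_left[OF scale, of c] by (simp only:)
next
  case (sum g N)
  have "(\<Sum>n=1..x. mangoldt n * (\<Sum>k<N. g k n)) / of_nat x = (\<Sum>k<N. (\<Sum>n=1..x. mangoldt n * g k n) / of_nat x)" for x
    by (subst sum_divide_distrib[symmetric], subst sum.swap) (simp add: sum_distrib_left)
  moreover have "(\<Sum>n<q. \<Sum>k<N. g k n) / of_nat (totient q) = (\<Sum>k<N. (\<Sum>n<q. g k n) / of_nat (totient q))"
    by (subst sum_divide_distrib[symmetric], subst sum.swap) simp
  ultimately show ?case using tendsto_sum[of "{..<N}", OF sum] by simp
qed

lemma prime_powers_negligible:
  fixes f :: "nat \<Rightarrow> complex"
  assumes bd: "\<And>n. norm (f n) \<le> B"
  shows "(\<lambda>x. ((\<Sum>n=1..x. mangoldt n * f n) - (\<Sum>p | prime p \<and> p \<le> x. of_real (ln (real p)) * f p)) / of_nat x) \<longlonglongrightarrow> 0"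
proof -
  define R where "R = (\<lambda>x. \<Sum>n\<in>{n\<in>{1..x}. \<not> prime n \<and> mangoldt n \<noteq> (0::complex)}. mangoldt n * f n)"
  have eq: "(\<Sum>n=1..x. mangoldt n * f n) - (\<Sum>p | prime p \<and> p \<le> x. of_real (ln (real p)) * f p) = R x" for x
  proof -
    have "{p. prime p \<and> p \<le> x} = {n\<in>{1..x}. prime n}" by (auto simp: prime_ge_1_nat Suc_leI prime_gt_0_nat)
    then have "(\<Sum>p | prime p \<and> p \<le> x. of_real (ln (real p)) * f p) = (\<Sum>n\<in>{n\<in>{1..x}. prime n}. mangoldt n * f n)"
      by (intro sum.cong) auto
    also have "\<dots> = (\<Sum>n=1..x. if prime n then mangoldt n * f n else 0)"
      by (rule sum.inter_filter) simp
    moreover have "R x = (\<Sum>n=1..x. if \<not> prime n \<and> mangoldt n \<noteq> (0::complex) then mangoldt n * f n else 0)"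
      unfolding R_def by (rule sum.inter_filter) simp
    ultimately show ?thesis by (simp only: sum_subtractf[symmetric]) (intro sum.cong, auto)
  qed
  have bound: "norm (R x) \<le> B * (sqrt (real x) + 1) * (2 * ln (real x) + 1) * ln (real x)" if x: "x \<ge> 1" for x
  proof -
    have B0: "B \<ge> 0" using bd[of 0] norm_ge_zero order_trans by blast
    have lx: "ln (real x) \<ge> 0" using x by simp
    define P where "P = {..nat \<lfloor>sqrt (real x)\<rfloor>}"
    have cP: "real (card P) \<le> sqrt (real x) + 1" by (simp add: P_def)
    have "norm (R x) \<le> B * real (card P) * (2 * ln (real x) + 1) * ln (real x)"
      unfolding R_def
    proof (rule sum_mangoldt_bound[OF _ _ _ bd x])
      show "{n \<in> {1..x}. \<not> prime n \<and> mangoldt n \<noteq> (0::complex)} \<subseteq> (\<lambda>(p, k). p ^ k) ` (P \<times> {k. real k \<le> 2 * ln (real x)})"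
      proof
        fix n assume n: "n \<in> {n \<in> {1..x}. \<not> prime n \<and> mangoldt n \<noteq> (0::complex)}"
        then obtain p k where pk: "prime p" "k > 0" "n = p ^ k" using mangoldt_nonzero_prime_power by blast
        have "k \<noteq> 1" using n pk by auto
        then have "p ^ 2 \<le> p ^ k" using pk by (intro power_increasing) (auto simp: Suc_le_eq prime_gt_0_nat)
        then have "p ^ 2 \<le> x" using n pk by simp
        then have "real p \<le> sqrt (real x)" by (intro real_le_rsqrt) (metis of_nat_le_iff of_nat_power)
        then have "p \<in> P" by (simp add: P_def le_nat_iff le_floor_iff)
        moreover have "real k \<le> 2 * ln (real x)" using n pk x by (intro prime_power_le_imp) auto
        ultimately show "n \<in> (\<lambda>(p, k). p ^ k) ` (P \<times> {k. real k \<le> 2 * ln (real x)})"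
          using pk by force
      qed
    qed (auto simp: P_def)
    also have "\<dots> \<le> B * (sqrt (real x) + 1) * (2 * ln (real x) + 1) * ln (real x)"
      using cP B0 lx by (intro mult_right_mono mult_left_mono) auto
    finally show ?thesis .
  qed
  have "(\<lambda>x. R x / of_nat x) \<longlonglongrightarrow> 0"
  proof (rule Lim_null_comparison)
    show "\<forall>\<^sub>F x in sequentially. norm (R x / of_nat x) \<le> B * (sqrt (real x) + 1) * (2 * ln (real x) + 1) * ln (real x) / real x"
      using eventually_ge_at_top[of 1] by eventually_elim (simp add: norm_divide divide_right_mono bound)
    show "(\<lambda>x. B * (sqrt (real x) + 1) * (2 * ln (real x) + 1) * ln (real x) / real x) \<longlonglongrightarrow> 0"
      by real_asymp
  qed
  then show ?thesis unfolding eq .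
qed

text \<open>The indicator of the class takes the value 1 once per period and vanishes off the units,
  so it is a residue function with sum 1. The class is described by the inverse \<open>r\<close> of
  p because the cofactors of p are expressed through it in
  \<open>prime_dvd_linear_iff\<close>.\<close>

theorem prime_number_theorem_ap:
  assumes q: "q > 0" and r: "coprime r q"
  shows "(\<lambda>x. (\<Sum>p | prime p \<and> p \<le> x \<and> [r * p = 1] (mod q). ln (real p)) / real x) \<longlonglongrightarrow> 1 / real (totient q)"
proof -
  define f where "f = (\<lambda>n. if [r * n = 1] (mod q) then 1 else 0 :: complex)"
  have "residue_fun q f" unfolding residue_fun_def
  proof (intro conjI allI impI)
    show "f (n + q) = f n" for n by (simp add: f_def cong_def distrib_left)
    show "f n = 0" if "\<not> coprime n q" for n
    proof -
      have "\<not> [r * n = 1] (mod q)"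
        using that cong_imp_coprime[of 1 "r * n" q] by (auto dest: cong_sym)
      then show ?thesis by (simp add: f_def)
    qed
  qed
  note psi = psi_residue_fun[OF q this]
  have "norm (f n) \<le> 1" for n by (simp add: f_def)
  from tendsto_diff[OF psi prime_powers_negligible[of f, OF this]]
  have lim: "(\<lambda>x. (\<Sum>p | prime p \<and> p \<le> x. of_real (ln (real p)) * f p) / of_nat x) \<longlonglongrightarrow> (\<Sum>n<q. f n) / of_nat (totient q)"
    by (simp add: diff_divide_distrib)
  obtain s where s: "[r * s = 1] (mod q)" using cong_solve_coprime_nat[OF r] by auto
  have "[r * n = 1] (mod q) \<longleftrightarrow> [n = s] (mod q)" for n
  proof -
    have "[r * n = 1] (mod q) \<longleftrightarrow> [r * n = r * s] (mod q)" using s by (meson cong_sym cong_trans)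
    also have "\<dots> \<longleftrightarrow> [n = s] (mod q)" using r by (rule cong_mult_lcancel_nat)
    finally show ?thesis .
  qed
  then have "(\<Sum>n<q. f n) = (\<Sum>n<q. if n = s mod q then 1 else 0)"
    unfolding f_def by (intro sum.cong) (auto simp: cong_def)
  also have "\<dots> = 1" using q by simp
  finally have one: "(\<Sum>n<q. f n) = 1" .
  have "(\<Sum>p | prime p \<and> p \<le> x. of_real (ln (real p)) * f p) = of_real (\<Sum>p | prime p \<and> p \<le> x \<and> [r * p = 1] (mod q). ln (real p))" for x
  proof -
    have fin: "finite {p. prime p \<and> p \<le> x}" by (rule finite_subset[of _ "{..x}"]) auto
    have "(\<Sum>p | prime p \<and> p \<le> x. of_real (ln (real p)) * f p) = (\<Sum>p\<in>{p. prime p \<and> p \<le> x}. if [r * p = 1] (mod q) then of_real (ln (real p)) else 0)"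
      by (intro sum.cong) (auto simp: f_def)
    also have "\<dots> = (\<Sum>p\<in>{p \<in> {p. prime p \<and> p \<le> x}. [r * p = 1] (mod q)}. of_real (ln (real p)))"
      by (rule sum.inter_filter[OF fin, symmetric])
    finally show ?thesis by (simp add: conj_assoc)
  qed
  with lim one have "(\<lambda>x. complex_of_real ((\<Sum>p | prime p \<and> p \<le> x \<and> [r * p = 1] (mod q). ln (real p)) / real x)) \<longlonglongrightarrow> of_real (1 / real (totient q))"
    by simp
  then show ?thesis by (simp only: tendsto_of_real_iff)
qed

section \<open>Measuring the union of the intervals\<close>

lemma counting_scaled_limit:
  fixes w :: "nat \<Rightarrow> real"
  assumes lim: "(\<lambda>N. (\<Sum>p | p \<in> P \<and> p \<le> N. w p) / real N) \<longlonglongrightarrow> c" and x: "x \<ge> 0"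
  shows "(\<lambda>n. (\<Sum>p | p \<in> P \<and> real p \<le> real n * x. w p) / real n) \<longlonglongrightarrow> c * x"
proof (cases "x = 0")
  case True
  have "(\<Sum>p | p \<in> P \<and> real p \<le> real n * x. w p) = (\<Sum>p | p \<in> P \<and> p = 0. w p)" for n
    using True by simp
  then show ?thesis using True lim_const_over_n[of "\<Sum>p | p \<in> P \<and> p = 0. w p"] by simp
next
  case False
  define T where "T = (\<lambda>N. \<Sum>p | p \<in> P \<and> p \<le> N. w p)"
  define k where "k = (\<lambda>n::nat. nat \<lfloor>real n * x\<rfloor>)"
  have x0: "x > 0" using x False by simp
  have eq: "(\<Sum>p | p \<in> P \<and> real p \<le> real n * x. w p) = T (k n)" for n
  proof -
    have "real p \<le> real n * x \<longleftrightarrow> p \<le> k n" for p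
      using x by (simp add: k_def le_nat_iff le_floor_iff)
    then show ?thesis by (simp add: T_def)
  qed
  have "filterlim k at_top sequentially"
    unfolding k_def using x0 by real_asymp
  then have "(\<lambda>n. T (k n) / real (k n)) \<longlonglongrightarrow> c"
    using lim unfolding T_def by (rule filterlim_compose[rotated])
  moreover have "(\<lambda>n. real (k n) / real n) \<longlonglongrightarrow> x"
  proof -
    have "(\<lambda>n. real_of_int \<lfloor>real n * x\<rfloor> / real n) \<longlonglongrightarrow> x" using x0 by real_asymp
    then show ?thesis using x by (simp add: k_def)
  qed
  ultimately have "(\<lambda>n. T (k n) / real (k n) * (real (k n) / real n)) \<longlonglongrightarrow> c * x" by (rule tendsto_mult)
  moreover have "\<forall>\<^sub>F n in sequentially. T (k n) / real (k n) * (real (k n) / real n) = T (k n) / real n"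
    using \<open>filterlim k at_top sequentially\<close>[unfolded filterlim_at_top, rule_format, of 1]
    by eventually_elim auto
  ultimately show ?thesis unfolding eq by (rule Lim_transform_eventually)
qed

text \<open>Among the integers \<open>p \<le> n l / s 0\<close>, those lying in no interval \<open>(n m / s K, n l / s K]\<close> fill the
  gaps between consecutive intervals, and only finitely many of these gaps are nonempty.\<close>
lemma union_of_intervals_limit:
  fixes w :: "nat \<Rightarrow> real" and l m :: real and s :: "nat \<Rightarrow> real"
  assumes lim: "(\<lambda>N. (\<Sum>p | p \<in> P \<and> p \<le> N. w p) / real N) \<longlonglongrightarrow> c"
    and P: "\<And>p. p \<in> P \<Longrightarrow> p > 0"
    and lm: "l > m" "m \<ge> 0"
    and s0: "s 0 > 0" and mono: "\<And>K. s K \<le> s (Suc K)" and unb: "\<And>x. \<exists>K. s K > x"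
    and M: "\<And>K. K \<ge> M \<Longrightarrow> m * s (Suc K) \<le> l * s K"
  shows "(\<lambda>n. (\<Sum>p | p \<in> P \<and> (\<exists>K. m * real n < real p * s K \<and> real p * s K \<le> l * real n). w p) / real n)
     \<longlonglongrightarrow> c * (l / s 0 - (\<Sum>K<M. max 0 (m / s K - l / s (Suc K))))"
proof -
  have incs: "s i \<le> s j" if "i \<le> j" for i j using lift_Suc_mono_le[of s] mono that by blast
  have pos: "s K > 0" for K using s0 incs[of 0 K] by simp
  define \<theta> where "\<theta> = (\<lambda>X. \<Sum>p | p \<in> P \<and> real p \<le> X. w p)"
  define U where "U = (\<lambda>n::nat. {p \<in> P. \<exists>K. m * real n < real p * s K \<and> real p * s K \<le> l * real n})"
  define G where "G = (\<lambda>n K. {p \<in> P. l * real n < real p * s (Suc K) \<and> real p * s K \<le> m * real n})"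
  define A where "A = (\<lambda>n::nat. {p \<in> P. real p * s 0 \<le> l * real n})"
  have fin: "finite {p \<in> P. real p \<le> X}" for X
    by (rule finite_subset[of _ "{..nat \<lfloor>X\<rfloor>}"]) (auto simp: le_nat_floor)
  have A_alt: "A n = {p \<in> P. real p \<le> real n * (l / s 0)}" for n
    using s0 by (auto simp: A_def field_simps)
  have finA: "finite (A n)" for n unfolding A_alt by (rule fin)
  have UA: "U n \<subseteq> A n" for n
  proof
    fix p assume "p \<in> U n"
    then obtain K where K: "p \<in> P" "real p * s K \<le> l * real n" by (auto simp: U_def)
    have "real p * s 0 \<le> real p * s K" using incs[of 0 K] by (intro mult_left_mono) auto
    then show "p \<in> A n" using K by (simp add: A_def)
  qed
  have mn: "m * real n \<le> l * real n" for n using lm by (intro mult_right_mono) auto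
  have GA: "G n K \<subseteq> A n" for n K
  proof
    fix p assume p: "p \<in> G n K"
    have "real p * s 0 \<le> real p * s K" using incs[of 0 K] by (intro mult_left_mono) auto
    then show "p \<in> A n" using p mn[of n] by (auto simp: A_def G_def)
  qed
  have GU: "G n K \<inter> U n = {}" for n K
  proof -
    have False if p: "p \<in> G n K" "m * real n < real p * s J" "real p * s J \<le> l * real n" for p J
    proof (cases "J \<le> K")
      case True
      then have "real p * s J \<le> real p * s K" by (intro mult_left_mono incs) auto
      then show False using p by (auto simp: G_def)
    next
      case False
      then have "real p * s (Suc K) \<le> real p * s J" by (intro mult_left_mono incs) auto
      then show False using p by (auto simp: G_def)
    qed
    then show ?thesis by (auto simp: U_def)
  qed
  have Gdisj: "G n K \<inter> G n J = {}" if "K < J" for n K J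
  proof -
    have False if p: "p \<in> G n K" "p \<in> G n J" for p
    proof -
      have "real p * s (Suc K) \<le> real p * s J" using \<open>K < J\<close> by (intro mult_left_mono incs) auto
      then show False using p mn[of n] by (auto simp: G_def)
    qed
    then show ?thesis by blast
  qed
  have cover: "A n \<subseteq> U n \<union> (\<Union>K<M. G n K)" for n
  proof
    fix p assume p: "p \<in> A n"
    then have p0: "real p > 0" using P by (auto simp: A_def)
    \<comment> \<open>Since \<open>s\<close> is unbounded there is a last K with p s K <= l n. Then
      p lies in the interval of this K or in the gap following it.\<close>
    define S where "S = {K. real p * s K \<le> l * real n}"
    obtain K1 where K1: "s K1 > l * real n / real p" using unb by blast
    have "K < K1" if "K \<in> S" for K
    proof (rule ccontr)
      assume "\<not> K < K1"
      then have "real p * s K1 \<le> real p * s K" by (intro mult_left_mono incs) auto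
      moreover have "l * real n < real p * s K1" using K1 p0 by (simp add: field_simps)
      moreover have "real p * s K \<le> l * real n" using that by (simp add: S_def)
      ultimately show False by linarith
    qed
    then have finS: "finite S" by (intro finite_subset[of S "{..<K1}"]) auto
    have "0 \<in> S" using p by (simp add: S_def A_def)
    define K where "K = Max S"
    have KS: "K \<in> S" unfolding K_def using finS \<open>0 \<in> S\<close> by (intro Max_in) auto
    have "Suc K \<notin> S" using Max_ge[OF finS, of "Suc K"] by (auto simp: K_def[symmetric])
    then have up: "l * real n < real p * s (Suc K)" by (simp add: S_def)
    show "p \<in> U n \<union> (\<Union>K<M. G n K)"
    proof (cases "m * real n < real p * s K")
      case True
      then show ?thesis using KS p by (auto simp: U_def S_def A_def)
    next
      case False
      then have "p \<in> G n K" using up p by (auto simp: G_def A_def)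
      moreover have "K < M"
      proof (rule ccontr)
        assume "\<not> K < M"
        then have *: "m * s (Suc K) \<le> l * s K" using M by simp
        \<comment> \<open>The chain below compares m p s (K + 1) with m l n and must cancel m. For m
          = 0 the assumption p s K <= m n is already impossible.\<close>
        have m0: "m > 0"
        proof (rule ccontr)
          assume "\<not> m > 0"
          then have "real p * s K \<le> 0" using False lm by simp
          then show False using p0 pos[of K] by (simp add: mult_le_0_iff)
        qed
        have "m * (real p * s (Suc K)) \<le> real p * (l * s K)" using * p0 by (simp add: mult.left_commute)
        also have "\<dots> \<le> l * (m * real n)" using False lm by (simp add: mult.left_commute[of "real p"])
        finally have "m * (real p * s (Suc K)) \<le> m * (l * real n)" by (simp add: mult.left_commute)
        then show False using up m0 by simp
      qed
      ultimately show ?thesis by blast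
    qed
  qed
  have "A n = U n \<union> (\<Union>K<M. G n K)" for n using cover UA GA by blast
  then have split: "sum w (A n) = sum w (U n) + (\<Sum>K<M. sum w (G n K))" for n
  proof -
    have "sum w (A n) = sum w (U n) + sum w (\<Union>K<M. G n K)"
      unfolding \<open>A n = U n \<union> (\<Union>K<M. G n K)\<close>
    proof (rule sum.union_disjoint)
      show "finite (U n)" by (rule finite_subset[OF UA finA])
      show "finite (\<Union>K<M. G n K)" using finite_subset[OF GA finA] by simp
      show "U n \<inter> (\<Union>K<M. G n K) = {}" using GU by blast
    qed
    also have "sum w (\<Union>K<M. G n K) = (\<Sum>K<M. sum w (G n K))"
      using finite_subset[OF GA finA] Gdisj by (intro sum.UNION_disjoint) (auto, metis disjoint_iff linorder_neqE_nat)
    finally show ?thesis .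
  qed
  have \<theta>lim: "(\<lambda>n. \<theta> (real n * x) / real n) \<longlonglongrightarrow> c * x" if "x \<ge> 0" for x
    unfolding \<theta>_def by (rule counting_scaled_limit[OF lim that])
  have Alim: "(\<lambda>n. sum w (A n) / real n) \<longlonglongrightarrow> c * (l / s 0)"
    using \<theta>lim[of "l / s 0"] lm s0 by (simp add: \<theta>_def A_alt)
  have Glim: "(\<lambda>n. sum w (G n K) / real n) \<longlonglongrightarrow> c * max 0 (m / s K - l / s (Suc K))" for K
  proof -
    define x where "x = l / s (Suc K)"
    \<comment> \<open>The maximum gives an empty gap the length 0, so that one formula for the count
      covers both cases.\<close>
    define y where "y = max x (m / s K)"
    have x: "x \<ge> 0" "x \<le> y" using lm pos[of "Suc K"] by (auto simp: x_def y_def)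
    have "sum w (G n K) = \<theta> (real n * y) - \<theta> (real n * x)" for n
    proof -
      have "G n K = {p \<in> P. real p \<le> real n * y} - {p \<in> P. real p \<le> real n * x}"
      proof -
        have 1: "l * real n < real p * s (Suc K) \<longleftrightarrow> \<not> real p \<le> real n * x" for p
          using pos[of "Suc K"] by (simp add: x_def field_simps not_le)
        have 2: "real p * s K \<le> m * real n \<longleftrightarrow> real p \<le> real n * (m / s K)" for p
          using pos[of K] by (simp add: field_simps)
        have 3: "real p \<le> real n * y \<longleftrightarrow> real p \<le> real n * x \<or> real p \<le> real n * (m / s K)" for p
        proof (cases "x \<le> m / s K")
          case True
          then have "real n * x \<le> real n * (m / s K)" by (intro mult_left_mono) auto
          then show ?thesis unfolding y_def max_def if_P[OF True] by linarith
        next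
          case False
          then have "real n * (m / s K) \<le> real n * x" by (intro mult_left_mono) auto
          then show ?thesis unfolding y_def max_def if_not_P[OF False] by linarith
        qed
        show ?thesis unfolding G_def using 1 2 3 by auto
      qed
      moreover have "real n * x \<le> real n * y" using x by (intro mult_left_mono) auto
      ultimately show ?thesis unfolding \<theta>_def
        by (simp add: sum_diff[OF fin] subset_iff)
    qed
    moreover have "(\<lambda>n. (\<theta> (real n * y) - \<theta> (real n * x)) / real n) \<longlonglongrightarrow> c * y - c * x"
      unfolding diff_divide_distrib using x by (intro tendsto_diff \<theta>lim) auto
    moreover have "c * y - c * x = c * max 0 (m / s K - l / s (Suc K))"
      by (simp add: y_def x_def max_def algebra_simps)
    ultimately show ?thesis by simp
  qed
  have "(\<lambda>n. sum w (A n) / real n - (\<Sum>K<M. sum w (G n K) / real n)) \<longlonglongrightarrow>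
      c * (l / s 0) - (\<Sum>K<M. c * max 0 (m / s K - l / s (Suc K)))"
    by (intro tendsto_diff tendsto_sum Alim Glim)
  moreover have "sum w (A n) / real n - (\<Sum>K<M. sum w (G n K) / real n) = sum w (U n) / real n" for n
    by (simp add: split sum_divide_distrib add_divide_distrib)
  ultimately show ?thesis unfolding U_def
    by (simp add: right_diff_distrib sum_distrib_left)
qed

section \<open>Lengths of the gaps and the coefficients\<close>

lemma bracket_bounds:
  assumes "a > 0"
  shows "1 \<le> bracket a b" "bracket a b \<le> a" "[bracket a b = b] (mod a)"
  using theI'[OF bracket_ex1[OF assms, of b]] unfolding bracket_def by auto

lemma S_set_altdef: "S_set t = {..<nat (t + 1)}"
  by (auto simp: S_set_def)

text \<open>Connects the two descriptions of the gaps: as positive parts in the measure of the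
  union, and as a plain sum cut off by a floor, where exactly the nonnegative terms are
  kept.\<close>

lemma sum_max_nonneg_prefix:
  fixes F :: "nat \<Rightarrow> real"
  assumes "\<And>i. int i \<le> t \<longleftrightarrow> F i \<ge> 0" and "t < int N"
  shows "(\<Sum>i<N. max 0 (F i)) = (\<Sum>i\<in>S_set t. F i)"
proof -
  have "(\<Sum>i<N. max 0 (F i)) = (\<Sum>i\<in>S_set t. max 0 (F i))"
  proof (rule sum.mono_neutral_right)
    show "S_set t \<subseteq> {..<N}" using assms(2) by (auto simp: S_set_def)
    show "\<forall>i\<in>{..<N} - S_set t. max 0 (F i) = 0" using assms(1) by (auto simp: S_set_def max_def)
  qed simp
  also have "\<dots> = (\<Sum>i\<in>S_set t. F i)"
    using assms by (intro sum.cong) (auto simp: S_set_def max_def)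
  finally show ?thesis .
qed

text \<open>The gap after \<open>s (2 i)\<close> is nonempty iff \<open>i \<le> h\<close>, the gap after \<open>s (2 i + 1)\<close> iff \<open>i + 1 \<le> g\<close> (counting gaps of length \<open>0\<close>).\<close>
lemma lambda_sum_as_measure:
  fixes l m r x y z w :: int
  assumes lm: "l > m" "m \<ge> 0" and xy: "x > 0" "y > 0"
    and le: "x * bracket y (w * r) \<ge> y * bracket x (z * r)"
  defines "u \<equiv> real_of_int (bracket x (z * r)) / real_of_int x"
    and "v \<equiv> real_of_int (bracket y (w * r)) / real_of_int y"
  defines "s \<equiv> \<lambda>K. if even K then u + real (K div 2) else v + real (K div 2)"
  obtains M where "\<And>K. K \<ge> M \<Longrightarrow> real_of_int m * s (Suc K) \<le> real_of_int l * s K"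
    and "lambda_sum l m r x y z w = real_of_int l / s 0 - (\<Sum>K<M. max 0 (real_of_int m / s K - real_of_int l / s (Suc K)))"
proof -
  define L where "L = real_of_int l"
  define m' where "m' = real_of_int m"
  define g where "g = g_floor l m r x y z w"
  define h where "h = h_floor l m r x y z w"
  have LM: "L > m'" "m' \<ge> 0" using lm by (auto simp: L_def m'_def)
  have u: "u > 0" using bracket_bounds[OF xy(1), of "z * r"] xy by (simp add: u_def)
  have v: "v > 0" "v \<le> 1" using bracket_bounds[OF xy(2), of "w * r"] xy by (simp_all add: v_def)
  have X: "real_of_int x > 0" "real_of_int y > 0" using xy by auto
  have g_eq: "g = \<lfloor>(L + m' * u - L * v) / (L - m')\<rfloor>"
  proof -
    have "real_of_int (x * y * l + y * m * bracket x (z * r) - x * l * bracket y (w * r)) / real_of_int (x * y * (l - m))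
       = (L + m' * u - L * v) / (L - m')"
      using X LM by (auto simp: u_def v_def L_def m'_def divide_simps algebra_simps)
    then show ?thesis by (simp add: g_def g_floor_def)
  qed
  have h_eq: "h = \<lfloor>(m' * v - L * u) / (L - m')\<rfloor>"
  proof -
    have "real_of_int (x * m * bracket y (w * r) - y * l * bracket x (z * r)) / real_of_int (x * y * (l - m))
       = (m' * v - L * u) / (L - m')"
      using X LM by (auto simp: u_def v_def L_def m'_def divide_simps algebra_simps)
    then show ?thesis by (simp add: h_def h_floor_def)
  qed
  have hi: "int i \<le> h \<longleftrightarrow> m' / (u + real i) - L / (v + real i) \<ge> 0" for i
  proof -
    have "int i \<le> h \<longleftrightarrow> real i * (L - m') \<le> m' * v - L * u"
      using LM unfolding h_eq le_floor_iff by (simp add: pos_le_divide_eq)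
    also have "\<dots> \<longleftrightarrow> L * (u + real i) \<le> m' * (v + real i)" by (auto simp: algebra_simps)
    also have "\<dots> \<longleftrightarrow> L / (v + real i) \<le> m' / (u + real i)"
      using u v by (simp add: frac_le_eq divide_simps add_pos_nonneg) 
    finally show ?thesis by simp
  qed
  have gi: "int i \<le> g - 1 \<longleftrightarrow> m' / (v + real i) - L / (u + real i + 1) \<ge> 0" for i
  proof -
    have "int i \<le> g - 1 \<longleftrightarrow> int (i + 1) \<le> g" by auto
    also have "\<dots> \<longleftrightarrow> (real i + 1) * (L - m') \<le> L + m' * u - L * v"
      using LM unfolding g_eq le_floor_iff by (simp add: pos_le_divide_eq add.commute)
    also have "\<dots> \<longleftrightarrow> L * (v + real i) \<le> m' * (u + real i + 1)" by (auto simp: algebra_simps)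
    also have "\<dots> \<longleftrightarrow> L / (u + real i + 1) \<le> m' / (v + real i)"
      using u v by (simp add: frac_le_eq divide_simps add_pos_nonneg)
    finally show ?thesis by simp
  qed
  \<comment> \<open>This rests on v <= 1. It guarantees that the sum over \<open>S_set g\<close>
    contains i = 0, whose term L / u is the main term l / s 0; the others pair with the sum over
    \<open>S_set (g - 1)\<close>.\<close>
  have g0: "g \<ge> 0"
  proof -
    have "L * v \<le> L * 1" using v LM by (intro mult_left_mono) auto
    moreover have "m' * u \<ge> 0" using u LM by simp
    ultimately have "L + m' * u - L * v \<ge> 0" by simp
    then have "(L + m' * u - L * v) / (L - m') \<ge> 0" using LM by simp
    then show ?thesis unfolding g_eq by simp
  qed
  \<comment> \<open>From \<open>N\<close> on both \<open>F\<close> and \<open>F'\<close> are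
    negative. Each i accounts for the positions 2 i and 2 i + 1 of \<open>s\<close>, whence the
    bound 2 N.\<close>
  define N where "N = nat (max g h + 1)"
  have N: "h < int N" "g - 1 < int N" using g0 by (auto simp: N_def)
  define F where "F = (\<lambda>i. m' / (u + real i) - L / (v + real i))"
  define F' where "F' = (\<lambda>i. m' / (v + real i) - L / (u + real i + 1))"
  show ?thesis
  proof
    fix K assume K: "K \<ge> 2 * N"
    define i where "i = K div 2"
    have i: "i \<ge> N" using K by (simp add: i_def)
    show "real_of_int m * s (Suc K) \<le> real_of_int l * s K"
    proof (cases "even K")
      case True
      then have "s K = u + real i" "s (Suc K) = v + real i" by (auto simp: s_def i_def)
      moreover have "\<not> (F i \<ge> 0)" using hi[of i] N i by (auto simp: F_def)
      then have "m' / (u + real i) < L / (v + real i)" by (simp add: F_def)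
      then have "m' * (v + real i) < L * (u + real i)" using u v by (simp add: divide_simps add_pos_nonneg split: if_splits)
      ultimately show ?thesis by (simp add: L_def m'_def)
    next
      case False
      then have "s K = v + real i" "s (Suc K) = u + real i + 1" by (auto simp: s_def i_def elim!: oddE)
      moreover have "\<not> (F' i \<ge> 0)" using gi[of i] N i by (auto simp: F'_def)
      then have "m' / (v + real i) < L / (u + real i + 1)" by (simp add: F'_def)
      then have "m' * (u + real i + 1) < L * (v + real i)" using u v by (simp add: divide_simps add_pos_nonneg split: if_splits)
      ultimately show ?thesis by (simp add: L_def m'_def)
    qed
  next
    have pairs: "(\<Sum>K<2 * n. E K) = (\<Sum>i<n. E (2 * i) + E (2 * i + 1))" for E :: "nat \<Rightarrow> real" and n
      by (induction n) (auto simp: algebra_simps)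
    have "(\<Sum>K<2 * N. max 0 (real_of_int m / s K - real_of_int l / s (Suc K))) = (\<Sum>i<N. max 0 (F i) + max 0 (F' i))"
      unfolding pairs by (intro sum.cong) (auto simp: s_def F_def F'_def L_def m'_def add_ac)
    also have "\<dots> = (\<Sum>i\<in>S_set h. F i) + (\<Sum>i\<in>S_set (g - 1). F' i)"
      unfolding sum.distrib
      using sum_max_nonneg_prefix[of h F N] sum_max_nonneg_prefix[of "g - 1" F' N] hi gi N by (simp add: F_def F'_def)
    finally have gaps: "(\<Sum>K<2 * N. max 0 (real_of_int m / s K - real_of_int l / s (Suc K))) = (\<Sum>i\<in>S_set h. F i) + (\<Sum>i\<in>S_set (g - 1). F' i)" .
    have frac: "real_of_int (c * t) / real_of_int (bracket c B + c * int i) = real_of_int t / (real_of_int (bracket c B) / real_of_int c + real i)"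
      if "real_of_int c > 0" for c t B i
      using that bracket_bounds[of c B] by (simp add: divide_simps) (simp add: algebra_simps)
    have "lambda_sum l m r x y z w = (\<Sum>i\<in>S_set g. L / (u + real i)) - (\<Sum>i\<in>S_set (g - 1). m' / (v + real i))
        + (\<Sum>i\<in>S_set h. L / (v + real i) - m' / (u + real i))"
      unfolding lambda_sum_def g_def[symmetric] h_def[symmetric] frac[OF X(1)] frac[OF X(2)]
      by (simp add: u_def v_def L_def m'_def)
    also have "(\<Sum>i\<in>S_set g. L / (u + real i)) = L / u + (\<Sum>i\<in>S_set (g - 1). L / (u + real i + 1))"
    proof -
      have "nat (g + 1) = Suc (nat g)" using g0 by simp
      then show ?thesis unfolding S_set_altdef by (simp add: sum.lessThan_Suc_shift add_ac del: sum.lessThan_Suc)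
    qed
    finally show "lambda_sum l m r x y z w = real_of_int l / s 0 - (\<Sum>K<2 * N. max 0 (real_of_int m / s K - real_of_int l / s (Suc K)))"
      unfolding gaps by (simp add: F_def F'_def sum_subtractf s_def L_def)
  qed
qed

section \<open>Reduction of the least common multiple to primes\<close>

lemma prime_power_dvd_lcm_iff:
  fixes a b :: int
  assumes "prime p" "a \<noteq> 0" "b \<noteq> 0"
  shows "p ^ k dvd lcm a b \<longleftrightarrow> p ^ k dvd a \<or> p ^ k dvd b"
proof -
  have "\<not> is_unit p" using assms(1) by auto
  then show ?thesis
    using assms by (simp add: power_dvd_iff_le_multiplicity multiplicity_lcm lcm_eq_0_iff le_max_iff_disj)
qed

lemma prime_power_dvd_Lcm_image:
  fixes f :: "int \<Rightarrow> int"
  assumes "finite I" "prime p" "k > 0" "\<And>i. i \<in> I \<Longrightarrow> f i \<noteq> 0"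
  shows "p ^ k dvd (LCM i\<in>I. f i) \<longleftrightarrow> (\<exists>i\<in>I. p ^ k dvd f i)"
  using assms(1,4)
proof (induction I rule: finite_induct)
  case empty
  have "\<not> is_unit p" using assms(2) by auto
  then have "\<not> is_unit (p ^ k)" using assms(3) by (simp only: is_unit_power_iff) auto
  then show ?case by simp
next
  case (insert x I)
  have "(LCM i\<in>I. f i) \<noteq> 0" using insert by (auto simp: Lcm_0_iff)
  then show ?case using insert assms(2) by (simp add: prime_power_dvd_lcm_iff)
qed

lemma ln_prime_factorization:
  assumes "N > 0"
  shows "ln (real N) = (\<Sum>p\<in>prime_factors N. real (multiplicity p N) * ln (real p))"
proof -
  have pos: "p > 0" if "p \<in> prime_factors N" for p using that by (auto intro: prime_gt_0_nat)
  have "N = (\<Prod>p\<in>prime_factors N. p ^ multiplicity p N)"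
    using prime_factorization_nat[of N] assms by simp
  then have "ln (real N) = ln (\<Prod>p\<in>prime_factors N. real p ^ multiplicity p N)"
    by (metis (no_types, lifting) of_nat_power of_nat_prod prod.cong)
  also have "\<dots> = (\<Sum>p\<in>prime_factors N. ln (real p ^ multiplicity p N))"
    using pos by (intro ln_prod) auto
  also have "\<dots> = (\<Sum>p\<in>prime_factors N. real (multiplicity p N) * ln (real p))"
    using pos by (intro sum.cong) (auto simp: ln_realpow)
  finally show ?thesis .
qed

lemma ln_prime_nonneg: "prime p \<Longrightarrow> 0 \<le> ln (real p)"
  using prime_ge_1_nat[of p] by simp

lemma sum_UNION_le:
  fixes g :: "'b \<Rightarrow> real"
  assumes "finite W" "\<And>i. i \<in> W \<Longrightarrow> finite (X i)" "\<And>i x. i \<in> W \<Longrightarrow> x \<in> X i \<Longrightarrow> g x \<ge> 0"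
  shows "sum g (\<Union>i\<in>W. X i) \<le> (\<Sum>i\<in>W. sum g (X i))"
  using assms
proof (induction W rule: finite_induct)
  case (insert i W)
  have fin: "finite (X i)" "finite (\<Union>i\<in>W. X i)" using insert by auto
  have "sum g (X i \<inter> (\<Union>i\<in>W. X i)) \<ge> 0" using insert.prems by (intro sum_nonneg) auto
  moreover have "sum g (X i \<union> (\<Union>i\<in>W. X i)) + sum g (X i \<inter> (\<Union>i\<in>W. X i)) = sum g (X i) + sum g (\<Union>i\<in>W. X i)"
    by (rule sum.union_inter[OF fin])
  moreover have "sum g (\<Union>i\<in>W. X i) \<le> (\<Sum>i\<in>W. sum g (X i))" using insert by auto
  ultimately show ?case using insert.hyps by simp
qed simp

lemma sum_ln_prime_divisors_le:
  assumes "N > 0" "A \<subseteq> {p. prime p \<and> p dvd N}"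
  shows "(\<Sum>p\<in>A. ln (real p)) \<le> ln (real N)"
proof -
  have sub: "A \<subseteq> prime_factors N" using assms by (auto simp: prime_factors_dvd)
  have "(\<Sum>p\<in>A. ln (real p)) \<le> (\<Sum>p\<in>prime_factors N. ln (real p))"
    using sub by (intro sum_mono2) (auto intro: ln_prime_nonneg)
  also have "\<dots> \<le> (\<Sum>p\<in>prime_factors N. real (multiplicity p N) * ln (real p))"
  proof (rule sum_mono)
    fix p assume p: "p \<in> prime_factors N"
    then have "multiplicity p N > 0" using assms by (auto simp: prime_factors_multiplicity)
    then have "1 * ln (real p) \<le> real (multiplicity p N) * ln (real p)"
      using p by (intro mult_right_mono) (auto intro: ln_prime_nonneg)
    then show "ln (real p) \<le> real (multiplicity p N) * ln (real p)" by simp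
  qed
  also have "\<dots> = ln (real N)" by (rule ln_prime_factorization[OF assms(1), symmetric])
  finally show ?thesis .
qed

text \<open>A prime power divides the least common multiple iff it divides one of the values, so the
  exact power of p is at most B. Counting p only once thus costs at most ln B, and costs nothing for
  p outside \<open>S\<close>, whose square divides no value.\<close>

lemma ln_Lcm_bounds:
  fixes f :: "int \<Rightarrow> int"
  assumes I: "finite I" and f: "\<And>i. i \<in> I \<Longrightarrow> f i > 0 \<and> real_of_int (f i) \<le> B" and B: "B \<ge> 1"
    and S: "finite S" "\<And>p i. prime p \<Longrightarrow> i \<in> I \<Longrightarrow> (int p)\<^sup>2 dvd f i \<Longrightarrow> p \<in> S"
  defines "Q \<equiv> {p. prime p \<and> (\<exists>i\<in>I. int p dvd f i)}"
  shows "finite Q" "\<bar>ln (real_of_int (LCM i\<in>I. f i)) - (\<Sum>p\<in>Q. ln (real p))\<bar> \<le> real (card S) * ln B"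
proof -
  define N where "N = nat (LCM i\<in>I. f i)"
  have pos: "(LCM i\<in>I. f i) > 0"
  proof -
    have "(LCM i\<in>I. f i) \<noteq> 0" using I f by (force simp: Lcm_0_iff)
    then show ?thesis using Lcm_int_greater_eq_0[of "f ` I"] by linarith
  qed
  have N: "int N = (LCM i\<in>I. f i)" "N > 0" using pos by (auto simp: N_def)
  have dvdN: "p ^ k dvd N \<longleftrightarrow> (\<exists>i\<in>I. (int p) ^ k dvd f i)" if "prime p" "k > 0" for p k
  proof -
    have "p ^ k dvd N \<longleftrightarrow> (int p) ^ k dvd (LCM i\<in>I. f i)"
      by (simp flip: N(1) of_nat_power add: int_dvd_int_iff)
    also have "\<dots> \<longleftrightarrow> (\<exists>i\<in>I. (int p) ^ k dvd f i)"
    proof (rule prime_power_dvd_Lcm_image[OF I _ that(2)])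
      show "f i \<noteq> 0" if "i \<in> I" for i using f[OF that] by auto
    qed (use that in simp)
    finally show ?thesis .
  qed
  have Q: "Q = prime_factors N" using N(2) dvdN[of _ 1] by (auto simp: Q_def prime_factors_dvd)
  then show finQ: "finite Q" by simp
  have lnB: "ln B \<ge> 0" using B by simp
  have lnp: "ln (real p) \<ge> 0" if "p \<in> Q" for p using that by (auto simp: Q_def dest: prime_ge_1_nat)
  have le1: "(real (multiplicity p N) - 1) * ln (real p) \<le> (if p \<in> S then ln B else 0)"
    and ge0: "(real (multiplicity p N) - 1) * ln (real p) \<ge> 0" if p: "p \<in> Q" for p
  proof -
    have pp: "prime p" using p by (simp add: Q_def)
    define k where "k = multiplicity p N"
    have k: "k > 0" using p Q N by (auto simp: k_def prime_factors_multiplicity)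
    then show "(real (multiplicity p N) - 1) * ln (real p) \<ge> 0" using lnp[OF p] by (simp add: k_def)
    have "p ^ k dvd N" by (simp add: k_def multiplicity_dvd)
    then obtain i where i: "i \<in> I" "(int p) ^ k dvd f i" using dvdN[OF pp k] by blast
    show "(real (multiplicity p N) - 1) * ln (real p) \<le> (if p \<in> S then ln B else 0)"
    proof (cases "p \<in> S")
      case True
      have "(int p) ^ k \<le> f i" using i f by (intro zdvd_imp_le) auto
      then have "real_of_int ((int p) ^ k) \<le> B" using f[OF i(1)] by linarith
      then have "real p ^ k \<le> B" by simp
      moreover have "real p > 0" using pp by (simp add: prime_gt_0_nat)
      ultimately have "ln (real p ^ k) \<le> ln B" using B by (subst ln_le_cancel_iff) auto
      then have "real k * ln (real p) \<le> ln B" using \<open>real p > 0\<close> by (simp add: ln_realpow)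
      then show ?thesis using True lnp[OF p] by (simp add: k_def algebra_simps)
    next
      case False
      have "k < 2"
      proof (rule ccontr)
        assume "\<not> k < 2"
        then have "(int p)\<^sup>2 dvd (int p) ^ k" by (intro le_imp_power_dvd) auto
        then have "p \<in> S" using S(2)[OF pp i(1)] i(2) dvd_trans by blast
        then show False using False by simp
      qed
      then have "k = 1" using k by simp
      then show ?thesis using False by (simp add: k_def)
    qed
  qed
  have "ln (real_of_int (LCM i\<in>I. f i)) = ln (real N)" using N(1) by (metis of_int_of_nat_eq)
  also have "\<dots> = (\<Sum>p\<in>Q. real (multiplicity p N) * ln (real p))"
    unfolding Q by (rule ln_prime_factorization[OF N(2)])
  finally have eq: "ln (real_of_int (LCM i\<in>I. f i)) - (\<Sum>p\<in>Q. ln (real p)) = (\<Sum>p\<in>Q. (real (multiplicity p N) - 1) * ln (real p))"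
    by (simp add: sum_subtractf left_diff_distrib)
  have "(\<Sum>p\<in>Q. (real (multiplicity p N) - 1) * ln (real p)) \<le> (\<Sum>p\<in>Q. if p \<in> S then ln B else 0)"
    by (intro sum_mono le1)
  also have "\<dots> = (\<Sum>p\<in>Q \<inter> S. ln B)" by (rule sum.inter_restrict[OF finQ, symmetric])
  also have "\<dots> \<le> real (card S) * ln B"
    using lnB card_mono[OF S(1), of "Q \<inter> S"] by (simp add: mult_right_mono)
  finally have "(\<Sum>p\<in>Q. (real (multiplicity p N) - 1) * ln (real p)) \<le> real (card S) * ln B" .
  moreover have "(\<Sum>p\<in>Q. (real (multiplicity p N) - 1) * ln (real p)) \<ge> 0" by (intro sum_nonneg ge0)
  ultimately show "\<bar>ln (real_of_int (LCM i\<in>I. f i)) - (\<Sum>p\<in>Q. ln (real p))\<bar> \<le> real (card S) * ln B"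
    unfolding eq by simp
qed

section \<open>Values of a linear polynomial and their cofactors\<close>

text \<open>If a i + b = p k, multiplication by r gives k = b r modulo a, and k is positive; the
  positive members of this class are the bracket plus nonnegative multiples of a.\<close>

lemma prime_dvd_linear_iff:
  fixes a b r :: int and p :: nat
  assumes a: "a > 0" and p: "p > 0" and rp: "[r * int p = 1] (mod a)" and pos: "i \<ge> 0" "b > 0"
  shows "int p dvd a * i + b \<longleftrightarrow> (\<exists>j::nat. a * i + b = int p * (bracket a (b * r) + a * int j))"
proof
  define u where "u = bracket a (b * r)"
  note u = bracket_bounds[OF a, of "b * r", folded u_def]
  assume "int p dvd a * i + b"
  then obtain k where k: "a * i + b = int p * k" by auto
  have "int p * k > 0" using k a pos by (metis add_nonneg_pos less_imp_le mult_nonneg_nonneg)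
  then have k0: "k > 0" using p by (simp add: zero_less_mult_iff)
  have "[a * i + b = b] (mod a)" unfolding cong_iff_dvd_diff by simp
  then have "[int p * k = b] (mod a)" using k by simp
  then have "[r * (int p * k) = r * b] (mod a)" by (rule cong_scalar_left)
  moreover have "[r * int p * k = 1 * k] (mod a)" by (rule cong_scalar_right[OF rp])
  ultimately have "[k = b * r] (mod a)" by (metis cong_sym cong_trans mult.assoc mult.commute mult_1)
  then have "[k = u] (mod a)" using u(3) cong_sym cong_trans by blast
  then obtain t where t: "k = u + a * t" by (metis cong_iff_lin cong_sym)
  have "t \<ge> 0"
  proof (rule ccontr)
    assume "\<not> t \<ge> 0"
    then have "a * t \<le> a * (-1)" using a by (intro mult_left_mono) auto
    then show False using t k0 u(2) by simp
  qed
  then have "k = u + a * int (nat t)" using t by simp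
  then show "\<exists>j::nat. a * i + b = int p * (bracket a (b * r) + a * int j)" using k unfolding u_def by metis
qed auto

text \<open>The converse direction: p times such a cofactor is congruent to b, hence a value a i +
  b, with no control over the position of i.\<close>

lemma linear_value_exists:
  fixes a b r :: int and p :: nat
  assumes a: "a > 0" and rp: "[r * int p = 1] (mod a)"
  obtains i where "a * i + b = int p * (bracket a (b * r) + a * int j)"
proof -
  define u where "u = bracket a (b * r)"
  note u = bracket_bounds[OF a, of "b * r", folded u_def]
  have "[u + a * int j = u] (mod a)" unfolding cong_iff_dvd_diff by simp
  then have "[int p * (u + a * int j) = int p * (b * r)] (mod a)"
    using cong_trans[OF _ u(3)] by (intro cong_scalar_left) auto
  also have "[int p * (b * r) = b] (mod a)"
    using cong_scalar_left[OF rp, of b] by (simp add: mult_ac)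
  finally have "[b = int p * (u + a * int j)] (mod a)" by (rule cong_sym)
  then obtain i where "int p * (u + a * int j) = b + a * i" by (metis cong_iff_lin)
  then show ?thesis using that[of i] by (simp add: u_def add.commute)
qed

text \<open>Replacing the condition \<open>m n < i \<le> l n\<close> by \<open>m n < i + b / a \<le> l n\<close> changes only boundedly many
  values of \<open>i\<close>, and the prime divisors of each \<open>a i + b\<close> contribute at most \<open>ln (a i + b)\<close>.\<close>
lemma shifted_window_error:
  fixes a b r l m :: int and n :: nat
  assumes a: "a > 0" and b: "b > 0" and lm: "l > m" "m \<ge> 0" and n: "n > 0"
    and P: "\<And>p. p \<in> P \<Longrightarrow> prime p \<and> [r * int p = 1] (mod a)"
  defines "U \<equiv> {p \<in> P. \<exists>i\<in>{m * int n<..l * int n}. int p dvd a * i + b}"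
    and "V \<equiv> {p \<in> P. \<exists>j::nat. a * m * int n < int p * (bracket a (b * r) + a * int j) \<and> int p * (bracket a (b * r) + a * int j) \<le> a * l * int n}"
  shows "finite ((U - V) \<union> (V - U))"
    "(\<Sum>p\<in>(U - V) \<union> (V - U). ln (real p)) \<le> 2 * (real_of_int b + 1) * ln (real_of_int ((a * l + b) * int n))"
proof -
  \<comment> \<open>A discrepancy can come only from an i within distance b below an end of the
    window: at l n when the shift by b / a pushes i out, at m n when it pulls i in. Hence at most 2
    (b + 1) values.\<close>
  define W where "W = {i \<in> {l * int n - b..l * int n} \<union> {m * int n - b..m * int n}. a * i + b > 0}"
  define X where "X = (\<lambda>i. {p. prime p \<and> p dvd nat (a * i + b)})"
  have finW: "finite W" by (simp add: W_def)
  have finX: "finite (X i)" if "i \<in> W" for i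
    using that unfolding X_def W_def by (intro finite_subset[OF _ finite_divisors_nat]) auto
  have ub: "i > -b'" if "a * i > - (b'::int)" "b' \<ge> 0" for i b'
  proof (rule ccontr)
    assume "\<not> i > -b'"
    then have "a * i \<le> a * (-b')" using a by (intro mult_left_mono) auto
    also have "\<dots> \<le> 1 * (-b')" using a that(2) by (intro mult_right_mono_neg) auto
    finally show False using that by simp
  qed
  have sub: "(U - V) \<union> (V - U) \<subseteq> (\<Union>i\<in>W. X i)"
  proof
    fix p assume "p \<in> (U - V) \<union> (V - U)"
    then consider "p \<in> U" "p \<notin> V" | "p \<in> V" "p \<notin> U" by blast
    then show "p \<in> (\<Union>i\<in>W. X i)"
    proof cases
      case 1
      then obtain i where i: "i \<in> {m * int n<..l * int n}" "int p dvd a * i + b" by (auto simp: U_def)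
      have pP: "p \<in> P" using 1 by (simp add: U_def)
      have p0: "p > 0" using P[OF pP] prime_gt_0_nat by blast
      have i0: "i \<ge> 0" using i lm by (smt (verit) greaterThanAtMost_iff mult_nonneg_nonneg of_nat_0_le_iff)
      obtain j :: nat where j: "a * i + b = int p * (bracket a (b * r) + a * int j)"
        using prime_dvd_linear_iff[OF a p0 _ i0 b] P[OF pP] i by blast
      have "a * (m * int n) < a * i" using i a by (intro mult_strict_left_mono) auto
      then have "a * (m * int n) < a * i + b" using b by linarith
      then have "\<not> a * i + b \<le> a * l * int n" using 1 pP j unfolding V_def by (auto simp: mult.assoc)
      then have "a * (i - l * int n) > - b" by (simp add: algebra_simps)
      then have "i - l * int n > - b" by (rule ub) (use b in auto)
      moreover have pos: "a * i + b > 0" using i0 a b by (simp add: add_nonneg_pos)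
      ultimately have "i \<in> W" using i by (auto simp: W_def)
      moreover have "p \<in> X i" using i P[OF pP] pos by (auto simp: X_def int_dvd_int_iff[symmetric])
      ultimately show ?thesis by blast
    next
      case 2
      then obtain j :: nat where j: "a * m * int n < int p * (bracket a (b * r) + a * int j)"
        "int p * (bracket a (b * r) + a * int j) \<le> a * l * int n" by (auto simp: V_def)
      have pP: "p \<in> P" using 2 by (simp add: V_def)
      obtain i where i: "a * i + b = int p * (bracket a (b * r) + a * int j)"
        using linear_value_exists[OF a] P[OF pP] by blast
      have d: "int p dvd a * i + b" using i by simp
      have "a * i < a * (l * int n)" using j(2) i b by (simp add: mult.assoc)
      then have il: "i < l * int n" using a by simp
      have ng: "\<not> i > m * int n" using 2 pP d il by (auto simp: U_def)
      have "a * (i - m * int n) > - b" using j(1) i by (simp add: algebra_simps)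
      then have "i - m * int n > - b" by (rule ub) (use b in auto)
      moreover have pos: "a * i + b > 0" using j(1) i a lm by (smt (verit) mult_nonneg_nonneg of_nat_0_le_iff)
      ultimately have "i \<in> W" using ng by (auto simp: W_def)
      moreover have "p \<in> X i" using d P[OF pP] pos by (auto simp: X_def int_dvd_int_iff[symmetric])
      ultimately show ?thesis by blast
    qed
  qed
  have finU: "finite (\<Union>i\<in>W. X i)" using finW finX by blast
  show "finite ((U - V) \<union> (V - U))" by (rule finite_subset[OF sub finU])
  have pp: "ln (real p) \<ge> 0" if "p \<in> (\<Union>i\<in>W. X i)" for p using that by (auto simp: X_def dest: prime_ge_1_nat)
  have "(\<Sum>p\<in>(U - V) \<union> (V - U). ln (real p)) \<le> (\<Sum>p\<in>(\<Union>i\<in>W. X i). ln (real p))"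
    using sub finU pp by (intro sum_mono2) auto
  also have "\<dots> \<le> (\<Sum>i\<in>W. \<Sum>p\<in>X i. ln (real p))"
    using finW finX by (intro sum_UNION_le) (auto simp: X_def intro: ln_prime_nonneg)
  also have "\<dots> \<le> (\<Sum>i\<in>W. ln (real_of_int ((a * l + b) * int n)))"
  proof (rule sum_mono)
    fix i assume i: "i \<in> W"
    then have pos: "a * i + b > 0" by (simp add: W_def)
    have "m * int n \<le> l * int n" using lm by (intro mult_right_mono) auto
    then have "i \<le> l * int n" using i by (auto simp: W_def)
    then have "a * i \<le> a * (l * int n)" using a by (intro mult_left_mono) auto
    moreover have "b * 1 \<le> b * int n" using b n by (intro mult_left_mono) auto
    ultimately have le: "a * i + b \<le> (a * l + b) * int n" by (simp add: algebra_simps)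
    have "(\<Sum>p\<in>X i. ln (real p)) \<le> ln (real (nat (a * i + b)))"
      using pos by (intro sum_ln_prime_divisors_le) (auto simp: X_def)
    also have "\<dots> \<le> ln (real_of_int ((a * l + b) * int n))"
      using pos le by (subst ln_le_cancel_iff) (auto simp flip: of_int_mult of_int_add)
    finally show "(\<Sum>p\<in>X i. ln (real p)) \<le> ln (real_of_int ((a * l + b) * int n))" .
  qed
  also have "\<dots> = real (card W) * ln (real_of_int ((a * l + b) * int n))" by simp
  also have "\<dots> \<le> 2 * (real_of_int b + 1) * ln (real_of_int ((a * l + b) * int n))"
  proof (rule mult_right_mono)
    have "card W \<le> card ({l * int n - b..l * int n} \<union> {m * int n - b..m * int n})"
      by (intro card_mono) (auto simp: W_def)
    also have "\<dots> \<le> card {l * int n - b..l * int n} + card {m * int n - b..m * int n}" by (rule card_Un_le)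
    also have "\<dots> = 2 * nat (b + 1)" by simp
    finally have "real (card W) \<le> real (2 * nat (b + 1))" by (simp only: of_nat_le_iff)
    then show "real (card W) \<le> 2 * (real_of_int b + 1)" using b by simp
    have "a * l \<ge> 0" using a lm by simp
    then have "1 * 1 \<le> (a * l + b) * int n" using b n by (intro mult_mono) auto
    then have "1 \<le> real_of_int ((a * l + b) * int n)" by linarith
    then show "0 \<le> ln (real_of_int ((a * l + b) * int n))" by simp
  qed
  finally show "(\<Sum>p\<in>(U - V) \<union> (V - U). ln (real p)) \<le> 2 * (real_of_int b + 1) * ln (real_of_int ((a * l + b) * int n))" .
qed

lemma abs_sum_diff_le:
  fixes g :: "'a \<Rightarrow> real"
  assumes "finite A" "finite B" "\<And>x. x \<in> A \<union> B \<Longrightarrow> g x \<ge> 0"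
  shows "\<bar>sum g A - sum g B\<bar> \<le> sum g ((A - B) \<union> (B - A))"
proof -
  have A: "sum g A = sum g (A - B) + sum g (A \<inter> B)"
    using assms(1) by (subst sum.union_disjoint[symmetric]) (auto intro!: sum.cong)
  have B: "sum g B = sum g (B - A) + sum g (A \<inter> B)"
    using assms(2) by (subst sum.union_disjoint[symmetric]) (auto intro!: sum.cong)
  have "sum g ((A - B) \<union> (B - A)) = sum g (A - B) + sum g (B - A)"
    using assms by (intro sum.union_disjoint) auto
  moreover have "sum g (A - B) \<ge> 0" "sum g (B - A) \<ge> 0" using assms(3) by (auto intro: sum_nonneg)
  ultimately show ?thesis using A B by (simp add: abs_le_iff)
qed

section \<open>Primes of one residue class\<close>

definition class_primes :: "int \<Rightarrow> int \<Rightarrow> nat set" where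
  "class_primes q r = {p. prime p \<and> [r * int p = 1] (mod q)}"

text \<open>The condition m n < p (c / a + j) <= l n, multiplied by a to stay in the integers. For
  \<open>c\<close> a bracket, c + a j runs through the positive cofactors.\<close>

definition window :: "int \<Rightarrow> int \<Rightarrow> int \<Rightarrow> int \<Rightarrow> nat \<Rightarrow> nat set" where
  "window l m a c n = {p. \<exists>j::nat. a * m * int n < int p * (c + a * int j) \<and> int p * (c + a * int j) \<le> a * l * int n}"

lemma class_primes_limit:
  assumes q: "q > 0" and r: "r > 0" "gcd r q = 1"
  shows "(\<lambda>N. (\<Sum>p | p \<in> class_primes q r \<and> p \<le> N. ln (real p)) / real N) \<longlonglongrightarrow> 1 / real (totient (nat q))"
proof -
  have cop: "coprime (nat r) (nat q)"
    using q r by (metis coprime_iff_gcd_eq_1 coprime_int_iff int_nat_eq less_imp_le)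
  have "(p \<in> class_primes q r \<and> p \<le> N) \<longleftrightarrow> (prime p \<and> p \<le> N \<and> [nat r * p = 1] (mod nat q))" for p N
    using q r cong_int_iff[of "nat r * p" 1 "nat q"] by (auto simp: class_primes_def)
  then show ?thesis using prime_number_theorem_ap[OF _ cop] q by simp
qed

lemma window_real:
  fixes a c l m :: int
  assumes "a > 0"
  shows "p \<in> window l m a c n \<longleftrightarrow> (\<exists>j::nat. real_of_int m * real n < real p * (real_of_int c / real_of_int a + real j)
     \<and> real p * (real_of_int c / real_of_int a + real j) \<le> real_of_int l * real n)"
proof -
  have a: "real_of_int a > 0" using assms by simp
  have eq: "real_of_int (int p * (c + a * int j)) = real_of_int a * (real p * (real_of_int c / real_of_int a + real j))" for j
    using a by (simp add: field_simps)
  have eq2: "real_of_int (a * k * int n) = real_of_int a * (real_of_int k * real n)" for k by simp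
  have 1: "a * m * int n < int p * (c + a * int j) \<longleftrightarrow> real_of_int m * real n < real p * (real_of_int c / real_of_int a + real j)" for j
    unfolding of_int_less_iff[where 'a = real, symmetric] eq eq2 using a by simp
  have 2: "int p * (c + a * int j) \<le> a * l * int n \<longleftrightarrow> real p * (real_of_int c / real_of_int a + real j) \<le> real_of_int l * real n" for j
    unfolding of_int_le_iff[where 'a = real, symmetric] eq eq2 using a by simp
  show ?thesis unfolding window_def using 1 2 by simp
qed

lemma window_limit_ordered:
  fixes l m x y z w q r :: int
  assumes lm: "l > m" "m \<ge> 0" and xy: "x > 0" "y > 0" and q: "q > 0" and r: "r > 0" "gcd r q = 1"
    and le: "x * bracket y (w * r) \<ge> y * bracket x (z * r)"
  shows "(\<lambda>n. (\<Sum>p\<in>class_primes q r \<inter> (window l m x (bracket x (z * r)) n \<union> window l m y (bracket y (w * r)) n). ln (real p)) / real n)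
     \<longlonglongrightarrow> 1 / real (totient (nat q)) * lambda_sum l m r x y z w"
proof -
  define u where "u = real_of_int (bracket x (z * r)) / real_of_int x"
  define v where "v = real_of_int (bracket y (w * r)) / real_of_int y"
  define s where "s = (\<lambda>K. if even K then u + real (K div 2) else v + real (K div 2))"
  obtain M where M: "\<And>K. K \<ge> M \<Longrightarrow> real_of_int m * s (Suc K) \<le> real_of_int l * s K"
    and lam: "lambda_sum l m r x y z w = real_of_int l / s 0 - (\<Sum>K<M. max 0 (real_of_int m / s K - real_of_int l / s (Suc K)))"
    using lambda_sum_as_measure[OF lm xy le] unfolding s_def u_def v_def by blast
  have u: "u > 0" using bracket_bounds[OF xy(1), of "z * r"] xy by (simp add: u_def)
  have v: "v > 0" "v \<le> 1" using bracket_bounds[OF xy(2), of "w * r"] xy by (simp_all add: v_def)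
  have uv: "u \<le> v"
  proof -
    have "real_of_int (y * bracket x (z * r)) \<le> real_of_int (x * bracket y (w * r))" using le by (simp only: of_int_le_iff)
    then show ?thesis using xy by (simp add: u_def v_def divide_simps mult.commute)
  qed
  have lim: "(\<lambda>n. (\<Sum>p | p \<in> class_primes q r \<and> (\<exists>K. real_of_int m * real n < real p * s K \<and> real p * s K \<le> real_of_int l * real n). ln (real p)) / real n)
     \<longlonglongrightarrow> 1 / real (totient (nat q)) * (real_of_int l / s 0 - (\<Sum>K<M. max 0 (real_of_int m / s K - real_of_int l / s (Suc K))))"
  proof (rule union_of_intervals_limit[OF class_primes_limit[OF q r]])
    show "p > 0" if "p \<in> class_primes q r" for p using that by (simp add: class_primes_def prime_gt_0_nat)
    show "s 0 > 0" using u by (simp add: s_def)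
    \<comment> \<open>Even positions step from u + i to v + i, which needs u <= v; odd ones from v +
      i to u + i + 1, which needs v <= 1 and u > 0.\<close>
    show "s K \<le> s (Suc K)" for K using uv u v by (auto simp: s_def elim!: evenE oddE)
    show "\<exists>K. s K > t" for t
    proof -
      obtain k :: nat where "t < real k" using reals_Archimedean2 by blast
      then have "s (2 * k) > t" using u by (simp add: s_def)
      then show ?thesis by blast
    qed
  qed (use lm M in auto)
  have "(\<exists>K. real_of_int m * real n < real p * s K \<and> real p * s K \<le> real_of_int l * real n) \<longleftrightarrow>
      p \<in> window l m x (bracket x (z * r)) n \<union> window l m y (bracket y (w * r)) n" (is "(\<exists>K. ?T (s K)) \<longleftrightarrow> _") for p n
  proof -
    have "(\<exists>K. ?T (s K)) \<longleftrightarrow> (\<exists>j::nat. ?T (u + real j)) \<or> (\<exists>j::nat. ?T (v + real j))"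
    proof
      assume "\<exists>K. ?T (s K)"
      then obtain K where K: "?T (s K)" by blast
      show "(\<exists>j::nat. ?T (u + real j)) \<or> (\<exists>j::nat. ?T (v + real j))"
        using K unfolding s_def by (cases "even K") auto
    next
      assume "(\<exists>j::nat. ?T (u + real j)) \<or> (\<exists>j::nat. ?T (v + real j))"
      then consider j where "?T (u + real j)" | j where "?T (v + real j)" by blast
      then show "\<exists>K. ?T (s K)"
      proof cases
        case (1 j)
        then have "?T (s (2 * j))" by (simp add: s_def)
        then show ?thesis by blast
      next
        case (2 j)
        then have "?T (s (2 * j + 1))" by (simp add: s_def)
        then show ?thesis by blast
      qed
    qed
    then show ?thesis by (simp add: window_real[OF xy(1)] window_real[OF xy(2)] u_def v_def)
  qed
  then have "{p. p \<in> class_primes q r \<and> (\<exists>K. real_of_int m * real n < real p * s K \<and> real p * s K \<le> real_of_int l * real n)} =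
     class_primes q r \<inter> (window l m x (bracket x (z * r)) n \<union> window l m y (bracket y (w * r)) n)" for n
    by blast
  with lim show ?thesis unfolding lam by simp
qed

lemma window_limit:
  fixes l m a1 a2 b1 b2 q r :: int
  assumes lm: "l > m" "m \<ge> 0" and a: "a1 > 0" "a2 > 0" and q: "q > 0" and r: "r > 0" "gcd r q = 1"
  shows "(\<lambda>n. (\<Sum>p\<in>class_primes q r \<inter> (window l m a1 (bracket a1 (b1 * r)) n \<union> window l m a2 (bracket a2 (b2 * r)) n). ln (real p)) / real n)
     \<longlonglongrightarrow> 1 / real (totient (nat q)) * A_coeff l m a1 a2 b1 b2 r"
proof (cases "a1 * bracket a2 (b2 * r) \<ge> a2 * bracket a1 (b1 * r)")
  case True
  then show ?thesis using window_limit_ordered[OF lm a q r] by (simp add: A_coeff_def)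
next
  case False
  then have "a2 * bracket a1 (b1 * r) \<ge> a1 * bracket a2 (b2 * r)" by simp
  from window_limit_ordered[OF lm a(2,1) q r this] show ?thesis using False by (simp add: A_coeff_def Un_commute)
qed

text \<open>As a1 and a2 divide q, the congruence r p = 1 holds modulo both, and
  \<open>shifted_window_error\<close> applies to each factor. The symmetric difference of the unions
  lies in the union of the symmetric differences, so the total error is still O(ln n).\<close>

lemma class_sum_limit:
  fixes l m a1 a2 b1 b2 q r :: int
  assumes lm: "l > m" "m \<ge> 0" and a: "a1 > 0" "a2 > 0" and b: "b1 > 0" "b2 > 0" and q: "q > 0" "a1 dvd q" "a2 dvd q"
    and r: "r > 0" "gcd r q = 1"
  shows "(\<lambda>n. (\<Sum>p | p \<in> class_primes q r \<and> (\<exists>i\<in>{m * int n<..l * int n}. int p dvd (a1 * i + b1) * (a2 * i + b2)). ln (real p)) / real n)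
     \<longlonglongrightarrow> 1 / real (totient (nat q)) * A_coeff l m a1 a2 b1 b2 r"
proof -
  define P where "P = class_primes q r"
  define U where "U = (\<lambda>a b n. {p \<in> P. \<exists>i\<in>{m * int n<..l * int n}. int p dvd a * i + b})"
  define V where "V = (\<lambda>a b n. {p \<in> P. \<exists>j::nat. a * m * int n < int p * (bracket a (b * r) + a * int j) \<and> int p * (bracket a (b * r) + a * int j) \<le> a * l * int n})"
  define E where "E = (\<lambda>a b (n::nat). 2 * (real_of_int b + 1) * ln (real_of_int ((a * l + b) * int n)))"
  have P1: "prime p \<and> [r * int p = 1] (mod a1)" "prime p \<and> [r * int p = 1] (mod a2)" if "p \<in> P" for p
    using that q cong_dvd_modulus[of "r * int p" 1 q] by (auto simp: P_def class_primes_def)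
  have lnP: "ln (real p) \<ge> 0" if "p \<in> P" for p using that by (auto simp: P_def class_primes_def intro: ln_prime_nonneg)
  have Ueq: "{p. p \<in> P \<and> (\<exists>i\<in>{m * int n<..l * int n}. int p dvd (a1 * i + b1) * (a2 * i + b2))} = U a1 b1 n \<union> U a2 b2 n" for n
    by (auto simp: U_def P_def class_primes_def prime_dvd_mult_iff)
  have Veq: "P \<inter> (window l m a1 (bracket a1 (b1 * r)) n \<union> window l m a2 (bracket a2 (b2 * r)) n) = V a1 b1 n \<union> V a2 b2 n" for n
    by (auto simp: V_def window_def)
  have finV: "finite (V a b n)" if "a > 0" for a b n
  proof (rule finite_subset[of _ "{..nat (a * l * int n)}"])
    show "V a b n \<subseteq> {..nat (a * l * int n)}"
    proof
      fix p assume "p \<in> V a b n"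
      then obtain j :: nat where j: "int p * (bracket a (b * r) + a * int j) \<le> a * l * int n" by (auto simp: V_def)
      have "1 \<le> bracket a (b * r) + a * int j" using bracket_bounds(1)[OF that, of "b * r"] that
        by (simp add: add_increasing2)
      then have "int p * 1 \<le> int p * (bracket a (b * r) + a * int j)" by (intro mult_left_mono) auto
      then show "p \<in> {..nat (a * l * int n)}" using j by (simp add: le_nat_iff)
    qed
  qed simp
  have bound: "\<bar>(\<Sum>p\<in>U a1 b1 n \<union> U a2 b2 n. ln (real p)) - (\<Sum>p\<in>V a1 b1 n \<union> V a2 b2 n. ln (real p))\<bar> \<le> E a1 b1 n + E a2 b2 n"
    if n: "n > 0" for n
  proof -
    define D where "D = (\<lambda>a b. (U a b n - V a b n) \<union> (V a b n - U a b n))"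
    have D1: "finite (D a1 b1)" "(\<Sum>p\<in>D a1 b1. ln (real p)) \<le> E a1 b1 n"
      using shifted_window_error[OF a(1) b(1) lm n P1(1)] unfolding D_def U_def V_def E_def by auto
    have D2: "finite (D a2 b2)" "(\<Sum>p\<in>D a2 b2. ln (real p)) \<le> E a2 b2 n"
      using shifted_window_error[OF a(2) b(2) lm n P1(2)] unfolding D_def U_def V_def E_def by auto
    have DP: "D a' b' \<subseteq> P" for a' b' by (auto simp: D_def U_def V_def)
    have finU: "finite (U a1 b1 n \<union> U a2 b2 n)"
      by (rule finite_subset[of _ "D a1 b1 \<union> V a1 b1 n \<union> D a2 b2 \<union> V a2 b2 n"])
        (use D1 D2 finV a in \<open>auto simp: D_def\<close>)
    have "\<bar>(\<Sum>p\<in>U a1 b1 n \<union> U a2 b2 n. ln (real p)) - (\<Sum>p\<in>V a1 b1 n \<union> V a2 b2 n. ln (real p))\<bar> \<le>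
      (\<Sum>p\<in>((U a1 b1 n \<union> U a2 b2 n) - (V a1 b1 n \<union> V a2 b2 n)) \<union> ((V a1 b1 n \<union> V a2 b2 n) - (U a1 b1 n \<union> U a2 b2 n)). ln (real p))"
      using finU finV a by (intro abs_sum_diff_le lnP) (auto simp: U_def V_def)
    also have "\<dots> \<le> (\<Sum>p\<in>D a1 b1 \<union> D a2 b2. ln (real p))"
      using D1 D2 DP by (intro sum_mono2 lnP) (auto simp: D_def)
    also have "\<dots> \<le> (\<Sum>p\<in>D a1 b1. ln (real p)) + (\<Sum>p\<in>D a2 b2. ln (real p))"
    proof -
      have "(\<Sum>p\<in>D a1 b1 \<inter> D a2 b2. ln (real p)) \<ge> 0" using DP by (intro sum_nonneg lnP) auto
      then show ?thesis using sum.union_inter[OF D1(1) D2(1), of "\<lambda>p. ln (real p)"] by linarith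
    qed
    also have "\<dots> \<le> E a1 b1 n + E a2 b2 n" using D1 D2 by linarith
    finally show ?thesis .
  qed
  have Elim: "(\<lambda>n. E a b n / real n) \<longlonglongrightarrow> 0" if "a > 0" "b > 0" for a b
  proof -
    have "a * l \<ge> 0" using lm that by simp
    then have c: "real_of_int (a * l + b) > 0" using that by linarith
    have "(\<lambda>n::nat. 2 * (real_of_int b + 1) * ln (real_of_int (a * l + b) * real n) / real n) \<longlonglongrightarrow> 0"
      using c by real_asymp
    then show ?thesis by (simp add: E_def)
  qed
  have "(\<lambda>n. (\<Sum>p\<in>U a1 b1 n \<union> U a2 b2 n. ln (real p)) / real n - (\<Sum>p\<in>V a1 b1 n \<union> V a2 b2 n. ln (real p)) / real n) \<longlonglongrightarrow> 0"
  proof (rule Lim_null_comparison)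
    show "\<forall>\<^sub>F n in sequentially. norm ((\<Sum>p\<in>U a1 b1 n \<union> U a2 b2 n. ln (real p)) / real n - (\<Sum>p\<in>V a1 b1 n \<union> V a2 b2 n. ln (real p)) / real n)
        \<le> E a1 b1 n / real n + E a2 b2 n / real n"
      using eventually_gt_at_top[of 0]
    proof eventually_elim
      case (elim n)
      then show ?case using bound[OF elim]
        by (simp add: diff_divide_distrib[symmetric] add_divide_distrib[symmetric] divide_right_mono)
    qed
    show "(\<lambda>n. E a1 b1 n / real n + E a2 b2 n / real n) \<longlonglongrightarrow> 0"
      using tendsto_add[OF Elim[OF a(1) b(1)] Elim[OF a(2) b(2)]] by simp
  qed
  from tendsto_add[OF this window_limit[OF lm a q(1) r, of b1 b2]]
  show ?thesis unfolding P_def[symmetric] Ueq Veq by simp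
qed

section \<open>Square factors and summation over the residue classes\<close>

text \<open>Either p divides both factors, hence \<open>D\<close>, or its square divides a single
  factor. \<open>D\<close> will be a1 b2 - a2 b1, the resultant of the two linear
  polynomials.\<close>

lemma prime_square_dvd_product:
  fixes p x y D C :: int
  assumes p: "prime p" and dvd: "p\<^sup>2 dvd x * y" and xy: "0 < x" "x \<le> C" "0 < y" "y \<le> C"
    and D: "\<And>d. d dvd x \<Longrightarrow> d dvd y \<Longrightarrow> d dvd D" "D \<noteq> 0"
  shows "p\<^sup>2 \<le> C \<or> p \<le> \<bar>D\<bar>"
proof -
  consider "p dvd x" "p dvd y" | "coprime p x" | "coprime p y" using p prime_imp_coprime by blast
  then show ?thesis
  proof cases
    case 1
    then have "p dvd D" using D by blast
    then have "p dvd \<bar>D\<bar>" by simp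
    then show ?thesis using D(2) zdvd_imp_le[of p "\<bar>D\<bar>"] by simp
  next
    case 2
    then have "p\<^sup>2 dvd y" using dvd by (simp add: coprime_dvd_mult_right_iff)
    then show ?thesis using xy zdvd_imp_le[of "p\<^sup>2" y] by simp
  next
    case 3
    then have "p\<^sup>2 dvd x" using dvd by (simp add: coprime_dvd_mult_left_iff)
    then show ?thesis using xy zdvd_imp_le[of "p\<^sup>2" x] by simp
  qed
qed

lemma class_primes_cover:
  assumes q: "q > 0" and p: "prime p" "\<not> int p dvd q"
  shows "\<exists>r\<in>{r \<in> {1..q}. gcd r q = 1}. p \<in> class_primes q r"
proof -
  have "coprime (int p) q" using p prime_imp_coprime[of "int p" q] by simp
  then obtain x where x: "[int p * x = 1] (mod q)" using cong_solve_coprime_int by blast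
  define r where "r = bracket q x"
  note rb = bracket_bounds[OF q, of x, folded r_def]
  have "[r * int p = x * int p] (mod q)" using rb(3) by (rule cong_scalar_right)
  then have c: "[r * int p = 1] (mod q)" using x by (metis cong_trans mult.commute)
  then have "coprime (r * int p) q" using cong_imp_coprime[of 1 "r * int p" q] cong_sym by auto
  then have "gcd r q = 1" by (simp add: coprime_iff_gcd_eq_1[symmetric])
  then show ?thesis using rb c p by (auto simp: class_primes_def)
qed

lemma class_primes_disjoint:
  assumes "r \<in> {1..q}" "r' \<in> {1..q}" "r \<noteq> r'"
  shows "class_primes q r \<inter> class_primes q r' = {}"
proof -
  have False if "p \<in> class_primes q r" "p \<in> class_primes q r'" for p
  proof -
    have c: "[r * int p = 1] (mod q)" "[r' * int p = 1] (mod q)" using that by (auto simp: class_primes_def)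
    have "[r * (r' * int p) = r * 1] (mod q)" "[r' * (r * int p) = r' * 1] (mod q)"
      using cong_scalar_left[OF c(2), of r] cong_scalar_left[OF c(1), of r'] by auto
    moreover have "r * (r' * int p) = r' * (r * int p)" by (simp add: mult_ac)
    ultimately have "[r = r'] (mod q)" by (metis cong_sym cong_trans mult_1_right)
    then have "q dvd r - r'" by (simp add: cong_iff_dvd_diff)
    then have "q dvd \<bar>r - r'\<bar>" by simp
    then have "q \<le> \<bar>r - r'\<bar>" using assms(3) by (intro zdvd_imp_le) auto
    then show False using assms by auto
  qed
  then show ?thesis by blast
qed

lemma class_primes_not_dvd:
  assumes "q > 0" "p \<in> class_primes q r"
  shows "\<not> int p dvd q"
proof
  assume "int p dvd q"
  then have "[r * int p = 1] (mod int p)" using assms by (auto simp: class_primes_def intro: cong_dvd_modulus)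
  then have "int p dvd r * int p - 1" by (simp only: cong_iff_dvd_diff)
  from dvd_diff[OF dvd_triv_right[of "int p" r] this] have "int p dvd 1" by simp
  then show False using assms by (auto simp: class_primes_def)
qed

lemma ln_Lcm_two_linear_limit:
  fixes l m a1 a2 b1 b2 :: int
  assumes lm: "l > m" "m \<ge> 0" and a: "a1 > 0" "a2 > 0" and b: "b1 > 0" "b2 > 0"
    and D: "a1 * b2 \<noteq> a2 * b1"
    and f: "\<And>x. f x = (a1 * x + b1) * (a2 * x + b2)"
  shows "(\<lambda>n. (ln (real_of_int (LCM i\<in>{m * int n<..l * int n}. f i)) -
      (\<Sum>p | prime p \<and> (\<exists>i\<in>{m * int n<..l * int n}. int p dvd f i). ln (real p))) / real n) \<longlonglongrightarrow> 0"
proof (rule Lim_null_comparison)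
  \<comment> \<open>For n >= 1 both factors are at most C n on the window, so their product is at
    most (C n)^2.\<close>
  define C where "C = (a1 + a2) * l + b1 + b2"
  define d where "d = \<bar>a1 * b2 - a2 * b1\<bar>"
  have C: "C > 0" using a b lm by (simp add: C_def add_nonneg_pos)
  have lin: "0 < a * i + b \<and> a * i + b \<le> C * int n"
    if "i \<in> {m * int n<..l * int n}" "n > 0" "(a, b) \<in> {(a1, b1), (a2, b2)}" for a b i n
  proof -
    have ab: "a > 0" "b > 0" "a \<le> a1 + a2" "b \<le> b1 + b2" using that a assms(5,6) by auto
    have "m * int n \<ge> 0" using lm by simp
    then have i: "i > 0" "i \<le> l * int n" using that by auto
    have "a * i \<le> (a1 + a2) * (l * int n)" using ab i a by (intro mult_mono) auto
    moreover have "b * 1 \<le> (b1 + b2) * int n" using ab that(2) by (intro mult_mono) auto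
    ultimately have "a * i + b \<le> C * int n" by (simp add: C_def algebra_simps)
    then show ?thesis using ab i by (simp add: add_pos_pos)
  qed
  show "\<forall>\<^sub>F n in sequentially. norm ((ln (real_of_int (LCM i\<in>{m * int n<..l * int n}. f i)) -
      (\<Sum>p | prime p \<and> (\<exists>i\<in>{m * int n<..l * int n}. int p dvd f i). ln (real p))) / real n) \<le>
      (sqrt (real_of_int C * real n) + real_of_int d + 2) * ln ((real_of_int C * real n)\<^sup>2) / real n"
    using eventually_gt_at_top[of 0]
  proof eventually_elim
    case (elim n)
    let ?I = "{m * int n<..l * int n}"
    \<comment> \<open>Primes whose square can divide a value: those up to sqrt (C n), and those
      bounded by the resultant. Their number is O(sqrt n), so the error is O(sqrt n ln n).\<close>
    define S where "S = {..nat \<lfloor>sqrt (real_of_int C * real n)\<rfloor>} \<union> {..nat d}"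
    have Cn: "1 \<le> C * int n" using C elim mult_mono[of 1 C 1 "int n"] by simp
    then have Cn': "1 \<le> real_of_int C * real n" by (metis of_int_1 of_int_le_iff of_int_mult of_int_of_nat_eq)
    have "real (card S) \<le> real (card {..nat \<lfloor>sqrt (real_of_int C * real n)\<rfloor>} + card {..nat d})"
      unfolding S_def of_nat_le_iff by (rule card_Un_le)
    also have "\<dots> \<le> sqrt (real_of_int C * real n) + real_of_int d + 2"
      using Cn' by (simp add: d_def)
    finally have cS: "real (card S) \<le> sqrt (real_of_int C * real n) + real_of_int d + 2" .
    have ge: "1 \<le> (real_of_int C * real n)\<^sup>2" using Cn' by simp
    have "\<bar>ln (real_of_int (LCM i\<in>?I. f i)) - (\<Sum>p | prime p \<and> (\<exists>i\<in>?I. int p dvd f i). ln (real p))\<bar>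
       \<le> real (card S) * ln ((real_of_int C * real n)\<^sup>2)"
    proof (rule ln_Lcm_bounds(2)[OF _ _ ge])
      fix i assume i: "i \<in> ?I"
      note l1 = lin[OF i elim, of a1 b1] and l2 = lin[OF i elim, of a2 b2]
      have "f i \<le> (C * int n) * (C * int n)" unfolding f using l1 l2 by (intro mult_mono) auto
      then have "real_of_int (f i) \<le> real_of_int ((C * int n) * (C * int n))" by (simp only: of_int_le_iff)
      then show "0 < f i \<and> real_of_int (f i) \<le> (real_of_int C * real n)\<^sup>2"
        using l1 l2 by (simp add: f power2_eq_square)
    next
      fix p i assume p: "prime p" and i: "i \<in> ?I" and dvd: "(int p)\<^sup>2 dvd f i"
      note l1 = lin[OF i elim, of a1 b1] and l2 = lin[OF i elim, of a2 b2]
      have "(int p)\<^sup>2 \<le> C * int n \<or> int p \<le> \<bar>a1 * b2 - a2 * b1\<bar>"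
      proof (rule prime_square_dvd_product[OF _ dvd[unfolded f]])
        fix e assume "e dvd a1 * i + b1" "e dvd a2 * i + b2"
        then have "e dvd a1 * (a2 * i + b2) - a2 * (a1 * i + b1)" by (intro dvd_diff dvd_mult)
        then show "e dvd a1 * b2 - a2 * b1" by (simp add: algebra_simps)
      qed (use p l1 l2 D in auto)
      then show "p \<in> S"
      proof
        assume "(int p)\<^sup>2 \<le> C * int n"
        then have "real_of_int ((int p)\<^sup>2) \<le> real_of_int (C * int n)" by (simp only: of_int_le_iff)
        then have "real p \<le> sqrt (real_of_int C * real n)" by (intro real_le_rsqrt) simp
        then have "p \<le> nat \<lfloor>sqrt (real_of_int C * real n)\<rfloor>" by (rule le_nat_floor)
        then show ?thesis by (simp add: S_def)
      qed (auto simp: S_def d_def)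
    qed (auto simp: S_def)
    also have "\<dots> \<le> (sqrt (real_of_int C * real n) + real_of_int d + 2) * ln ((real_of_int C * real n)\<^sup>2)"
      using cS ge by (intro mult_right_mono) auto
    finally show ?case using elim by (simp add: divide_right_mono)
  qed
  show "(\<lambda>n. (sqrt (real_of_int C * real n) + real_of_int d + 2) * ln ((real_of_int C * real n)\<^sup>2) / real n) \<longlonglongrightarrow> 0"
    using C by real_asymp
qed

theorem theorem1p1:
  fixes l m a1 a2 b1 b2 q :: int and f :: "int \<Rightarrow> int"
  assumes "l > m" and "m \<ge> 0"
    and "a1 > 0" and "a2 > 0" and "b1 > 0" and "b2 > 0"
    and "gcd a1 b1 = 1" and "gcd a2 b2 = 1"
    and "a1 * b2 \<noteq> a2 * b1"
    and "\<And>x. f x = (a1 * x + b1) * (a2 * x + b2)"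
    and "q = lcm a1 a2"
  shows "(\<lambda>n::nat. ln (real_of_int (LCM i\<in>{m * int n<..l * int n}. f i))
            - real n / real (totient (nat q))
                * (\<Sum>r\<in>{r \<in> {1..q}. gcd r q = 1}. A_coeff l m a1 a2 b1 b2 r))
         \<in> o(\<lambda>n. real n)"
proof -
  note lm = assms(1,2) and a = assms(3,4) and b = assms(5,6) and D = assms(9) and f = assms(10)
  have q: "q > 0" "a1 dvd q" "a2 dvd q" using a assms(11) by (auto simp: lcm_pos_int)
  define R where "R = {r \<in> {1..q}. gcd r q = 1}"
  define L where "L = (\<lambda>n::nat. ln (real_of_int (LCM i\<in>{m * int n<..l * int n}. f i)))"
  define Q where "Q = (\<lambda>n::nat. {p. prime p \<and> (\<exists>i\<in>{m * int n<..l * int n}. int p dvd f i)})"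
  \<comment> \<open>Primes dividing q belong to no class. There are finitely many, independently of
    n, so their contribution is bounded.\<close>
  define Q0 where "Q0 = (\<lambda>n. {p \<in> Q n. int p dvd q})"
  define QR where "QR = (\<lambda>r n. {p. p \<in> class_primes q r \<and> (\<exists>i\<in>{m * int n<..l * int n}. int p dvd f i)})"
  have finR: "finite R" by (rule finite_subset[of _ "{1..q}"]) (auto simp: R_def)
  have fin0: "finite {p. int p dvd q}"
    by (rule finite_subset[of _ "{..nat q}"]) (use q in \<open>auto dest: zdvd_imp_le simp: le_nat_iff\<close>)
  have finQ: "finite (Q n)" for n
  proof -
    have fp: "f i > 0" if "i \<in> {m * int n<..l * int n}" for i
    proof -
      have "m * int n \<ge> 0" using lm by simp
      then have "i > 0" using that by auto
      then show ?thesis unfolding f using a b by (intro mult_pos_pos add_pos_pos) auto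
    qed
    have "Q n \<subseteq> (\<Union>i\<in>{m * int n<..l * int n}. {..nat (f i)})"
    proof
      fix p assume "p \<in> Q n"
      then obtain i where i: "i \<in> {m * int n<..l * int n}" "int p dvd f i" by (auto simp: Q_def)
      then have "int p \<le> f i" using fp by (intro zdvd_imp_le) auto
      then have "p \<le> nat (f i)" by simp
      then show "p \<in> (\<Union>i\<in>{m * int n<..l * int n}. {..nat (f i)})" using i by blast
    qed
    then show ?thesis by (rule finite_subset) auto
  qed
  have QRQ: "QR r n \<subseteq> Q n" for r n by (auto simp: QR_def Q_def class_primes_def)
  have split: "(\<Sum>p\<in>Q n. ln (real p)) = (\<Sum>p\<in>Q0 n. ln (real p)) + (\<Sum>r\<in>R. \<Sum>p\<in>QR r n. ln (real p))" for n
  proof -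
    have "p \<in> Q0 n \<union> (\<Union>r\<in>R. QR r n)" if p: "p \<in> Q n" for p
    proof (cases "int p dvd q")
      case False
      have "prime p" using p by (simp add: Q_def)
      from class_primes_cover[OF q(1) this False] obtain r
        where "r \<in> {r \<in> {1..q}. gcd r q = 1}" "p \<in> class_primes q r" by (rule bexE)
      then have "r \<in> R" "p \<in> class_primes q r" by (simp_all only: R_def)
      then show ?thesis using p by (auto simp: QR_def Q_def)
    qed (use p in \<open>simp add: Q0_def\<close>)
    then have "Q n \<subseteq> Q0 n \<union> (\<Union>r\<in>R. QR r n)" by (rule subsetI)
    moreover have "Q0 n \<union> (\<Union>r\<in>R. QR r n) \<subseteq> Q n" using QRQ by (auto simp: Q0_def)
    ultimately have "Q n = Q0 n \<union> (\<Union>r\<in>R. QR r n)" by (rule equalityI)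
    moreover have "Q0 n \<inter> (\<Union>r\<in>R. QR r n) = {}"
      using class_primes_not_dvd[OF q(1)] by (auto simp: Q0_def QR_def)
    moreover have "(\<Sum>p\<in>(\<Union>r\<in>R. QR r n). ln (real p)) = (\<Sum>r\<in>R. \<Sum>p\<in>QR r n. ln (real p))"
    proof (rule sum.UNION_disjoint)
      show "\<forall>i\<in>R. \<forall>j\<in>R. i \<noteq> j \<longrightarrow> QR i n \<inter> QR j n = {}"
        using class_primes_disjoint[of _ q] by (auto simp: R_def QR_def)
    qed (auto intro: finR finite_subset[OF QRQ finQ])
    moreover have "finite (Q0 n)" "finite (\<Union>r\<in>R. QR r n)"
      using finQ[of n] finite_subset[OF QRQ finQ] finR by (auto simp: Q0_def)
    ultimately show ?thesis by (simp add: sum.union_disjoint)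
  qed
  have lim0: "(\<lambda>n. (\<Sum>p\<in>Q0 n. ln (real p)) / real n) \<longlonglongrightarrow> 0"
  proof (rule Lim_null_comparison)
    define c where "c = (\<Sum>p | int p dvd q \<and> prime p. ln (real p))"
    have fin: "finite {p. int p dvd q \<and> prime p}" by (rule finite_subset[OF _ fin0]) auto
    show "\<forall>\<^sub>F n in sequentially. norm ((\<Sum>p\<in>Q0 n. ln (real p)) / real n) \<le> c / real n"
    proof (intro always_eventually allI)
      fix n
      have "(\<Sum>p\<in>Q0 n. ln (real p)) \<le> c" unfolding c_def
        by (rule sum_mono2[OF fin]) (auto simp: Q0_def Q_def intro: ln_prime_nonneg)
      moreover have "(\<Sum>p\<in>Q0 n. ln (real p)) \<ge> 0"
        by (intro sum_nonneg) (auto simp: Q0_def Q_def intro: ln_prime_nonneg)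
      ultimately show "norm ((\<Sum>p\<in>Q0 n. ln (real p)) / real n) \<le> c / real n"
        by (simp add: divide_right_mono)
    qed
    show "(\<lambda>n. c / real n) \<longlonglongrightarrow> 0" by (rule lim_const_over_n)
  qed
  have limR: "(\<lambda>n. (\<Sum>p\<in>QR r n. ln (real p)) / real n) \<longlonglongrightarrow> 1 / real (totient (nat q)) * A_coeff l m a1 a2 b1 b2 r"
    if "r \<in> R" for r
    using class_sum_limit[OF lm a b q, of r] that by (simp add: R_def QR_def f)
  have limL: "(\<lambda>n. (L n - (\<Sum>p\<in>Q n. ln (real p))) / real n) \<longlonglongrightarrow> 0"
    unfolding L_def Q_def by (rule ln_Lcm_two_linear_limit[OF lm a b D f])
  define A where "A = (\<Sum>r\<in>R. 1 / real (totient (nat q)) * A_coeff l m a1 a2 b1 b2 r)"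
  have "(\<lambda>n. (L n - (\<Sum>p\<in>Q n. ln (real p))) / real n + ((\<Sum>p\<in>Q0 n. ln (real p)) / real n + (\<Sum>r\<in>R. (\<Sum>p\<in>QR r n. ln (real p)) / real n)) - A)
     \<longlonglongrightarrow> 0 + (0 + A) - A"
    unfolding A_def by (intro tendsto_intros limL lim0 limR)
  moreover have "\<forall>\<^sub>F n in sequentially. (L n - (\<Sum>p\<in>Q n. ln (real p))) / real n + ((\<Sum>p\<in>Q0 n. ln (real p)) / real n + (\<Sum>r\<in>R. (\<Sum>p\<in>QR r n. ln (real p)) / real n)) - A
    = (L n - real n / real (totient (nat q)) * (\<Sum>r\<in>R. A_coeff l m a1 a2 b1 b2 r)) / real n"
    using eventually_gt_at_top[of 0]
  proof eventually_elim
    case (elim n)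
    have "A = real n / real (totient (nat q)) * (\<Sum>r\<in>R. A_coeff l m a1 a2 b1 b2 r) / real n"
      using elim by (simp add: A_def sum_divide_distrib)
    moreover have "(\<Sum>p\<in>Q0 n. ln (real p)) / real n + (\<Sum>r\<in>R. (\<Sum>p\<in>QR r n. ln (real p)) / real n) = (\<Sum>p\<in>Q n. ln (real p)) / real n"
      by (simp add: split add_divide_distrib sum_divide_distrib)
    ultimately show ?case by (simp add: diff_divide_distrib)
  qed
  ultimately have "(\<lambda>n. (L n - real n / real (totient (nat q)) * (\<Sum>r\<in>R. A_coeff l m a1 a2 b1 b2 r)) / real n) \<longlonglongrightarrow> 0"
    by (simp add: Lim_transform_eventually)
  then have "(\<lambda>n. L n - real n / real (totient (nat q)) * (\<Sum>r\<in>R. A_coeff l m a1 a2 b1 b2 r)) \<in> o(\<lambda>n. real n)"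
    by (intro smalloI_tendsto) (auto intro: eventually_mono[OF eventually_gt_at_top[of 0]])
  then show ?thesis unfolding L_def R_def .
qed

end
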